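(* Let $\rho\in(0,1)$, let $\mathrm{Im}(\alpha)>0$, and define $q=e^{2\pi i\alpha}$, $\tilde q=e^{-2\pi i/\alpha}$, with $\sqrt q=e^{\pi i\alpha}$, $\sqrt{\tilde q}=e^{-\pi i/\alpha}$. Then for $|z|<\min\{\sqrt{|q|},\sqrt{|\tilde q|}\}$ and $|\arg(z)|<\pi$ $$\phi(z;\alpha,\rho)=\frac{(-z\sqrt{\tilde q}\,e^{-\pi i\rho};\tilde q)_\infty\,(-z^\alpha\sqrt q\,e^{\pi i\rho\alpha};q)_\infty}{(-z\sqrt{\tilde q}\,e^{\pi i\rho};\tilde q)_\infty\,(-z^\alpha\sqrt q\,e^{-\pi i\rho\alpha};q)_\infty}.$$
   Context: For $|q|<1$, $(a;q)_\infty=\prod_{k\ge0}(1-aq^k)$ is the q-Pochhammer symbol. Powers are principal: $z^\alpha=e^{\alpha\ln z}$, $|\arg z|<\pi$. Definition of $\phi$. The admissible set is $\mathcal A=\{\alpha\in(0,1),\rho\in(0,1)\}\cup\{\alpha=1,\rho=\frac12\}\cup\{\alpha\in(1,2),\rho\in[1-\alpha^{-1},\alpha^{-1}]\}$. For $(\alpha,\rho)\in\mathcal A$, let $X_t$ be the stable Lévy process with $X_0=0$, $\mathbb E[e^{izX_t}]=e^{-t\Psi(z)}$, $z\in\mathbb R$, $\Psi(z)=e^{\pi i\gamma/2}|z|^\alpha$ for $z>0$, $\Psi(z)=e^{-\pi i\gamma/2}|z|^\alpha$ for $z<0$, $\gamma=\alpha(1-2\rho)$; then $\phi(z;\alpha,\rho)=\mathbb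 E[e^{-zS_{e(1)}}]$ for $\mathrm{Re}(z)\ge0$, where $S_t=\sup_{0\le u\le t}X_u$ and $e(1)$ is an independent unit-mean exponential variable. For real $\alpha>0$, $\rho\in(0,1)$ and $z>0$ it is extended (by analytic continuation in the parameters) by $$\phi(z;\alpha,\rho)=\exp\left(\int_0^z\frac{1}{2\pi iu}\left[F(\pi i\rho-\ln u;i/\alpha)-F(-\pi i\rho-\ln u;i/\alpha)\right]du\right),\quad F(w;i/\alpha)=\int_{\mathbb R}\frac{dx}{(1+e^{w-x/\alpha})(1+e^x)}\ (|\mathrm{Im}\,w|<\pi).$$ This function is real-analytic in $(z,\alpha)$; for complex $\alpha$ with $\mathrm{Im}(\alpha)>0$ and complex $z$ with $|\arg z|<\pi$, $\phi(z;\alpha,\rho)$ denotes its analytic (meromorphic) continuation in $(z,\alpha)$ from real $z>0$, $\alpha>0$, so the identity is one between meromorphic functions. *)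

theory Defs
  imports "HOL-Analysis.Analysis"
begin

definition qpoch_inf :: "complex \<Rightarrow> complex \<Rightarrow> complex" where
  "qpoch_inf a q = (\<Prod>k. 1 - a * q ^ k)"

text \<open>
  \<open>stable_F w \<alpha>\<close> is the function \<open>F(w; i/\<alpha>)\<close>, and \<open>stable_phi_real z \<alpha> \<rho>\<close> is
  \<open>\<phi>(z; \<alpha>, \<rho>)\<close> for real \<open>z > 0\<close>, \<open>\<alpha> > 0\<close>, \<open>\<rho> \<in> (0,1)\<close>, given by the integral formula.
  For admissible \<open>(\<alpha>, \<rho>)\<close> the latter is the Laplace transform of the supremum of
  a stable process at an independent exponential time; the formula extends it to all
  \<open>\<alpha> > 0\<close> and \<open>\<rho> \<in> (0,1)\<close>. All integrals are Lebesgue integrals.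
\<close>

definition stable_F :: "complex \<Rightarrow> real \<Rightarrow> complex" where
  "stable_F w \<alpha> =
     (LINT x|lborel. 1 / ((1 + exp (w - of_real (x / \<alpha>))) * (1 + exp (of_real x))))"

definition stable_phi_real :: "real \<Rightarrow> real \<Rightarrow> real \<Rightarrow> complex" where
  "stable_phi_real z \<alpha> \<rho> =
     exp (LINT u:{0<..<z}|lborel.
       1 / (2 * of_real pi * \<i> * of_real u) *
       (stable_F (of_real pi * \<i> * of_real \<rho> - of_real (ln u)) \<alpha>
        - stable_F (- of_real pi * \<i> * of_real \<rho> - of_real (ln u)) \<alpha>))"

text \<open>Holomorphy in two variables: jointly continuous and separately holomorphic.\<close>

definition holomorphic2_on :: "(complex \<times> complex \<Rightarrow> complex) \<Rightarrow> (complex \<times> complex) set \<Rightarrow> bool"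
    (infixl "(holomorphic2'_on)" 50) where
  "f holomorphic2_on U \<longleftrightarrow>
     continuous_on U f \<and>
     (\<forall>b. (\<lambda>z. f (z, b)) holomorphic_on {z. (z, b) \<in> U}) \<and>
     (\<forall>a. (\<lambda>w. f (a, w)) holomorphic_on {w. (a, w) \<in> U})"

text \<open>
  Meromorphy in two variables on an arbitrary set \<open>A\<close> of points (not necessarily open):
  near every point of \<open>A\<close> the function is a quotient \<open>f / g\<close> of holomorphic functions,
  where \<open>g\<close> does not vanish identically on any nonempty open subset of the neighbourhood.
  As in the one-variable notion \<open>nicely_meromorphic_on\<close>, values are normalised:
  where the quotient extends holomorphically the value is that of the extension, and at
  poles and points of indeterminacy it is 0.
\<close>

definition nicely_meromorphic2_on :: "(complex \<times> complex \<Rightarrow> complex) \<Rightarrow> (complex \<times> complex) set \<Rightarrow> bool"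
    (infixl "(nicely'_meromorphic2'_on)" 50) where
  "\<Phi> nicely_meromorphic2_on A \<longleftrightarrow>
     (\<forall>p\<in>A. \<exists>U f g. open U \<and> p \<in> U \<and> f holomorphic2_on U \<and> g holomorphic2_on U \<and>
        U \<subseteq> closure {x \<in> U. g x \<noteq> 0} \<and>
        (\<forall>x\<in>U. g x \<noteq> 0 \<longrightarrow> \<Phi> x = f x / g x) \<and>
        (g p = 0 \<longrightarrow> \<Phi> p = 0 \<and>
           \<not> (\<exists>V h. open V \<and> p \<in> V \<and> V \<subseteq> U \<and> h holomorphic2_on V \<and>
                (\<forall>x\<in>V. h x * g x = f x))))"

definition real_params :: "(complex \<times> complex) set" where
  "real_params = {(of_real z, of_real \<alpha>) | z \<alpha>. z > (0::real) \<and> \<alpha> > (0::real)}"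

definition upper_params :: "(complex \<times> complex) set" where
  "upper_params = {(z, \<alpha>). z \<noteq> 0 \<and> \<bar>Arg z\<bar> < pi \<and> Im \<alpha> > 0}"

text \<open>
  \<open>real_params\<close> lies in the closure of the connected open set \<open>upper_params\<close>. A
  meromorphic function on the union is meromorphic near every point of \<open>real_params\<close>, so
  its normalised values on the union are determined by those on \<open>real_params\<close>:
  there is at most one meromorphic continuation.
\<close>

definition is_stable_phi_continuation :: "real \<Rightarrow> (complex \<times> complex \<Rightarrow> complex) \<Rightarrow> bool" where
  "is_stable_phi_continuation \<rho> \<Phi> \<longleftrightarrow>
     \<Phi> nicely_meromorphic2_on (real_params \<union> upper_params) \<and>
     (\<forall>z \<alpha>. z > 0 \<longrightarrow> \<alpha> > 0 \<longrightarrow> \<Phi> (of_real z, of_real \<alpha>) = stable_phi_real z \<alpha> \<rho>)"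

definition stable_phi :: "complex \<Rightarrow> complex \<Rightarrow> real \<Rightarrow> complex" where
  "stable_phi z \<alpha> \<rho> = (SOME \<Phi>. is_stable_phi_continuation \<rho> \<Phi>) (z, \<alpha>)"

end

theory Submission
  imports Defs "HOL-Complex_Analysis.Complex_Analysis"
begin

text \<open>
  Put \<open>r = \<pi>\<rho>\<close> and \<open>z = e^t\<close>. Subtracting the two values of \<open>F\<close> and rescaling the variable of
  integration turns the defining formula into
  \<open>\<phi>(e^t) = exp (- \<alpha> / 2\<pi> \<cdot> \<integral>_{s<t} I(s, \<alpha>) ds)\<close> with
  \<open>I(t, \<alpha>) = \<integral> K(t + y) / (1 + e^{\<alpha>y}) dy\<close>, where
  \<open>K(s) = sin r / (cosh s + cos r)\<close>. Now \<open>\<alpha>\<close> occurs only in a denominator that has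
  no zero on the real line when \<open>Re \<alpha> > 0\<close>, so the formula is holomorphic in \<open>(t, \<alpha>)\<close> for
  \<open>\<bar>Im t\<bar> < \<pi> - r\<close> and \<open>Re \<alpha> > 0\<close>, a complex neighbourhood of all real parameters
  (\<open>holomorphic2_on_stable_phi_at_exp\<close>, \<open>stable_phi_real_eq\<close>).

  The product formula comes from moving the line of integration. The kernel \<open>K\<close> has period
  \<open>2\<pi>\<i>\<close>. If \<open>1/\<alpha> = 1 - \<i>v\<close> with \<open>v > 0\<close>, then replacing \<open>y\<close> by \<open>y - 2\<pi>\<i>\<close> in
  \<open>1 + e^{\<alpha>y}\<close> has the same effect as replacing it by \<open>y + 2\<pi>v\<close>. Hence
  \<open>I(t - 2\<pi>v) - I(t)\<close> is a sum of residues, at only three poles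
  (\<open>fermi_integral_shift\<close>), and these are the logarithmic derivatives of
  elementary factors. Integration yields \<open>\<phi>(e^t) = R(t) \<phi>(e^{t - 2\<pi>v})\<close> with an explicit quotient
  \<open>R\<close> of such factors (\<open>stable_phi_at_exp_functional_equation\<close>). On this curve of parameters the shift by
  \<open>-2\<pi>v\<close> multiplies \<open>z\<close> by the nome \<open>e^{-2\<pi>\<i>/\<alpha>}\<close> and \<open>z^\<alpha>\<close> by the nome \<open>e^{2\<pi>\<i>\<alpha>}\<close>, so that iterating the
  equation, with \<open>\<phi> \<longrightarrow> 1\<close> as \<open>z \<longrightarrow> 0\<close>, produces the infinite products. The curve has accumulation
  points, and the identity theorem in two variables extends the formula to
  \<open>\<bar>Im t\<bar> < \<pi> - r\<close>, \<open>Re \<alpha> > 0\<close>, \<open>Im \<alpha> > 0\<close> (\<open>stable_phi_at_exp_product\<close>).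

  Therefore the quotient of products, which is meromorphic for all \<open>z\<close> in the slit plane and all
  \<open>\<alpha>\<close> in the upper half-plane, continues \<open>\<phi>\<close>; a continuation exists
  (\<open>stable_phi_continuation_exists\<close>). Conversely every continuation agrees with the quotient on
  a dense set near a real parameter, and then, by connectedness, on a dense set near every
  parameter. At a point where numerator and denominator do not both vanish this fixes the
  normalised value
  (\<open>stable_phi_continuation_unique\<close>). For \<open>\<bar>z\<bar>\<close> below the square root of \<open>\<bar>e^{-2\<pi>\<i>/\<alpha>}\<bar>\<close>
  there is no common zero: the products in \<open>z\<close> do not vanish at all, and those in \<open>z^\<alpha>\<close> have
  disjoint zero sets because \<open>0 < \<rho> < 1\<close>. At the poles both sides have the value 0.
\<close>

section \<open>Holomorphic functions of two variables\<close>

lemma holomorphic2_on_continuous: "f holomorphic2_on U \<Longrightarrow> continuous_on U f"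
  by (simp add: holomorphic2_on_def)

lemma holomorphic2_on_subset:
  assumes "f holomorphic2_on U" "V \<subseteq> U"
  shows "f holomorphic2_on V"
  using assms unfolding holomorphic2_on_def
  by (auto intro: continuous_on_subset holomorphic_on_subset)

lemma holomorphic2_on_slice1:
  assumes "f holomorphic2_on U" "\<And>z. z \<in> A \<Longrightarrow> (z, w) \<in> U"
  shows "(\<lambda>z. f (z, w)) holomorphic_on A"
  using assms unfolding holomorphic2_on_def
  by (auto intro: holomorphic_on_subset)

lemma holomorphic2_on_slice2:
  assumes "f holomorphic2_on U" "\<And>w. w \<in> B \<Longrightarrow> (z, w) \<in> U"
  shows "(\<lambda>w. f (z, w)) holomorphic_on B"
  using assms unfolding holomorphic2_on_def
  by (auto intro: holomorphic_on_subset)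

lemma holomorphic2_on_const: "(\<lambda>p. c) holomorphic2_on U"
  and holomorphic2_on_fst: "fst holomorphic2_on U"
  and holomorphic2_on_snd: "snd holomorphic2_on U"
  unfolding holomorphic2_on_def
  by (auto intro!: continuous_intros holomorphic_intros)

lemma holomorphic2_on_add:
  "f holomorphic2_on U \<Longrightarrow> g holomorphic2_on U \<Longrightarrow> (\<lambda>p. f p + g p) holomorphic2_on U"
  unfolding holomorphic2_on_def by (auto intro!: continuous_intros holomorphic_intros)

lemma holomorphic2_on_diff:
  "f holomorphic2_on U \<Longrightarrow> g holomorphic2_on U \<Longrightarrow> (\<lambda>p. f p - g p) holomorphic2_on U"
  unfolding holomorphic2_on_def by (auto intro!: continuous_intros holomorphic_intros)

lemma holomorphic2_on_mult:
  "f holomorphic2_on U \<Longrightarrow> g holomorphic2_on U \<Longrightarrow> (\<lambda>p. f p * g p) holomorphic2_on U"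
  unfolding holomorphic2_on_def by (auto intro!: continuous_intros holomorphic_intros)

lemma holomorphic2_on_divide:
  "f holomorphic2_on U \<Longrightarrow> g holomorphic2_on U \<Longrightarrow> (\<And>p. p \<in> U \<Longrightarrow> g p \<noteq> 0) \<Longrightarrow>
     (\<lambda>p. f p / g p) holomorphic2_on U"
  unfolding holomorphic2_on_def by (auto intro!: continuous_intros holomorphic_intros)

lemma holomorphic2_on_exp:
  "f holomorphic2_on U \<Longrightarrow> (\<lambda>p. exp (f p)) holomorphic2_on U"
  unfolding holomorphic2_on_def by (auto intro!: continuous_intros holomorphic_intros)

lemmas holomorphic2_intros =
  holomorphic2_on_const holomorphic2_on_fst holomorphic2_on_snd holomorphic2_on_add holomorphic2_on_diff
  holomorphic2_on_mult holomorphic2_on_divide holomorphic2_on_exp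

lemma holomorphic2_on_compose_fst:
  assumes f: "f holomorphic2_on U" and g: "g holomorphic_on A"
    and W: "\<And>z w. (z, w) \<in> W \<Longrightarrow> z \<in> A \<and> (g z, w) \<in> U"
  shows "(\<lambda>p. f (g (fst p), snd p)) holomorphic2_on W"
  unfolding holomorphic2_on_def
proof (intro conjI allI)
  have "continuous_on W (\<lambda>p. g (fst p))"
    by (rule continuous_on_compose2[OF holomorphic_on_imp_continuous_on[OF g]])
       (use W in \<open>auto intro!: continuous_intros\<close>)
  thus "continuous_on W (\<lambda>p. f (g (fst p), snd p))"
    by (intro continuous_on_compose2[OF holomorphic2_on_continuous[OF f]] continuous_intros)
       (use W in auto)
next
  fix b
  have "((\<lambda>z. f (z, b)) \<circ> g) holomorphic_on {z. (z, b) \<in> W}"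
    using W by (intro holomorphic_on_compose_gen[of _ _ _ "g ` {z. (z, b) \<in> W}"]
        holomorphic_on_subset[OF g] holomorphic2_on_slice1[OF f]) auto
  thus "(\<lambda>z. f (g (fst (z, b)), snd (z, b))) holomorphic_on {z. (z, b) \<in> W}"
    by (simp add: o_def)
next
  fix a
  show "(\<lambda>w. f (g (fst (a, w)), snd (a, w))) holomorphic_on {w. (a, w) \<in> W}"
    using W by (auto intro!: holomorphic2_on_slice2[OF f])
qed

text \<open>
  The one-variable identity theorem, applied first in the second and then in the first
  variable. Sets \<open>X\<close> and \<open>Y\<close> with an accumulation point are enough, which covers open sets,
  real points, and the parameter curve along which the product formula is computed.
\<close>

lemma holomorphic2_eq_zero:
  assumes f: "f holomorphic2_on A \<times> B"
    and A: "open A" "connected A" and B: "open B" "connected B"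
    and X: "X \<subseteq> A" "\<xi> \<in> A" "\<xi> islimpt X"
    and Y: "Y \<subseteq> B" "\<eta> \<in> B" "\<eta> islimpt Y"
    and zero: "\<And>x y. x \<in> X \<Longrightarrow> y \<in> Y \<Longrightarrow> f (x, y) = 0"
    and "z \<in> A" "w \<in> B"
  shows "f (z, w) = 0"
proof -
  have "f (x, w) = 0" if x: "x \<in> X" for x
  proof (rule analytic_continuation[OF _ B Y, of "\<lambda>w. f (x, w)"])
    show "(\<lambda>w. f (x, w)) holomorphic_on B"
      using x X(1) by (intro holomorphic2_on_slice2[OF f]) blast
  qed (use x zero \<open>w \<in> B\<close> in blast)+
  moreover have "(\<lambda>z. f (z, w)) holomorphic_on A"
    using \<open>w \<in> B\<close> by (intro holomorphic2_on_slice1[OF f]) blast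
  ultimately show ?thesis
    using analytic_continuation[OF _ A X, of "\<lambda>z. f (z, w)"] \<open>z \<in> A\<close> by blast
qed

lemma islimpt_injective_image:
  fixes f :: "'a :: metric_space \<Rightarrow> 'b :: metric_space"
  assumes "x islimpt S" "isCont f x" "\<And>y. y \<in> S \<Longrightarrow> y \<noteq> x \<Longrightarrow> f y \<noteq> f x"
  shows "f x islimpt f ` S"
proof -
  obtain u where u: "\<And>n. u n \<in> S - {x}" "u \<longlonglongrightarrow> x"
    using assms(1) unfolding islimpt_sequential by blast
  have "(\<lambda>n. f (u n)) \<longlonglongrightarrow> f x" by (rule isCont_tendsto_compose[OF assms(2) u(2)])
  moreover have "f (u n) \<in> f ` S - {f x}" for n using u(1)[of n] assms(3) by auto
  ultimately show ?thesis
    unfolding islimpt_sequential by (intro exI[of _ "\<lambda>n. f (u n)"]) blast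
qed

lemma islimpt_of_real_image:
  assumes "open S" "x \<in> S"
  shows "(of_real x :: complex) islimpt of_real ` S"
  by (rule islimpt_injective_image) (use assms in \<open>auto intro!: interior_limit_point simp: interior_open\<close>)

lemma open_product_ball:
  assumes "open V" "(a :: 'a :: metric_space, b :: 'b :: metric_space) \<in> V"
  obtains r where "r > 0" "ball a r \<times> ball b r \<subseteq> V"
proof -
  obtain A B where AB: "open A" "open B" "a \<in> A" "b \<in> B" "A \<times> B \<subseteq> V"
    using assms open_prod_elim by (metis mem_Sigma_iff)
  obtain r s where "r > 0" "ball a r \<subseteq> A" "s > 0" "ball b s \<subseteq> B"
    using AB by (meson openE)
  hence "ball a (min r s) \<times> ball b (min r s) \<subseteq> V" "min r s > 0"
    using AB by fastforce+
  thus ?thesis using that by blast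
qed

lemma holomorphic2_eq_zero_open:
  assumes f: "f holomorphic2_on A \<times> B"
    and A: "open A" "connected A" and B: "open B" "connected B"
    and V: "open V" "V \<noteq> {}" "V \<subseteq> A \<times> B" and zero: "\<And>p. p \<in> V \<Longrightarrow> f p = 0"
    and p: "p \<in> A \<times> B"
  shows "f p = 0"
proof -
  obtain a b where ab: "(a, b) \<in> V" using V by (metis ex_in_conv surj_pair)
  then obtain r where r: "r > 0" "ball a r \<times> ball b r \<subseteq> V"
    using open_product_ball V(1) by blast
  obtain z w where zw: "p = (z, w)" by (cases p)
  have lim: "a islimpt ball a r" "b islimpt ball b r"
    using r(1) by (auto simp: islimpt_ball)
  have "ball a r \<times> ball b r \<subseteq> A \<times> B" using r(2) V(3) by blast
  hence sub: "ball a r \<subseteq> A" "ball b r \<subseteq> B"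
    using r(1) by (auto simp: times_subset_iff)
  have "f (z, w) = 0"
  proof (rule holomorphic2_eq_zero[OF f A B sub(1) _ lim(1) sub(2) _ lim(2)])
    show "f (x, y) = 0" if "x \<in> ball a r" "y \<in> ball b r" for x y
      using that r(2) by (intro zero) blast
  qed (use ab V p zw in blast)+
  thus ?thesis by (simp add: zw)
qed

text \<open>
  Cauchy's estimate on a disc turns the bound on the integrand into a bound on its difference
  quotients, so the derivative can be taken under the integral by dominated convergence.
\<close>

lemma holomorphic_on_integral_dominated:
  fixes f :: "complex \<Rightarrow> 'a \<Rightarrow> complex"
  assumes hol: "\<And>x. x \<in> space M \<Longrightarrow> (\<lambda>z. f z x) holomorphic_on W"
    and meas: "\<And>z. z \<in> W \<Longrightarrow> f z \<in> borel_measurable M"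
    and dom: "\<And>z. z \<in> W \<Longrightarrow> \<exists>V g. open V \<and> z \<in> V \<and> V \<subseteq> W \<and> integrable M g \<and>
                (\<forall>w\<in>V. \<forall>x\<in>space M. norm (f w x) \<le> g x)"
  shows "(\<lambda>z. integral\<^sup>L M (f z)) holomorphic_on W"
proof -
  have "(\<lambda>z. integral\<^sup>L M (f z)) field_differentiable (at z)" if z: "z \<in> W" for z
  proof -
    obtain V g where V: "open V" "z \<in> V" "V \<subseteq> W" and g: "integrable M g"
      and bd: "\<And>w x. w \<in> V \<Longrightarrow> x \<in> space M \<Longrightarrow> norm (f w x) \<le> g x"
      using dom[OF z] by blast
    obtain r where r: "r > 0" "ball z (2 * r) \<subseteq> V"
      using V(1,2) by (metis mult.commute openE field_sum_of_halves half_gt_zero mult_2_right)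
    have hol': "(\<lambda>z. f z x) holomorphic_on ball z (2 * r)" if "x \<in> space M" for x
      using holomorphic_on_subset[OF hol[OF that]] r V by blast
    have lip: "norm ((f w x - f z x) / (w - z)) \<le> g x / r"
      if w: "w \<in> ball z r - {z}" and x: "x \<in> space M" for w x
    proof -
      have "norm (f w x - f z x) \<le> g x / r * norm (w - z)"
      proof (rule field_differentiable_bound[where S = "ball z r" and f' = "deriv (\<lambda>z. f z x)"])
        fix u assume u: "u \<in> ball z r"
        hence sub: "cball u r \<subseteq> ball z (2 * r)"
          by (smt (verit) dist_triangle mem_ball mem_cball subsetI)
        show "((\<lambda>z. f z x) has_field_derivative deriv (\<lambda>z. f z x) u) (at u within ball z r)"
          using hol'[OF x] u r
          by (intro holomorphic_derivI[of _ "ball z (2 * r)"]) auto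
        have "norm ((deriv ^^ 1) (\<lambda>z. f z x) u) \<le> fact 1 * g x / r ^ 1"
        proof (rule Cauchy_inequality)
          show "(\<lambda>z. f z x) holomorphic_on ball u r"
            using hol'[OF x] sub by (meson ball_subset_cball holomorphic_on_subset subset_trans)
          show "continuous_on (cball u r) (\<lambda>z. f z x)"
            using hol'[OF x] sub
            by (meson continuous_on_subset holomorphic_on_imp_continuous_on)
          fix y assume "norm (u - y) = r"
          hence "y \<in> cball u r" by (simp add: dist_norm)
          thus "norm (f y x) \<le> g x" using sub r bd x by blast
        qed (use r in auto)
        thus "norm (deriv (\<lambda>z. f z x) u) \<le> g x / r" by simp
      qed (use w r in auto)
      thus ?thesis using w by (simp add: norm_divide divide_simps split: if_splits)
    qed
    have intf: "integrable M (f w)" if "w \<in> V" for w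
      using that V meas bd
      by (intro Bochner_Integration.integrable_bound[OF g]) (auto intro!: AE_I2 order_trans[OF bd])
    define D where "D = integral\<^sup>L M (\<lambda>x. deriv (\<lambda>z. f z x) z)"
    have lim: "(\<lambda>n. (f (X n) x - f z x) / (X n - z)) \<longlonglongrightarrow> deriv (\<lambda>z. f z x) z"
      if X: "\<And>n. X n \<in> ball z r - {z}" "X \<longlonglongrightarrow> z" and x: "x \<in> space M" for X x
    proof -
      have "((\<lambda>z. f z x) has_field_derivative deriv (\<lambda>z. f z x) z) (at z within ball z r)"
        using hol'[OF x] r by (intro holomorphic_derivI[of _ "ball z (2 * r)"]) auto
      hence "((\<lambda>y. (f y x - f z x) / (y - z)) \<longlongrightarrow> deriv (\<lambda>z. f z x) z) (at z within ball z r)"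
        by (simp add: has_field_derivative_iff)
      thus ?thesis
        using X unfolding tendsto_at_iff_sequentially o_def by blast
    qed
    have "((\<lambda>y. (integral\<^sup>L M (f y) - integral\<^sup>L M (f z)) / (y - z)) \<longlongrightarrow> D) (at z within ball z r)"
      unfolding tendsto_at_iff_sequentially
    proof (intro allI impI)
      fix X assume X: "\<forall>i. X i \<in> ball z r - {z}" "X \<longlonglongrightarrow> z"
      have XV: "X n \<in> V" for n
        using X(1) r by (metis DiffD1 ball_subset_ball_iff in_mono le_add_same_cancel1 less_eq_real_def mult_2 dist_self add.left_neutral)
      have "(\<lambda>n. integral\<^sup>L M (\<lambda>x. (f (X n) x - f z x) / (X n - z))) \<longlonglongrightarrow> D"
        unfolding D_def
      proof (rule integral_dominated_convergence[where w = "\<lambda>x. g x / r"])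
        show 1: "(\<lambda>x. (f (X n) x - f z x) / (X n - z)) \<in> borel_measurable M" for n
          using intf[OF XV, of n] intf[OF V(2)] by measurable
        show "(\<lambda>x. deriv (\<lambda>z. f z x) z) \<in> borel_measurable M"
          by (rule borel_measurable_LIMSEQ_metric[OF 1, of "\<lambda>n. n"]) (use lim X in blast)
        show "integrable M (\<lambda>x. g x / r)" using g by simp
        show "AE x in M. (\<lambda>n. (f (X n) x - f z x) / (X n - z)) \<longlonglongrightarrow> deriv (\<lambda>z. f z x) z"
          using lim X by (intro AE_I2) blast
        show "AE x in M. norm ((f (X n) x - f z x) / (X n - z)) \<le> g x / r" for n
          using lip X by (intro AE_I2) blast
      qed
      also have "(\<lambda>n. integral\<^sup>L M (\<lambda>x. (f (X n) x - f z x) / (X n - z))) =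
                 (\<lambda>n. (integral\<^sup>L M (f (X n)) - integral\<^sup>L M (f z)) / (X n - z))"
        using intf XV V(2) by simp
      finally show "((\<lambda>y. (integral\<^sup>L M (f y) - integral\<^sup>L M (f z)) / (y - z)) \<circ> X) \<longlonglongrightarrow> D"
        by (simp add: o_def)
    qed
    hence "((\<lambda>z. integral\<^sup>L M (f z)) has_field_derivative D) (at z within ball z r)"
      by (simp add: has_field_derivative_iff)
    thus ?thesis
      using r(1) by (metis at_within_ball centre_in_ball field_differentiable_def at_within_open open_ball)
  qed
  thus ?thesis
    by (auto simp: holomorphic_on_def intro: field_differentiable_at_within)
qed

text \<open>
  The weight \<open>c\<close> absorbs bounds that grow with the parameters, as is the case for \<open>e^{b Re t}\<close> below; on
  a smaller neighbourhood it is bounded by a constant.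
\<close>

lemma holomorphic2_on_integral:
  fixes f :: "complex \<times> complex \<Rightarrow> 'a \<Rightarrow> complex"
  assumes "open W"
    and hol: "\<And>x. x \<in> space M \<Longrightarrow> (\<lambda>p. f p x) holomorphic2_on W"
    and meas: "\<And>p. p \<in> W \<Longrightarrow> f p \<in> borel_measurable M"
    and weighted_dom: "\<And>p. p \<in> W \<Longrightarrow> \<exists>V (c :: _ \<Rightarrow> real) g. open V \<and> p \<in> V \<and> V \<subseteq> W \<and>
           continuous_on V c \<and> integrable M g \<and> (\<forall>q\<in>V. \<forall>x\<in>space M. norm (f q x) \<le> c q * g x)"
  shows "(\<lambda>p. integral\<^sup>L M (f p)) holomorphic2_on W"
proof -
  have dom: "\<exists>V g. open V \<and> p \<in> V \<and> V \<subseteq> W \<and> integrable M g \<and>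
                (\<forall>q\<in>V. \<forall>x\<in>space M. norm (f q x) \<le> g x)" if p: "p \<in> W" for p
  proof -
    obtain V g and c :: "complex \<times> complex \<Rightarrow> real" where V: "open V" "p \<in> V" "V \<subseteq> W"
      and c: "continuous_on V c" and g: "integrable M g"
      and bd: "\<And>q x. q \<in> V \<Longrightarrow> x \<in> space M \<Longrightarrow> norm (f q x) \<le> c q * g x"
      using weighted_dom[OF p] by blast
    define V' where "V' = V \<inter> (\<lambda>q. \<bar>c q\<bar>) -` {..<\<bar>c p\<bar> + 1}"
    have "open V'" unfolding V'_def
      by (intro continuous_open_preimage V continuous_intros c)
    moreover have "norm (f q x) \<le> (\<bar>c p\<bar> + 1) * \<bar>g x\<bar>" if "q \<in> V'" "x \<in> space M" for q x
    proof -
      have "norm (f q x) \<le> \<bar>c q * g x\<bar>" using bd[of q x] that by (auto simp: V'_def)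
      also have "\<dots> \<le> (\<bar>c p\<bar> + 1) * \<bar>g x\<bar>"
        unfolding abs_mult using that by (intro mult_right_mono) (auto simp: V'_def)
      finally show ?thesis .
    qed
    moreover have "integrable M (\<lambda>x. (\<bar>c p\<bar> + 1) * \<bar>g x\<bar>)" using g by simp
    ultimately show ?thesis
      using V by (intro exI[of _ V'] exI[of _ "\<lambda>x. (\<bar>c p\<bar> + 1) * \<bar>g x\<bar>"]) (auto simp: V'_def)
  qed
  have "continuous_on W (\<lambda>p. integral\<^sup>L M (f p))"
    unfolding continuous_on_eq_continuous_at[OF \<open>open W\<close>]
  proof
    fix p assume p: "p \<in> W"
    obtain V g where V: "open V" "p \<in> V" "V \<subseteq> W" and g: "integrable M g"
      and bd: "\<And>w x. w \<in> V \<Longrightarrow> x \<in> space M \<Longrightarrow> norm (f w x) \<le> g x"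
      using dom[OF p] by blast
    have "((\<lambda>p. integral\<^sup>L M (f p)) \<longlongrightarrow> integral\<^sup>L M (f p)) (at p within V)"
      unfolding tendsto_at_iff_sequentially o_def
    proof (intro allI impI)
      fix X assume X: "\<forall>i. X i \<in> V - {p}" "X \<longlonglongrightarrow> p"
      show "(\<lambda>n. integral\<^sup>L M (f (X n))) \<longlonglongrightarrow> integral\<^sup>L M (f p)"
      proof (rule integral_dominated_convergence[where w = g])
        show "AE x in M. (\<lambda>n. f (X n) x) \<longlonglongrightarrow> f p x"
        proof (rule AE_I2)
          fix x assume x: "x \<in> space M"
          show "(\<lambda>n. f (X n) x) \<longlonglongrightarrow> f p x"
            by (rule continuous_on_tendsto_compose[OF holomorphic2_on_continuous[OF hol[OF x]]])
               (use X V p in \<open>auto intro!: always_eventually\<close>)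
        qed
        show "AE x in M. norm (f (X n) x) \<le> g x" for n
          using X bd by (intro AE_I2) blast
      qed (use X V meas p g in blast)+
    qed
    thus "continuous (at p) (\<lambda>p. integral\<^sup>L M (f p))"
      using at_within_open[OF V(2,1)] by (simp add: continuous_within)
  qed
  moreover have slice: "(\<lambda>z. integral\<^sup>L M (f (c z))) holomorphic_on {z. c z \<in> W}"
    if c: "continuous_on UNIV c" and hol_c: "\<And>x. x \<in> space M \<Longrightarrow> (\<lambda>z. f (c z) x) holomorphic_on {z. c z \<in> W}"
    for c :: "complex \<Rightarrow> complex \<times> complex"
  proof (rule holomorphic_on_integral_dominated)
    fix z assume z: "z \<in> {z. c z \<in> W}"
    then obtain V g where V: "open V" "c z \<in> V" "V \<subseteq> W" and g: "integrable M g"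
      and bd: "\<And>w x. w \<in> V \<Longrightarrow> x \<in> space M \<Longrightarrow> norm (f w x) \<le> g x"
      using dom[of "c z"] by blast
    have "open (c -` V)" by (rule open_vimage[OF V(1) c])
    thus "\<exists>V' g. open V' \<and> z \<in> V' \<and> V' \<subseteq> {z. c z \<in> W} \<and> integrable M g \<and>
                (\<forall>w\<in>V'. \<forall>x\<in>space M. norm (f (c w) x) \<le> g x)"
      using V g bd by (intro exI[of _ "c -` V"] exI[of _ g]) auto
  qed (use hol_c meas in auto)
  have "(\<lambda>z. integral\<^sup>L M (f (z, b))) holomorphic_on {z. (z, b) \<in> W}" for b
    using hol by (intro slice[of "\<lambda>z. (z, b)"]) (auto simp: holomorphic2_on_def intro!: continuous_intros)
  moreover have "(\<lambda>w. integral\<^sup>L M (f (a, w))) holomorphic_on {w. (a, w) \<in> W}" for a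
    using hol by (intro slice[of "\<lambda>w. (a, w)"]) (auto simp: holomorphic2_on_def intro!: continuous_intros)
  ultimately show ?thesis
    unfolding holomorphic2_on_def by blast
qed

section \<open>The infinite q-Pochhammer symbol\<close>

lemma convergent_prod_qpoch:
  fixes a q :: complex
  assumes "norm q < 1"
  shows "convergent_prod (\<lambda>k. 1 - a * q ^ k)"
proof -
  have "summable (\<lambda>k. norm a * norm q ^ k)"
    using assms by (intro summable_mult summable_geometric) simp
  thus ?thesis
    by (intro abs_convergent_prod_imp_convergent_prod summable_imp_abs_convergent_prod)
       (simp_all add: norm_mult norm_power)
qed

lemma qpoch_LIMSEQ:
  assumes "norm q < 1"
  shows "(\<lambda>n. \<Prod>k<n. 1 - a * q ^ k) \<longlonglongrightarrow> qpoch_inf a q"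
  unfolding qpoch_inf_def
  by (rule convergent_prod_LIMSEQ[OF convergent_prod_qpoch[OF assms], THEN LIMSEQ_lessThan_iff_atMost[THEN iffD2]])

lemma qpoch_nonzero_iff:
  assumes "norm q < 1"
  shows "qpoch_inf a q \<noteq> 0 \<longleftrightarrow> (\<forall>k. a * q ^ k \<noteq> 1)"
proof
  assume *: "\<forall>k. a * q ^ k \<noteq> 1"
  show "qpoch_inf a q \<noteq> 0"
    unfolding qpoch_inf_def using * by (intro prodinf_nonzero convergent_prod_qpoch assms) auto
next
  assume *: "qpoch_inf a q \<noteq> 0"
  show "\<forall>k. a * q ^ k \<noteq> 1"
  proof (intro allI notI)
    fix k assume k: "a * q ^ k = 1"
    have "eventually (\<lambda>n. (\<Prod>k<n. 1 - a * q ^ k) = 0) sequentially"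
      using eventually_gt_at_top[of k] by eventually_elim (use k in auto)
    hence "(\<lambda>n. \<Prod>k<n. 1 - a * q ^ k) \<longlonglongrightarrow> 0"
      by (simp add: tendsto_eventually)
    with qpoch_LIMSEQ[OF assms, of a] have "qpoch_inf a q = 0"
      using LIMSEQ_unique by blast
    with * show False by simp
  qed
qed

lemma uniform_limit_qpoch:
  fixes A r :: real
  assumes "r < 1"
  shows "uniform_limit (cball 0 A \<times> cball 0 r) (\<lambda>n p. \<Prod>k<n. 1 - fst p * snd p ^ k)
           (\<lambda>p. qpoch_inf (fst p) (snd p)) sequentially"
proof -
  define S where "S = (cball 0 A \<times> cball 0 r :: (complex \<times> complex) set)"
  have "uniformly_convergent_on S (\<lambda>N p. \<Prod>k<N. 1 + (- (fst p * snd p ^ k)))"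
  proof (rule uniformly_convergent_on_prod)
    show "compact S" unfolding S_def by (intro compact_Times compact_cball)
    show "uniformly_convergent_on S (\<lambda>N p. \<Sum>n<N. norm (- (fst p * snd p ^ n)))"
    proof (rule Weierstrass_m_test'_ev)
      show "\<forall>\<^sub>F n in sequentially. \<forall>p\<in>S. norm (norm (- (fst p * snd p ^ n))) \<le> \<bar>A\<bar> * (max r 0) ^ n"
      proof (intro always_eventually allI ballI)
        fix n p assume "p \<in> S"
        hence "norm (fst p) \<le> \<bar>A\<bar>" "norm (snd p) \<le> (max r 0)" by (auto simp: S_def)
        thus "norm (norm (- (fst p * snd p ^ n))) \<le> \<bar>A\<bar> * (max r 0) ^ n"
          by (auto simp: norm_mult norm_power intro!: mult_mono power_mono)
      qed
      show "summable (\<lambda>n. \<bar>A\<bar> * (max r 0) ^ n)"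
        using assms by (intro summable_mult summable_geometric) simp
    qed
  qed (auto intro!: continuous_intros)
  hence "uniform_limit S (\<lambda>n p. \<Prod>k<n. 1 - fst p * snd p ^ k)
           (\<lambda>p. lim (\<lambda>n. \<Prod>k<n. 1 - fst p * snd p ^ k)) sequentially"
    by (simp add: uniformly_convergent_uniform_limit_iff)
  moreover have "lim (\<lambda>n. \<Prod>k<n. 1 - fst p * snd p ^ k) = qpoch_inf (fst p) (snd p)" if "p \<in> S" for p
  proof (rule limI[OF qpoch_LIMSEQ])
    show "norm (snd p) < 1" using that assms by (auto simp: S_def)
  qed
  ultimately show ?thesis
    unfolding S_def[symmetric] by (simp cong: uniform_limit_cong')
qed

text \<open>
  Both arguments may vary, because in the product formula the nomes depend on \<open>\<alpha>\<close> as well.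
\<close>

lemma holomorphic_on_qpoch:
  assumes "open S" and a: "a holomorphic_on S" and q: "q holomorphic_on S"
    and lt: "\<And>w. w \<in> S \<Longrightarrow> norm (q w) < 1"
  shows "(\<lambda>w. qpoch_inf (a w) (q w)) holomorphic_on S"
proof (rule holomorphic_uniform_sequence[OF \<open>open S\<close>, of "\<lambda>n w. \<Prod>k<n. 1 - a w * q w ^ k"])
  fix x assume x: "x \<in> S"
  then obtain d where d: "d > 0" "cball x d \<subseteq> S"
    using \<open>open S\<close> by (meson open_contains_cball)
  have cont: "continuous_on (cball x d) (\<lambda>w. norm (a w))" "continuous_on (cball x d) (\<lambda>w. norm (q w))"
    using a q d by (auto intro!: continuous_on_norm intro: continuous_on_subset holomorphic_on_imp_continuous_on)
  have ne: "cball x d \<noteq> {}" using d by simp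
  obtain u where u: "u \<in> cball x d" "\<And>w. w \<in> cball x d \<Longrightarrow> norm (q w) \<le> norm (q u)"
    using continuous_attains_sup[OF compact_cball ne cont(2)] by blast
  obtain v where v: "v \<in> cball x d" "\<And>w. w \<in> cball x d \<Longrightarrow> norm (a w) \<le> norm (a v)"
    using continuous_attains_sup[OF compact_cball ne cont(1)] by blast
  have "uniform_limit (cball 0 (norm (a v)) \<times> cball 0 (norm (q u))) (\<lambda>n p. \<Prod>k<n. 1 - fst p * snd p ^ k)
          (\<lambda>p. qpoch_inf (fst p) (snd p)) sequentially"
    using u(1) d lt by (intro uniform_limit_qpoch) blast
  hence "uniform_limit (cball x d) (\<lambda>n w. \<Prod>k<n. 1 - a w * q w ^ k)
          (\<lambda>w. qpoch_inf (a w) (q w)) sequentially"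
    unfolding uniform_limit_iff by (elim all_forward imp_forward eventually_mono) (use u v in auto)
  thus "\<exists>d>0. cball x d \<subseteq> S \<and> uniform_limit (cball x d) (\<lambda>n w. \<Prod>k<n. 1 - a w * q w ^ k)
          (\<lambda>w. qpoch_inf (a w) (q w)) sequentially"
    using d by blast
qed (intro holomorphic_intros a q)

lemma continuous_on_qpoch: "continuous_on (UNIV \<times> ball 0 1) (\<lambda>p. qpoch_inf (fst p) (snd p))"
proof -
  have "continuous (at (a, q)) (\<lambda>p. qpoch_inf (fst p) (snd p))" if q: "norm q < 1" for a q
  proof -
    obtain r where r: "norm q < r" "r < 1" using q dense by blast
    let ?S = "cball 0 (norm a + 1) \<times> cball 0 r :: (complex \<times> complex) set"
    have "continuous_on ?S (\<lambda>p. qpoch_inf (fst p) (snd p))"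
      by (rule uniform_limit_theorem[OF _ uniform_limit_qpoch[OF r(2)]])
         (auto intro!: always_eventually continuous_intros)
    moreover have "(a, q) \<in> interior ?S"
      using r by (auto simp: interior_Times)
    ultimately show ?thesis
      by (rule continuous_on_interior)
  qed
  thus ?thesis
    by (intro continuous_at_imp_continuous_on) auto
qed

lemma holomorphic2_on_qpoch:
  assumes "open W" and a: "a holomorphic2_on W" and q: "q holomorphic2_on W"
    and lt: "\<And>p. p \<in> W \<Longrightarrow> norm (q p) < 1"
  shows "(\<lambda>p. qpoch_inf (a p) (q p)) holomorphic2_on W"
  unfolding holomorphic2_on_def
proof (intro conjI allI)
  have "continuous_on W (\<lambda>p. (\<lambda>p. qpoch_inf (fst p) (snd p)) (a p, q p))"
    by (rule continuous_on_compose2[OF continuous_on_qpoch])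
       (use a q lt in \<open>auto intro!: continuous_intros holomorphic2_on_continuous\<close>)
  thus "continuous_on W (\<lambda>p. qpoch_inf (a p) (q p))" by simp
next
  fix b
  have "open ((\<lambda>z. (z, b)) -` W)" by (intro open_vimage assms continuous_intros)
  thus "(\<lambda>z. qpoch_inf (a (z, b)) (q (z, b))) holomorphic_on {z. (z, b) \<in> W}"
    by (intro holomorphic_on_qpoch holomorphic2_on_slice1[OF a] holomorphic2_on_slice1[OF q] lt)
       (auto simp: vimage_def)
next
  fix z
  have "open ((\<lambda>w. (z, w)) -` W)" by (intro open_vimage assms continuous_intros)
  thus "(\<lambda>w. qpoch_inf (a (z, w)) (q (z, w))) holomorphic_on {w. (z, w) \<in> W}"
    by (intro holomorphic_on_qpoch holomorphic2_on_slice2[OF a] holomorphic2_on_slice2[OF q] lt)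
       (auto simp: vimage_def)
qed

section \<open>The integral representation in a complex neighbourhood of the real parameters\<close>

lemma set_integrable_exp_neg:
  fixes b :: real assumes "b > 0"
  shows "set_integrable lborel {0..} (\<lambda>x. exp (- b * x))"
proof -
  have "(\<lambda>x. exp (- b * x)) absolutely_integrable_on {0..}"
    by (intro nonnegative_absolutely_integrable_1 integrable_on_exp_minus_to_infinity assms) auto
  hence "integrable lebesgue (\<lambda>x. indicator {0..} x *\<^sub>R exp (- b * x))"
    by (simp add: set_integrable_def)
  thus ?thesis
    unfolding set_integrable_def by (subst (asm) integrable_completion) auto
qed

lemma integrable_exp_neg_abs:
  fixes b :: real assumes "b > 0"
  shows "integrable lborel (\<lambda>x. exp (- b * \<bar>x\<bar>))"
proof -
  define f where "f = (\<lambda>x. indicator {0..} x *\<^sub>R exp (- b * x))"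
  have f: "integrable lborel f"
    using set_integrable_exp_neg[OF assms] by (simp add: f_def set_integrable_def)
  hence "integrable lborel (\<lambda>x. f (0 + (- 1) * x))"
    by (rule lborel_integrable_real_affine) simp
  with f have "integrable lborel (\<lambda>x. f x + f (- x))"
    by simp
  thus ?thesis
    by (rule Bochner_Integration.integrable_bound) (auto simp: f_def indicator_def)
qed

lemma set_integrable_exp_pos:
  fixes b :: real assumes "b > 0"
  shows "set_integrable lborel {..0} (\<lambda>x. exp (b * x))"
  unfolding set_integrable_def
  by (rule Bochner_Integration.integrable_bound[OF integrable_exp_neg_abs[OF assms]])
     (auto simp: indicator_def)

text \<open>
  With \<open>x = e^{Re w}\<close> and \<open>k = cos c\<close>, the square of the norm is at least \<open>1 + 2kx + x^2\<close>, and this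
  is both \<open>(1 + kx)^2 + (x sin c)^2\<close> and \<open>(x + k)^2 + (sin c)^2\<close>.
\<close>

lemma norm_one_plus_exp_ge:
  assumes "\<bar>Im w\<bar> \<le> c" "0 < c" "c < pi"
  shows "sin c * max 1 (exp (Re w)) \<le> norm (1 + exp w)"
proof -
  define x k where "x = exp (Re w)" and "k = cos c"
  have k: "k \<le> cos (Im w)"
    using assms unfolding k_def by (metis abs_ge_zero cos_abs_real cos_monotone_0_pi_le less_eq_real_def)
  have x: "x > 0" by (simp add: x_def)
  have s: "sin c ^ 2 = 1 - k\<^sup>2" by (simp add: k_def sin_squared_eq)
  have "(norm (1 + exp w))\<^sup>2 = (1 + x * cos (Im w))\<^sup>2 + (x * sin (Im w))\<^sup>2"
    by (simp add: cmod_power2 Re_exp Im_exp x_def)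
  also have "\<dots> = 1 + 2 * x * cos (Im w) + x\<^sup>2 * ((sin (Im w))\<^sup>2 + (cos (Im w))\<^sup>2)"
    by algebra
  also have "\<dots> = 1 + 2 * x * cos (Im w) + x\<^sup>2" by simp
  finally have eq: "(norm (1 + exp w))\<^sup>2 = 1 + 2 * x * cos (Im w) + x\<^sup>2" .
  have le: "1 + 2 * x * k + x\<^sup>2 \<le> (norm (1 + exp w))\<^sup>2"
    using k x by (simp add: eq)
  have "1 + 2 * x * k + x\<^sup>2 = (1 + k * x)\<^sup>2 + (sin c * x)\<^sup>2"
    by (simp add: power_mult_distrib s) (simp add: power2_eq_square algebra_simps)
  hence "(sin c * x)\<^sup>2 \<le> (norm (1 + exp w))\<^sup>2" using le by (smt (verit) zero_le_power2)
  moreover have "1 + 2 * x * k + x\<^sup>2 = (x + k)\<^sup>2 + (sin c)\<^sup>2"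
    by (simp add: s) (simp add: power2_eq_square algebra_simps)
  hence "(sin c)\<^sup>2 \<le> (norm (1 + exp w))\<^sup>2" using le by (smt (verit) zero_le_power2)
  moreover have "sin c > 0" using assms by (intro sin_gt_zero)
  ultimately show ?thesis
    by (auto simp: max_def x_def abs_le_square_iff[symmetric] split: if_splits)
qed

lemma one_plus_exp_nonzero:
  assumes "\<bar>Im w\<bar> < pi" shows "1 + exp w \<noteq> 0"
proof -
  obtain c where c: "max \<bar>Im w\<bar> 1 < c" "c < pi"
    using assms dense[of "max \<bar>Im w\<bar> 1" pi] pi_gt3 by auto
  have "sin c > 0" using c by (intro sin_gt_zero) auto
  hence "0 < sin c * max 1 (exp (Re w))" by (simp add: less_max_iff_disj)
  also have "\<dots> \<le> norm (1 + exp w)" using c by (intro norm_one_plus_exp_ge) auto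
  finally show ?thesis by auto
qed

text \<open>
  For nonreal \<open>\<alpha>\<close> the points \<open>\<alpha>y\<close> leave every strip around the real axis. While
  \<open>\<bar>Im (\<alpha>y)\<bar> \<le> \<pi>/2\<close> the strip estimate applies; afterwards \<open>\<bar>Re (\<alpha>y)\<bar>\<close> is at least \<open>\<pi>/2B\<close>, so \<open>\<bar>e^{\<alpha>y}\<bar>\<close> stays away from 1.
\<close>

lemma norm_one_plus_exp_ray_ge:
  assumes "B > 0"
  obtains c :: real where "c > 0"
    "\<And>\<alpha> y. 0 < Re \<alpha> \<Longrightarrow> \<bar>Im \<alpha>\<bar> \<le> B * Re \<alpha> \<Longrightarrow>
       c * max 1 (exp (Re \<alpha> * y)) \<le> norm (1 + exp (\<alpha> * of_real y))"
proof -
  define \<delta> where "\<delta> = pi / (2 * B)"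
  have \<delta>: "\<delta> > 0" using assms by (simp add: \<delta>_def)
  define c where "c = 1 - exp (- \<delta>)"
  have c: "c > 0" "c \<le> 1" using \<delta> by (auto simp: c_def)
  have "c * max 1 (exp (Re \<alpha> * y)) \<le> norm (1 + exp (\<alpha> * of_real y))"
    if \<alpha>: "0 < Re \<alpha>" "\<bar>Im \<alpha>\<bar> \<le> B * Re \<alpha>" for \<alpha> y
  proof (cases "\<bar>Im \<alpha> * y\<bar> \<le> pi / 2")
    case True
    have "c * max 1 (exp (Re \<alpha> * y)) \<le> 1 * max 1 (exp (Re \<alpha> * y))"
      using c by (intro mult_right_mono) auto
    also have "\<dots> = sin (pi / 2) * max 1 (exp (Re (\<alpha> * of_real y)))" by simp
    also have "\<dots> \<le> norm (1 + exp (\<alpha> * of_real y))"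
      using True by (intro norm_one_plus_exp_ge) auto
    finally show ?thesis .
  next
    case False
    define x where "x = Re \<alpha> * y"
    have "pi / 2 < \<bar>Im \<alpha>\<bar> * \<bar>y\<bar>" using False by (simp add: abs_mult)
    also have "\<dots> \<le> (B * Re \<alpha>) * \<bar>y\<bar>" using \<alpha> by (intro mult_right_mono) auto
    also have "\<dots> = B * \<bar>x\<bar>" using \<alpha> by (simp add: x_def abs_mult)
    finally have x: "\<delta> < \<bar>x\<bar>" using assms by (simp add: \<delta>_def field_simps)
    have ge: "\<bar>exp x - 1\<bar> \<le> norm (1 + exp (\<alpha> * of_real y))"
    proof -
      have "norm (exp (\<alpha> * of_real y)) = exp x" by (simp add: x_def)
      thus ?thesis using norm_triangle_ineq3[of "exp (\<alpha> * of_real y)" "- 1"]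
        by (simp add: add.commute)
    qed
    show ?thesis
    proof (cases "x > 0")
      case True
      hence "exp (- x) \<le> exp (- \<delta>)" using x by simp
      hence "exp x * exp (- x) \<le> exp x * exp (- \<delta>)" by (intro mult_left_mono) auto
      hence "c * exp x \<le> exp x - 1" by (simp add: c_def algebra_simps flip: exp_add)
      thus ?thesis using ge True by (simp add: x_def max_def)
    next
      case False
      hence "exp x \<le> exp (- \<delta>)" using x by simp
      hence "c \<le> 1 - exp x" by (simp add: c_def)
      moreover have "exp x \<le> 1" using False by simp
      hence m: "max 1 (exp x) = 1" by simp
      ultimately show ?thesis using ge unfolding x_def[symmetric] m by linarith
    qed
  qed
  thus ?thesis using that c by blast
qed

text \<open>
  This is \<open>sin r / (cosh s + cos r)\<close>, the Poisson kernel of a strip, with its denominator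
  factored: the factors show the poles and reduce all estimates to those for \<open>1 + e^w\<close>.
\<close>

definition poisson_kernel :: "real \<Rightarrow> complex \<Rightarrow> complex" where
  "poisson_kernel r s = 2 * of_real (sin r) * exp s /
     ((1 + exp (s + \<i> * of_real r)) * (1 + exp (s - \<i> * of_real r)))"

lemma holomorphic_on_poisson_kernel:
  assumes "0 < r" "r < pi"
  shows "poisson_kernel r holomorphic_on {s. \<bar>Im s\<bar> < pi - r}"
  unfolding poisson_kernel_def
  by (intro holomorphic_intros) (use assms in \<open>auto intro!: one_plus_exp_nonzero\<close>)

lemma poisson_kernel_bound_of_factors:
  assumes k: "k > 0"
    and 1: "k * max 1 (exp (Re s)) \<le> norm (1 + exp (s + \<i> * of_real r))"
    and 2: "k * max 1 (exp (Re s)) \<le> norm (1 + exp (s - \<i> * of_real r))"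
  shows "norm (poisson_kernel r s) \<le> 2 / k\<^sup>2 * exp (- \<bar>Re s\<bar>)"
proof -
  define m where "m = max 1 (exp (Re s))"
  have m: "m > 0" by (simp add: m_def less_max_iff_disj)
  have "norm (poisson_kernel r s) \<le> 2 * exp (Re s) / ((k * m) * (k * m))"
    unfolding poisson_kernel_def norm_divide norm_mult
  proof (rule frac_le)
    show "k * m * (k * m) \<le> norm (1 + exp (s + \<i> * of_real r)) * norm (1 + exp (s - \<i> * of_real r))"
      using k m 1 2 unfolding m_def by (intro mult_mono) auto
    show "norm (2 :: complex) * norm (complex_of_real (sin r)) * norm (exp s) \<le> 2 * exp (Re s)"
      by simp
  qed (use k m in auto)
  also have "\<dots> = 2 / k\<^sup>2 * (exp (Re s) / m\<^sup>2)"
    by (simp add: power2_eq_square)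
  also have "exp (Re s) / m\<^sup>2 = exp (- \<bar>Re s\<bar>)"
    by (simp add: m_def max_def power2_eq_square exp_minus field_simps)
  finally show ?thesis .
qed

lemma norm_poisson_kernel_le:
  assumes "0 < r" "0 \<le> c" "r + c < pi" "\<bar>Im s\<bar> \<le> c"
  shows "norm (poisson_kernel r s) \<le> 2 / (sin (r + c))\<^sup>2 * exp (- \<bar>Re s\<bar>)"
proof (rule poisson_kernel_bound_of_factors)
  show "sin (r + c) > 0" using assms by (intro sin_gt_zero) auto
qed (use assms norm_one_plus_exp_ge[of "s + \<i> * of_real r" "r + c"]
       norm_one_plus_exp_ge[of "s - \<i> * of_real r" "r + c"] in auto)

abbreviation fermi_integrand :: "real \<Rightarrow> complex \<Rightarrow> complex \<Rightarrow> real \<Rightarrow> complex" where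
  "fermi_integrand r t \<alpha> y \<equiv> poisson_kernel r (t + of_real y) / (1 + exp (\<alpha> * of_real y))"

text \<open>
  The kernel decays like \<open>e^{-\<bar>Re t + y\<bar>}\<close>, and the other factor like \<open>min 1 e^{-2by}\<close>. Because
  \<open>-\<bar>x\<bar> \<le> bx\<close> for \<open>b \<le> 1\<close>, giving up part of the first decay separates the variables:
  one bound is integrable over \<open>y\<close>, and also over \<open>Re t\<close> near \<open>-\<infinity>\<close>.
\<close>

lemma norm_fermi_integrand_le:
  assumes "0 < r" "0 \<le> c" "r + c < pi" "0 < b" "2 * b \<le> 1" "0 < B"
  obtains C where "C > 0"
    "\<And>t \<alpha> y. \<bar>Im t\<bar> \<le> c \<Longrightarrow> 2 * b \<le> Re \<alpha> \<Longrightarrow> \<bar>Im \<alpha>\<bar> \<le> B \<Longrightarrow>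
       norm (fermi_integrand r t \<alpha> y)
         \<le> C * exp (b * Re t) * exp (- b * \<bar>y\<bar>)"
proof -
  obtain d where d: "d > 0"
    "\<And>\<alpha> y. 0 < Re \<alpha> \<Longrightarrow> \<bar>Im \<alpha>\<bar> \<le> (B / (2 * b)) * Re \<alpha> \<Longrightarrow>
       d * max 1 (exp (Re \<alpha> * y)) \<le> norm (1 + exp (\<alpha> * of_real y))"
    by (rule norm_one_plus_exp_ray_ge[of "B / (2 * b)"]) (use assms in \<open>auto simp: field_simps\<close>)
  define k where "k = 2 / (sin (r + c))\<^sup>2"
  have "sin (r + c) > 0" using assms by (intro sin_gt_zero) auto
  hence k: "k > 0" by (simp add: k_def)
  have "norm (fermi_integrand r t \<alpha> y)
         \<le> (k / d) * exp (b * Re t) * exp (- b * \<bar>y\<bar>)"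
    if t: "\<bar>Im t\<bar> \<le> c" and \<alpha>: "2 * b \<le> Re \<alpha>" "\<bar>Im \<alpha>\<bar> \<le> B" for t \<alpha> y
  proof -
    define x where "x = Re t + y"
    have 1: "norm (poisson_kernel r (t + of_real y)) \<le> k * exp (- \<bar>x\<bar>)"
      using norm_poisson_kernel_le[of r c "t + of_real y"] assms t by (simp add: k_def x_def)
    have "\<bar>Im \<alpha>\<bar> \<le> (B / (2 * b)) * (2 * b)" using assms \<alpha> by simp
    also have "\<dots> \<le> (B / (2 * b)) * Re \<alpha>" using assms \<alpha> by (intro mult_left_mono) auto
    finally have 2: "d * max 1 (exp (Re \<alpha> * y)) \<le> norm (1 + exp (\<alpha> * of_real y))"
      using assms \<alpha> by (intro d) auto
    have "exp (max 0 (2 * b * y)) \<le> max 1 (exp (Re \<alpha> * y))"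
    proof (cases "y \<ge> 0")
      case True
      hence "2 * b * y \<le> Re \<alpha> * y" using \<alpha> by (intro mult_right_mono) auto
      thus ?thesis using True assms by (simp add: max_def)
    next
      case False
      hence "b * y \<le> 0" using assms by (simp add: mult_nonneg_nonpos)
      hence "max 0 (2 * b * y) = 0" by simp
      thus ?thesis by simp
    qed
    hence "d * exp (max 0 (2 * b * y)) \<le> d * max 1 (exp (Re \<alpha> * y))"
      using d(1) by (intro mult_left_mono) auto
    with 2 have 3: "d * exp (max 0 (2 * b * y)) \<le> norm (1 + exp (\<alpha> * of_real y))" by simp
    have "norm (fermi_integrand r t \<alpha> y)
            \<le> (k * exp (- \<bar>x\<bar>)) / (d * exp (max 0 (2 * b * y)))"
      unfolding norm_divide by (intro frac_le 1 3) (use d k in auto)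
    also have "\<dots> = (k / d) * exp (- \<bar>x\<bar> - max 0 (2 * b * y))"
      by (simp add: exp_diff)
    also have "\<dots> \<le> (k / d) * exp (b * Re t + (- b * \<bar>y\<bar>))"
    proof (intro mult_left_mono)
      have "- \<bar>x\<bar> \<le> b * x"
      proof (cases "x \<ge> 0")
        case True thus ?thesis using assms
          by (smt (verit) mult_nonneg_nonneg)
      next
        case False
        hence "1 * x \<le> b * x" using assms by (intro mult_right_mono_neg) auto
        thus ?thesis using False by simp
      qed
      moreover have "b * y - max 0 (2 * b * y) \<le> - b * \<bar>y\<bar>"
      proof (cases "y \<ge> 0")
        case False
        hence "b * y \<le> 0" using assms by (simp add: mult_nonneg_nonpos)
        thus ?thesis using False by simp
      qed (use assms in auto)
      ultimately show "exp (- \<bar>x\<bar> - max 0 (2 * b * y)) \<le> exp (b * Re t + - b * \<bar>y\<bar>)"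
        by (simp add: x_def algebra_simps)
    qed (use d k in auto)
    finally show ?thesis by (simp only: exp_add mult.assoc)
  qed
  thus ?thesis using that[of "k / d"] k d by simp
qed

definition strip_params :: "real \<Rightarrow> (complex \<times> complex) set" where
  "strip_params r = {(t, \<alpha>). \<bar>Im t\<bar> < pi - r \<and> 0 < Re \<alpha>}"

lemma open_strip_params: "open (strip_params r)"
proof -
  have "open ({t. \<bar>Im t\<bar> < pi - r} \<times> {\<alpha>. 0 < Re \<alpha>})"
    by (intro open_Times open_Collect_less continuous_intros)
  also have "\<dots> = strip_params r" by (auto simp: strip_params_def)
  finally show ?thesis .
qed

text \<open>
  The convolution of the Poisson kernel with the Fermi function \<open>1 / (1 + e^{\<alpha>y})\<close>; for real
  parameters it is, up to a constant factor, the logarithmic derivative of \<open>\<phi>(e^t)\<close> in \<open>t\<close>.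
\<close>

definition fermi_integral :: "real \<Rightarrow> complex \<times> complex \<Rightarrow> complex" where
  "fermi_integral r p =
     (LINT y|lborel. fermi_integrand r (fst p) (snd p) y)"

lemma one_plus_exp_ray_nonzero:
  assumes "0 < Re \<alpha>" shows "1 + exp (\<alpha> * of_real y) \<noteq> 0"
proof -
  obtain c where c: "c > 0" "\<And>\<beta> y. 0 < Re \<beta> \<Longrightarrow> \<bar>Im \<beta>\<bar> \<le> (\<bar>Im \<alpha>\<bar> / Re \<alpha> + 1) * Re \<beta> \<Longrightarrow>
       c * max 1 (exp (Re \<beta> * y)) \<le> norm (1 + exp (\<beta> * of_real y))"
    by (rule norm_one_plus_exp_ray_ge[of "\<bar>Im \<alpha>\<bar> / Re \<alpha> + 1"])
       (use assms in \<open>auto intro: add_nonneg_pos\<close>)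
  have "0 < c * max 1 (exp (Re \<alpha> * y))" using c(1) by (simp add: less_max_iff_disj)
  also have "\<dots> \<le> norm (1 + exp (\<alpha> * of_real y))"
    using assms by (intro c(2)) (auto simp: field_simps)
  finally show ?thesis by auto
qed

lemma continuous_on_fermi_integrand:
  assumes "0 < r" "r < pi" "p \<in> strip_params r"
  shows "continuous_on UNIV (\<lambda>y. fermi_integrand r (fst p) (snd p) y)"
proof (intro continuous_on_divide ballI)
  show "continuous_on UNIV (\<lambda>y. poisson_kernel r (fst p + of_real y))"
    by (rule continuous_on_compose2[OF holomorphic_on_imp_continuous_on[OF holomorphic_on_poisson_kernel]])
       (use assms in \<open>auto intro!: continuous_intros simp: strip_params_def\<close>)
qed (use assms in \<open>auto intro!: continuous_intros one_plus_exp_ray_nonzero simp: strip_params_def\<close>)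

text \<open>
  The neighbourhood is invariant under real translations of \<open>t\<close>, so that one choice of the
  constants serves the whole half-line over which the integral in \<open>t\<close> is taken later.
\<close>

lemma fermi_integrand_locally_bounded:
  assumes r: "0 < r" "r < pi" and p: "p \<in> strip_params r"
  obtains V C b where "open V" "p \<in> V" "V \<subseteq> strip_params r" "C > 0" "b > 0"
    "\<And>t \<alpha> s. (t, \<alpha>) \<in> V \<Longrightarrow> (t + of_real s, \<alpha>) \<in> V"
    "\<And>t \<alpha> y. (t, \<alpha>) \<in> V \<Longrightarrow>
       norm (fermi_integrand r t \<alpha> y)
         \<le> C * exp (b * Re t) * exp (- b * \<bar>y\<bar>)"
proof -
  obtain t0 \<alpha>0 where p_eq: "p = (t0, \<alpha>0)" by (cases p)
  have *: "\<bar>Im t0\<bar> < pi - r" "0 < Re \<alpha>0" using p by (auto simp: p_eq strip_params_def)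
  obtain c where c: "\<bar>Im t0\<bar> < c" "c < pi - r" using dense[OF *(1)] by blast
  define b B where "b = min (1 / 2) (Re \<alpha>0 / 4)" and "B = \<bar>Im \<alpha>0\<bar> + 1"
  have b: "0 < b" "2 * b \<le> 1" "2 * b < Re \<alpha>0" "B > 0" using * by (auto simp: b_def B_def)
  obtain C where C: "C > 0" "\<And>t \<alpha> y. \<bar>Im t\<bar> \<le> c \<Longrightarrow> 2 * b \<le> Re \<alpha> \<Longrightarrow> \<bar>Im \<alpha>\<bar> \<le> B \<Longrightarrow>
       norm (fermi_integrand r t \<alpha> y)
         \<le> C * exp (b * Re t) * exp (- b * \<bar>y\<bar>)"
    by (rule norm_fermi_integrand_le[of r c b B]) (use r c b in auto)
  define V where "V = {t. \<bar>Im t\<bar> < c} \<times> {\<alpha>. 2 * b < Re \<alpha> \<and> \<bar>Im \<alpha>\<bar> < B}"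
  have "open V" unfolding V_def
    by (intro open_Times open_Collect_conj open_Collect_less continuous_intros)
  moreover have "p \<in> V" "V \<subseteq> strip_params r"
    using c b by (auto simp: V_def p_eq B_def strip_params_def)
  moreover have "(t + of_real s, \<alpha>) \<in> V" if "(t, \<alpha>) \<in> V" for t \<alpha> s
    using that by (simp add: V_def)
  moreover have "norm (fermi_integrand r t \<alpha> y)
         \<le> C * exp (b * Re t) * exp (- b * \<bar>y\<bar>)" if "(t, \<alpha>) \<in> V" for t \<alpha> y
    using that by (intro C) (auto simp: V_def)
  ultimately show ?thesis
    using that[of V C b] C(1) b(1) by blast
qed

lemma integrable_fermi_integrand:
  assumes r: "0 < r" "r < pi" and p: "p \<in> strip_params r"
  shows "integrable lborel (\<lambda>y. fermi_integrand r (fst p) (snd p) y)"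
proof -
  obtain V C b where V: "open V" "p \<in> V" "V \<subseteq> strip_params r" "C > 0" "b > 0"
    "\<And>t \<alpha> s. (t, \<alpha>) \<in> V \<Longrightarrow> (t + of_real s, \<alpha>) \<in> V"
    "\<And>t \<alpha> y. (t, \<alpha>) \<in> V \<Longrightarrow>
       norm (fermi_integrand r t \<alpha> y)
         \<le> C * exp (b * Re t) * exp (- b * \<bar>y\<bar>)"
    using fermi_integrand_locally_bounded[OF assms] by metis
  have "integrable lborel (\<lambda>y. C * exp (b * Re (fst p)) * exp (- b * \<bar>y\<bar>))"
    by (intro integrable_mult_right integrable_exp_neg_abs V)
  thus ?thesis
  proof (rule Bochner_Integration.integrable_bound)
    show "AE y in lborel. norm (fermi_integrand r (fst p) (snd p) y)
            \<le> norm (C * exp (b * Re (fst p)) * exp (- b * \<bar>y\<bar>))"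
      using V by (intro AE_I2) (auto intro!: order_trans[OF V(7)])
  qed (use borel_measurable_continuous_onI[OF continuous_on_fermi_integrand[OF assms]] in simp)
qed

lemma fermi_integral_locally_bounded:
  assumes r: "0 < r" "r < pi" and p: "p \<in> strip_params r"
  obtains V C b where "open V" "p \<in> V" "V \<subseteq> strip_params r" "C > 0" "b > 0"
    "\<And>t \<alpha> s. (t, \<alpha>) \<in> V \<Longrightarrow> (t + of_real s, \<alpha>) \<in> V"
    "\<And>t \<alpha>. (t, \<alpha>) \<in> V \<Longrightarrow> norm (fermi_integral r (t, \<alpha>)) \<le> C * exp (b * Re t)"
proof -
  obtain V C b where V: "open V" "p \<in> V" "V \<subseteq> strip_params r" "C > 0" "b > 0"
    "\<And>t \<alpha> s. (t, \<alpha>) \<in> V \<Longrightarrow> (t + of_real s, \<alpha>) \<in> V"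
    "\<And>t \<alpha> y. (t, \<alpha>) \<in> V \<Longrightarrow>
       norm (fermi_integrand r t \<alpha> y)
         \<le> C * exp (b * Re t) * exp (- b * \<bar>y\<bar>)"
    using fermi_integrand_locally_bounded[OF assms] by metis
  define D where "D = C * (LINT y|lborel. exp (- b * \<bar>y\<bar>)) + 1"
  have "D > 0" unfolding D_def using V by (intro add_nonneg_pos mult_nonneg_nonneg) auto
  have "norm (fermi_integral r (t, \<alpha>)) \<le> D * exp (b * Re t)" if t: "(t, \<alpha>) \<in> V" for t \<alpha>
  proof -
    have int: "integrable lborel (\<lambda>y. C * exp (b * Re t) * exp (- b * \<bar>y\<bar>))"
      by (intro integrable_mult_right integrable_exp_neg_abs V)
    have "norm (fermi_integral r (t, \<alpha>))
       \<le> (LINT y|lborel. C * exp (b * Re t) * exp (- b * \<bar>y\<bar>))"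
      unfolding fermi_integral_def fst_conv snd_conv
      by (rule Bochner_Integration.integral_norm_bound_integral[OF _ int])
         (use V t integrable_fermi_integrand[OF r, of "(t, \<alpha>)"] in auto)
    also have "\<dots> = (C * (LINT y|lborel. exp (- b * \<bar>y\<bar>))) * exp (b * Re t)"
      by simp
    also have "\<dots> \<le> D * exp (b * Re t)"
      unfolding D_def by (intro mult_right_mono) auto
    finally show ?thesis .
  qed
  thus ?thesis using that V \<open>D > 0\<close> by blast
qed

lemma holomorphic2_on_fermi_integral:
  assumes r: "0 < r" "r < pi"
  shows "fermi_integral r holomorphic2_on strip_params r"
  unfolding fermi_integral_def
proof (rule holomorphic2_on_integral[OF open_strip_params])
  fix y :: real
  have "(\<lambda>p. (\<lambda>q. poisson_kernel r (fst q)) (fst p + of_real y, snd p)) holomorphic2_on strip_params r"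
  proof (rule holomorphic2_on_compose_fst[where A = UNIV])
    have *: "poisson_kernel r holomorphic_on {t. \<bar>Im t\<bar> < pi - r}"
      by (rule holomorphic_on_poisson_kernel[OF r])
    show "(\<lambda>q. poisson_kernel r (fst q)) holomorphic2_on strip_params r"
      unfolding holomorphic2_on_def
      by (auto simp: strip_params_def split_beta
          intro!: continuous_intros holomorphic_on_subset[OF *]
            continuous_on_compose2[OF holomorphic_on_imp_continuous_on[OF *]])
  qed (auto intro!: holomorphic_intros simp: strip_params_def)
  hence "(\<lambda>p. poisson_kernel r (fst p + of_real y)) holomorphic2_on strip_params r" by simp
  thus "(\<lambda>p. fermi_integrand r (fst p) (snd p) y)
          holomorphic2_on strip_params r"
    by (intro holomorphic2_intros)
       (auto intro!: one_plus_exp_ray_nonzero simp: strip_params_def)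
next
  fix p assume "p \<in> strip_params r"
  thus "(\<lambda>y. fermi_integrand r (fst p) (snd p) y) \<in> borel_measurable lborel"
    using borel_measurable_continuous_onI[OF continuous_on_fermi_integrand[OF r]] by simp
next
  fix p assume p: "p \<in> strip_params r"
  obtain V C b where V: "open V" "p \<in> V" "V \<subseteq> strip_params r" "C > 0" "b > 0"
    "\<And>t \<alpha> s. (t, \<alpha>) \<in> V \<Longrightarrow> (t + of_real s, \<alpha>) \<in> V"
    "\<And>t \<alpha> y. (t, \<alpha>) \<in> V \<Longrightarrow>
       norm (fermi_integrand r t \<alpha> y)
         \<le> C * exp (b * Re t) * exp (- b * \<bar>y\<bar>)"
    using fermi_integrand_locally_bounded[OF r p] by metis
  show "\<exists>V (c :: _ \<Rightarrow> real) g. open V \<and> p \<in> V \<and> V \<subseteq> strip_params r \<and> continuous_on V c \<and>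
      integrable lborel g \<and> (\<forall>q\<in>V. \<forall>y\<in>space lborel. norm (fermi_integrand r (fst q) (snd q) y) \<le> c q * g y)"
  proof (rule exI[of _ V], rule exI[of _ "\<lambda>q. C * exp (b * Re (fst q))"],
         rule exI[of _ "\<lambda>y. exp (- b * \<bar>y\<bar>)"], intro conjI ballI)
    show "continuous_on V (\<lambda>q. C * exp (b * Re (fst q)))" by (intro continuous_intros)
  qed (use V integrable_exp_neg_abs[of b] in auto)
qed

text \<open>
  The primitive in \<open>t\<close> that vanishes at \<open>-\<infinity>\<close>. Integrating over the fixed half-line \<open>s \<le> 0\<close> makes
  sense for complex \<open>t\<close> and keeps the domain of integration independent of \<open>t\<close>.
\<close>

definition fermi_primitive :: "real \<Rightarrow> complex \<times> complex \<Rightarrow> complex" where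
  "fermi_primitive r p =
     (LINT s:{..0}|lborel. fermi_integral r (fst p + of_real s, snd p))"

lemma continuous_on_fermi_integral_shift:
  assumes r: "0 < r" "r < pi" and p: "p \<in> strip_params r"
  shows "continuous_on UNIV (\<lambda>s. fermi_integral r (fst p + of_real s, snd p))"
  by (rule continuous_on_compose2[OF holomorphic2_on_continuous[OF holomorphic2_on_fermi_integral[OF r]]])
     (use p in \<open>auto intro!: continuous_intros simp: strip_params_def\<close>)

lemma fermi_primitive_locally_bounded:
  assumes r: "0 < r" "r < pi" and p: "p \<in> strip_params r"
  obtains V C b where "open V" "p \<in> V" "V \<subseteq> strip_params r" "C > 0" "b > 0"
    "\<And>t \<alpha> s. (t, \<alpha>) \<in> V \<Longrightarrow> (t + of_real s, \<alpha>) \<in> V"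
    "\<And>q. q \<in> V \<Longrightarrow> set_integrable lborel {..0} (\<lambda>s. fermi_integral r (fst q + of_real s, snd q))"
    "\<And>q. q \<in> V \<Longrightarrow> norm (fermi_primitive r q) \<le> C * exp (b * Re (fst q))"
    "\<And>q s. q \<in> V \<Longrightarrow>
       norm (fermi_integral r (fst q + of_real s, snd q)) \<le> C * exp (b * Re (fst q)) * exp (b * s)"
proof -
  obtain V C b where V: "open V" "p \<in> V" "V \<subseteq> strip_params r" "C > 0" "b > 0"
    "\<And>t \<alpha> s. (t, \<alpha>) \<in> V \<Longrightarrow> (t + of_real s, \<alpha>) \<in> V"
    "\<And>t \<alpha>. (t, \<alpha>) \<in> V \<Longrightarrow> norm (fermi_integral r (t, \<alpha>)) \<le> C * exp (b * Re t)"
    using fermi_integral_locally_bounded[OF assms] by metis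
  define M where "M = (LINT s:{..0}|lborel. exp (b * s))"
  have M: "M \<ge> 0" unfolding M_def set_lebesgue_integral_def by (intro integral_nonneg_AE AE_I2) auto
  define D where "D = C * (M + 1)"
  have D: "D > 0" unfolding D_def using V(4) M by (intro mult_pos_pos) auto
  have D': "C \<le> D" "C * M \<le> D" using V(4) M by (auto simp: D_def algebra_simps)
  have bd: "norm (fermi_integral r (fst q + of_real s, snd q)) \<le> C * exp (b * Re (fst q)) * exp (b * s)"
    if q: "q \<in> V" for q s
    using V(7)[OF V(6), of "fst q" "snd q" s] q by (simp add: exp_add algebra_simps)
  have maj: "set_integrable lborel {..0} (\<lambda>s. C * exp (b * Re (fst q)) * exp (b * s))" for q :: "complex \<times> complex"
    by (intro set_integrable_mult_right) (use set_integrable_exp_pos[OF V(5)] in simp)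
  have int: "set_integrable lborel {..0} (\<lambda>s. fermi_integral r (fst q + of_real s, snd q))"
    if q: "q \<in> V" for q
  proof -
    have "(\<lambda>s. fermi_integral r (fst q + of_real s, snd q)) \<in> borel_measurable borel"
      using q V by (intro borel_measurable_continuous_onI continuous_on_fermi_integral_shift[OF r]) auto
    thus ?thesis
      using maj[of q] unfolding set_integrable_def
      by (elim Bochner_Integration.integrable_bound)
         (use bd[OF q] V in \<open>auto intro!: AE_I2 simp: indicator_def\<close>)
  qed
  have "norm (fermi_primitive r q) \<le> D * exp (b * Re (fst q))" if q: "q \<in> V" for q
  proof -
    have "norm (fermi_primitive r q) \<le> (LINT s:{..0}|lborel. C * exp (b * Re (fst q)) * exp (b * s))"
      unfolding fermi_primitive_def set_lebesgue_integral_def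
      by (rule Bochner_Integration.integral_norm_bound_integral)
         (use int[OF q] maj[of q] bd[OF q] in \<open>auto simp: set_integrable_def indicator_def\<close>)
    also have "\<dots> = (C * M) * exp (b * Re (fst q))" by (simp add: M_def)
    also have "\<dots> \<le> D * exp (b * Re (fst q))" using D' by (intro mult_right_mono) auto
    finally show ?thesis .
  qed
  moreover have "norm (fermi_integral r (fst q + of_real s, snd q)) \<le> D * exp (b * Re (fst q)) * exp (b * s)"
    if q: "q \<in> V" for q s
    by (rule order_trans[OF bd[OF q]]) (use D' in \<open>auto intro!: mult_right_mono\<close>)
  ultimately show ?thesis using that V D int by blast
qed

lemma holomorphic2_on_fermi_primitive:
  assumes r: "0 < r" "r < pi"
  shows "fermi_primitive r holomorphic2_on strip_params r"
  unfolding fermi_primitive_def set_lebesgue_integral_def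
proof (rule holomorphic2_on_integral[OF open_strip_params])
  fix s :: real
  have "(\<lambda>p. fermi_integral r (fst p + of_real s, snd p)) holomorphic2_on strip_params r"
    by (rule holomorphic2_on_compose_fst[OF holomorphic2_on_fermi_integral[OF r], where A = UNIV])
       (auto intro!: holomorphic_intros simp: strip_params_def)
  thus "(\<lambda>p. indicator {..0} s *\<^sub>R fermi_integral r (fst p + of_real s, snd p))
          holomorphic2_on strip_params r"
    unfolding scaleR_conv_of_real by (intro holomorphic2_intros)
next
  fix p assume "p \<in> strip_params r"
  thus "(\<lambda>s. indicator {..0} s *\<^sub>R fermi_integral r (fst p + of_real s, snd p)) \<in> borel_measurable lborel"
    using borel_measurable_continuous_onI[OF continuous_on_fermi_integral_shift[OF r]] by simp
next
  fix p assume p: "p \<in> strip_params r"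
  obtain V C b where V: "open V" "p \<in> V" "V \<subseteq> strip_params r" "C > 0" "b > 0"
    "\<And>q s. q \<in> V \<Longrightarrow>
       norm (fermi_integral r (fst q + of_real s, snd q)) \<le> C * exp (b * Re (fst q)) * exp (b * s)"
    using fermi_primitive_locally_bounded[OF r p] by metis
  show "\<exists>V (c :: _ \<Rightarrow> real) g. open V \<and> p \<in> V \<and> V \<subseteq> strip_params r \<and> continuous_on V c \<and>
      integrable lborel g \<and> (\<forall>q\<in>V. \<forall>s\<in>space lborel.
        norm (indicator {..0} s *\<^sub>R fermi_integral r (fst q + of_real s, snd q)) \<le> c q * g s)"
  proof (rule exI[of _ V], rule exI[of _ "\<lambda>q. C * exp (b * Re (fst q))"],
         rule exI[of _ "\<lambda>s. indicator {..0} s *\<^sub>R exp (b * s)"], intro conjI ballI)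
    show "continuous_on V (\<lambda>q. C * exp (b * Re (fst q)))" by (intro continuous_intros)
    show "integrable lborel (\<lambda>s. indicator {..0} s *\<^sub>R exp (b * s))"
      using set_integrable_exp_pos[OF V(5)] by (simp add: set_integrable_def)
  qed (use V in \<open>auto simp: indicator_def\<close>)
qed

text \<open>
  The value \<open>\<phi>(e^t; \<alpha>, \<rho>)\<close> with \<open>r = \<pi>\<rho>\<close>, in the coordinates \<open>p = (t, \<alpha>)\<close>.
\<close>

definition stable_phi_at_exp :: "real \<Rightarrow> complex \<times> complex \<Rightarrow> complex" where
  "stable_phi_at_exp r p = exp (- (snd p / (2 * of_real pi)) * fermi_primitive r p)"

lemma holomorphic2_on_stable_phi_at_exp:
  assumes r: "0 < r" "r < pi"
  shows "stable_phi_at_exp r holomorphic2_on strip_params r"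
proof -
  have "(\<lambda>p. exp ((0 - snd p / (2 * of_real pi)) * fermi_primitive r p)) holomorphic2_on strip_params r"
    by (intro holomorphic2_intros holomorphic2_on_fermi_primitive r) auto
  thus ?thesis by (simp add: stable_phi_at_exp_def[abs_def])
qed

section \<open>Agreement with the defining integral on real parameters\<close>

text \<open>
  The substitution \<open>u = z e^s\<close>. Carried out first for \<open>norm (f u)\<close>, it shows that \<open>f\<close> is integrable
  over \<open>(0, z)\<close>.
\<close>

lemma set_integral_exp_substitution:
  fixes f :: "real \<Rightarrow> complex" and z :: real
  assumes z: "z > 0" and cont: "continuous_on {0<..} f"
    and int: "set_integrable lborel {..0} (\<lambda>s. (z * exp s) *\<^sub>R f (z * exp s))"
  shows "(LINT u:{0<..<z}|lborel. f u) = (LINT s:{..0}|lborel. (z * exp s) *\<^sub>R f (z * exp s))"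
proof -
  let ?g = "\<lambda>s. z * exp s"
  have cf: "isCont f x" if "x > 0" for x
    using cont that by (simp add: continuous_on_eq_continuous_at)
  have A: "((ereal \<circ> ?g \<circ> real_of_ereal) \<longlongrightarrow> 0) (at_right (-\<infinity>))"
  proof -
    have "(?g \<longlongrightarrow> z * 0) at_bot" by (intro tendsto_intros exp_at_bot)
    thus ?thesis unfolding zero_ereal_def by (simp add: ereal_tendsto_simps)
  qed
  have B: "((ereal \<circ> ?g \<circ> real_of_ereal) \<longlongrightarrow> ereal z) (at_left 0)"
  proof -
    have "(?g \<longlongrightarrow> z * exp 0) (at_left 0)" by (intro tendsto_intros)
    thus ?thesis unfolding zero_ereal_def by (simp add: ereal_tendsto_simps)
  qed
  have ein: "einterval (-\<infinity>) 0 = {..<0}" "einterval 0 (ereal z) = {0<..<z}"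
    by (auto simp: einterval_def zero_ereal_def)
  have int': "set_integrable lborel {..<0} (\<lambda>s. ?g s *\<^sub>R f (?g s))"
    by (rule set_integrable_subset[OF int]) auto
  have "set_integrable lborel (einterval 0 (ereal z)) (\<lambda>u. norm (f u))"
  proof (rule interval_integral_substitution_nonneg(1)[OF _ _ _ _ _ _ A B])
    show "set_integrable lborel (einterval (-\<infinity>) 0) (\<lambda>s. norm (f (?g s)) * ?g s)"
      using set_integrable_norm[OF int'] z by (simp add: ein mult.commute abs_mult)
    show "DERIV ?g x :> ?g x" for x by (auto intro!: derivative_eq_intros)
    show "isCont (\<lambda>u. norm (f u)) (?g x)" for x using z by (intro continuous_intros cf) simp
  qed (use z in auto)
  hence int2: "set_integrable lborel {0<..<z} f"
    unfolding ein set_integrable_def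
  proof (rule Bochner_Integration.integrable_bound)
    have "continuous_on {0<..<z} f" by (rule continuous_on_subset[OF cont]) auto
    thus "(\<lambda>x. indicator {0<..<z} x *\<^sub>R f x) \<in> borel_measurable lborel"
      using borel_measurable_continuous_on_indicator[of "{0<..<z}" f] by simp
  qed (auto simp: indicator_def)
  have "(LBINT u=0..ereal z. f u) = (LBINT s=-\<infinity>..0. ?g s *\<^sub>R f (?g s))"
  proof (rule interval_integral_substitution_integrable[OF _ _ _ _ _ A B])
    show "DERIV ?g x :> ?g x" for x by (auto intro!: derivative_eq_intros)
    show "isCont f (?g x)" for x using z by (intro cf) simp
    show "set_integrable lborel (einterval (-\<infinity>) 0) (\<lambda>s. ?g s *\<^sub>R f (?g s))"
      using int' by (simp add: ein)
    show "set_integrable lborel (einterval 0 (ereal z)) f" using int2 by (simp add: ein)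
  qed (use z in auto)
  hence "(LINT u:{0<..<z}|lborel. f u) = (LINT s:{..<0}|lborel. ?g s *\<^sub>R f (?g s))"
    using z by (simp add: interval_lebesgue_integral_le_eq ein zero_ereal_def[symmetric])
  also have "\<dots> = (LINT s:{..0}|lborel. ?g s *\<^sub>R f (?g s))"
  proof (rule set_integral_cong_set)
    show "AE x in lborel. x \<in> {..0} \<longleftrightarrow> x \<in> {..<(0 :: real)}"
      using AE_lborel_singleton[of 0] by eventually_elim auto
  qed (use int int' in \<open>auto simp: set_borel_measurable_def set_integrable_def\<close>)
  finally show ?thesis .
qed

lemma poisson_kernel_partial_fractions:
  assumes "\<bar>Im s\<bar> < pi - r" "0 < r"
  shows "1 / (1 + exp (\<i> * of_real r - s)) - 1 / (1 + exp (- \<i> * of_real r - s)) = - \<i> * poisson_kernel r s"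
proof -
  define a b where "a = exp (s + \<i> * of_real r)" and "b = exp (s - \<i> * of_real r)"
  have nz: "1 + a \<noteq> 0" "1 + b \<noteq> 0"
    unfolding a_def b_def using assms by (auto intro!: one_plus_exp_nonzero)
  have ab: "a \<noteq> 0" "b \<noteq> 0" by (auto simp: a_def b_def)
  have *: "exp (\<i> * of_real r - s) = inverse b" "exp (- \<i> * of_real r - s) = inverse a"
  proof -
    have "\<i> * of_real r - s = - (s - \<i> * of_real r)" "- \<i> * of_real r - s = - (s + \<i> * of_real r)"
      by simp_all
    thus "exp (\<i> * of_real r - s) = inverse b" "exp (- \<i> * of_real r - s) = inverse a"
      by (simp_all only: a_def b_def exp_minus)
  qed
  have "a - b = exp s * (exp (\<i> * of_real r) - exp (- (\<i> * of_real r)))"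
    by (simp add: a_def b_def exp_add exp_diff exp_minus field_simps)
  also have "\<dots> = 2 * \<i> * sin (of_real r) * exp s"
    by (simp add: sin_exp_eq)
  finally have "b - a = - \<i> * (2 * of_real (sin r) * exp s)"
    by (simp add: sin_of_real algebra_simps)
  moreover have "1 / (1 + inverse b) - 1 / (1 + inverse a) = (b - a) / ((1 + a) * (1 + b))"
  proof -
    have *: "1 / (1 + inverse b) = b / (1 + b)" "1 / (1 + inverse a) = a / (1 + a)"
      using ab nz by (auto simp: field_simps)
    show ?thesis unfolding *
      using nz by (simp add: field_simps)
  qed
  ultimately show ?thesis
    unfolding * poisson_kernel_def a_def[symmetric] b_def[symmetric] by simp
qed

text \<open>
  The substitution \<open>x = \<alpha>y\<close> moves \<open>\<alpha>\<close> out of the factor that contains \<open>w\<close>.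
\<close>

lemma stable_F_rescaled:
  assumes w: "\<bar>Im w\<bar> < pi" and \<alpha>: "\<alpha> > 0"
  shows "integrable lborel (\<lambda>y. 1 / ((1 + exp (w - of_real y)) * (1 + exp (of_real (\<alpha> * y)))))"
    and "stable_F w \<alpha> = of_real \<alpha> *
           (LINT y|lborel. 1 / ((1 + exp (w - of_real y)) * (1 + exp (of_real (\<alpha> * y)))))"
proof -
  let ?f = "\<lambda>y. 1 / ((1 + exp (w - of_real y)) * (1 + exp (of_real (\<alpha> * y))))"
  obtain c where c: "max \<bar>Im w\<bar> 1 < c" "c < pi"
    using w dense[of "max \<bar>Im w\<bar> 1" pi] pi_gt3 by auto
  define k where "k = sin c"
  have k: "k > 0" unfolding k_def using c by (intro sin_gt_zero) auto
  define b where "b = min 1 \<alpha>"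
  have b: "b > 0" "b \<le> 1" "b \<le> \<alpha>" using \<alpha> by (auto simp: b_def)
  have nz1: "1 + exp (w - of_real y) \<noteq> 0" for y
    using w by (intro one_plus_exp_nonzero) auto
  have nz2: "1 + exp (complex_of_real (\<alpha> * y)) \<noteq> 0" for y
    by (intro one_plus_exp_nonzero) auto
  show "integrable lborel ?f"
  proof (rule Bochner_Integration.integrable_bound)
    show "integrable lborel (\<lambda>y. exp \<bar>Re w\<bar> / k * exp (- b * \<bar>y\<bar>))"
      by (intro integrable_mult_right integrable_exp_neg_abs b)
    have "continuous_on UNIV ?f"
      using nz1 nz2 by (intro continuous_intros) auto
    thus "?f \<in> borel_measurable lborel"
      using borel_measurable_continuous_onI by simp
    show "AE y in lborel. norm (?f y) \<le> norm (exp \<bar>Re w\<bar> / k * exp (- b * \<bar>y\<bar>))"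
    proof (rule AE_I2)
      fix y :: real
      define m where "m = max 1 (exp (Re w - y))"
      have m: "k * m \<le> norm (1 + exp (w - of_real y))"
        using norm_one_plus_exp_ge[of "w - of_real y" c] c by (simp add: k_def m_def)
      have "m \<ge> 1" by (simp add: m_def)
      have "norm (1 + exp (complex_of_real (\<alpha> * y))) = norm (complex_of_real (1 + exp (\<alpha> * y)))"
        by (simp only: exp_of_real of_real_add of_real_1)
      also have "\<dots> = 1 + exp (\<alpha> * y)" by (simp only: norm_of_real) simp
      finally have e: "norm (1 + exp (complex_of_real (\<alpha> * y))) = 1 + exp (\<alpha> * y)" .
      have "exp (b * \<bar>y\<bar>) \<le> exp \<bar>Re w\<bar> * (m * (1 + exp (\<alpha> * y)))"
      proof (cases "y \<ge> 0")
        case True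
        have "b * \<bar>y\<bar> \<le> \<alpha> * y" using True b by (auto intro: mult_right_mono)
        hence "exp (b * \<bar>y\<bar>) \<le> exp (\<alpha> * y)" by simp
        also have "\<dots> \<le> 1 * (1 * (1 + exp (\<alpha> * y)))" by simp
        also have "\<dots> \<le> exp \<bar>Re w\<bar> * (m * (1 + exp (\<alpha> * y)))"
          using \<open>m \<ge> 1\<close> by (intro mult_mono) (auto intro: add_nonneg_nonneg)
        finally show ?thesis .
      next
        case False
        hence "b * \<bar>y\<bar> \<le> 1 * \<bar>y\<bar>" using b by (intro mult_right_mono) auto
        hence "b * \<bar>y\<bar> \<le> \<bar>Re w\<bar> + (Re w - y)" using False by linarith
        hence "exp (b * \<bar>y\<bar>) \<le> exp (\<bar>Re w\<bar> + (Re w - y))" by (simp only: exp_le_cancel_iff)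
        also have "\<dots> = exp \<bar>Re w\<bar> * (exp (Re w - y) * 1)" by (simp add: exp_add)
        also have "\<dots> \<le> exp \<bar>Re w\<bar> * (m * (1 + exp (\<alpha> * y)))"
          using \<open>m \<ge> 1\<close> by (intro mult_mono) (auto simp: m_def)
        finally show ?thesis .
      qed
      hence "1 / (k * (m * (1 + exp (\<alpha> * y)))) \<le> exp \<bar>Re w\<bar> / (k * exp (b * \<bar>y\<bar>))"
        using k \<open>m \<ge> 1\<close> by (simp add: divide_simps add_pos_pos)
      moreover have "norm (?f y) \<le> 1 / (k * (m * (1 + exp (\<alpha> * y))))"
      proof -
        have "norm (?f y) = 1 / (norm (1 + exp (w - of_real y)) * (1 + exp (\<alpha> * y)))"
          by (simp only: norm_divide norm_mult e norm_one)
        also have "\<dots> \<le> 1 / ((k * m) * (1 + exp (\<alpha> * y)))"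
          using k \<open>m \<ge> 1\<close> by (intro divide_left_mono mult_right_mono m mult_pos_pos)
                             (auto intro!: add_pos_pos nz1)
        finally show ?thesis by (simp add: mult.assoc)
      qed
      ultimately have "norm (?f y) \<le> exp \<bar>Re w\<bar> / (k * exp (b * \<bar>y\<bar>))"
        by (rule order_trans[rotated])
      also have "\<dots> = norm (exp \<bar>Re w\<bar> / k * exp (- b * \<bar>y\<bar>))"
        using k by (simp add: exp_minus field_simps)
      finally show "norm (?f y) \<le> norm (exp \<bar>Re w\<bar> / k * exp (- b * \<bar>y\<bar>))" .
    qed
  qed
  have "stable_F w \<alpha> = \<bar>\<alpha>\<bar> *\<^sub>R (LINT y|lborel. 1 / ((1 + exp (w - of_real ((0 + \<alpha> * y) / \<alpha>))) *
            (1 + exp (of_real (0 + \<alpha> * y)))))"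
    unfolding stable_F_def using \<alpha> by (subst lborel_integral_real_affine[of \<alpha> _ 0]) auto
  also have "\<dots> = of_real \<alpha> * (LINT y|lborel. ?f y)"
    using \<alpha> by (simp add: scaleR_conv_of_real)
  finally show "stable_F w \<alpha> = of_real \<alpha> * (LINT y|lborel. ?f y)" .
qed

lemma stable_F_diff:
  assumes r: "0 < r" "r < pi" and \<alpha>: "\<alpha> > 0" and t: "\<bar>Im t\<bar> < pi - r"
  shows "stable_F (\<i> * of_real r - t) \<alpha> - stable_F (- \<i> * of_real r - t) \<alpha> =
           - \<i> * of_real \<alpha> * fermi_integral r (t, of_real \<alpha>)"
proof -
  let ?f = "\<lambda>w y. 1 / ((1 + exp (w - complex_of_real y)) * (1 + exp (of_real (\<alpha> * y))))"
  have w: "\<bar>Im (\<i> * of_real r - t)\<bar> < pi" "\<bar>Im (- \<i> * of_real r - t)\<bar> < pi"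
    using r t by auto
  have "?f (\<i> * of_real r - t) y - ?f (- \<i> * of_real r - t) y =
          - \<i> * (poisson_kernel r (t + of_real y) / (1 + exp (of_real \<alpha> * of_real y)))" for y
  proof -
    have "?f (\<i> * of_real r - t) y - ?f (- \<i> * of_real r - t) y =
       (1 / (1 + exp (\<i> * of_real r - (t + of_real y))) - 1 / (1 + exp (- \<i> * of_real r - (t + of_real y)))) /
         (1 + exp (of_real \<alpha> * of_real y))"
      by (simp add: diff_divide_distrib algebra_simps)
    also have "\<dots> = - \<i> * poisson_kernel r (t + of_real y) / (1 + exp (of_real \<alpha> * of_real y))"
      by (subst poisson_kernel_partial_fractions) (use r t in auto)
    finally show ?thesis by simp
  qed
  hence "(LINT y|lborel. ?f (\<i> * of_real r - t) y - ?f (- \<i> * of_real r - t) y) =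
        (LINT y|lborel. - \<i> * (poisson_kernel r (t + of_real y) / (1 + exp (of_real \<alpha> * of_real y))))"
    by (simp only:)
  also have "\<dots> = - \<i> * fermi_integral r (t, of_real \<alpha>)"
    unfolding fermi_integral_def by (subst integral_mult_right_zero) simp
  finally have "(LINT y|lborel. ?f (\<i> * of_real r - t) y) - (LINT y|lborel. ?f (- \<i> * of_real r - t) y) =
          - \<i> * fermi_integral r (t, of_real \<alpha>)"
    unfolding Bochner_Integration.integral_diff[OF stable_F_rescaled(1)[OF w(1) \<alpha>] stable_F_rescaled(1)[OF w(2) \<alpha>]] .
  hence "of_real \<alpha> * ((LINT y|lborel. ?f (\<i> * of_real r - t) y) - (LINT y|lborel. ?f (- \<i> * of_real r - t) y)) =
          of_real \<alpha> * (- \<i> * fermi_integral r (t, of_real \<alpha>))"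
    by (simp only:)
  thus ?thesis
    unfolding stable_F_rescaled(2)[OF w(1) \<alpha>] stable_F_rescaled(2)[OF w(2) \<alpha>]
    by (simp only: right_diff_distrib mult_ac)
qed

lemma stable_phi_real_eq:
  assumes \<rho>: "0 < \<rho>" "\<rho> < 1" and z: "z > 0" and \<alpha>: "\<alpha> > 0"
  shows "stable_phi_real z \<alpha> \<rho> = stable_phi_at_exp (pi * \<rho>) (of_real (ln z), of_real \<alpha>)"
proof -
  define r where "r = pi * \<rho>"
  have r: "0 < r" "r < pi" using \<rho> by (auto simp: r_def)
  let ?I = "\<lambda>t. fermi_integral r (of_real t, of_real \<alpha>)"
  define f where "f = (\<lambda>u. - (of_real \<alpha> / (2 * of_real pi)) * ?I (ln u) / of_real u)"
  have p: "(of_real t, of_real \<alpha>) \<in> strip_params r" for t :: real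
    using r \<alpha> by (auto simp: strip_params_def)
  have "1 / (2 * of_real pi * \<i> * of_real u) *
       (stable_F (of_real pi * \<i> * of_real \<rho> - of_real (ln u)) \<alpha>
        - stable_F (- of_real pi * \<i> * of_real \<rho> - of_real (ln u)) \<alpha>) = f u" if u: "u > 0" for u
  proof -
    have 1: "of_real pi * \<i> * of_real \<rho> = \<i> * of_real r" "- of_real pi * \<i> * of_real \<rho> = - \<i> * of_real r"
      by (simp_all add: r_def)
    show ?thesis
      unfolding 1 by (subst stable_F_diff) (use r \<alpha> u in \<open>auto simp: f_def divide_simps\<close>)
  qed
  hence "stable_phi_real z \<alpha> \<rho> = exp (LINT u:{0<..<z}|lborel. f u)"
    unfolding stable_phi_real_def set_lebesgue_integral_def
    by (intro arg_cong[of _ _ exp] Bochner_Integration.integral_cong) (auto simp: indicator_def)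
  also have "(LINT u:{0<..<z}|lborel. f u) = (LINT s:{..0}|lborel. (z * exp s) *\<^sub>R f (z * exp s))"
  proof (rule set_integral_exp_substitution[OF z])
    have "continuous_on {0<..} (\<lambda>u. ?I (ln u))"
      by (rule continuous_on_compose2[OF holomorphic2_on_continuous[OF holomorphic2_on_fermi_integral[OF r]]])
         (use p in \<open>auto intro!: continuous_intros\<close>)
    thus "continuous_on {0<..} f"
      unfolding f_def by (intro continuous_intros) auto
    have "set_integrable lborel {..0} (\<lambda>s. fermi_integral r (fst (of_real (ln z) :: complex, of_real \<alpha> :: complex) + of_real s,
            snd (of_real (ln z) :: complex, of_real \<alpha> :: complex)))"
      using fermi_primitive_locally_bounded[OF r p] by metis
    hence "set_integrable lborel {..0} (\<lambda>s. ?I (ln z + s))" by simp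
    hence "set_integrable lborel {..0} (\<lambda>s. - (of_real \<alpha> / (2 * of_real pi)) * ?I (ln z + s))"
      by (intro set_integrable_mult_right)
    moreover have "(z * exp s) *\<^sub>R f (z * exp s) = - (of_real \<alpha> / (2 * of_real pi)) * ?I (ln z + s)" for s
      using z by (simp add: f_def ln_mult scaleR_conv_of_real del: of_real_mult of_real_add)
    ultimately show "set_integrable lborel {..0} (\<lambda>s. (z * exp s) *\<^sub>R f (z * exp s))" by simp
  qed
  also have "\<dots> = (LINT s:{..0}|lborel. - (of_real \<alpha> / (2 * of_real pi)) * ?I (ln z + s))"
    using z by (simp add: f_def ln_mult scaleR_conv_of_real del: of_real_mult of_real_add)
  also have "\<dots> = - (of_real \<alpha> / (2 * of_real pi)) * fermi_primitive r (of_real (ln z), of_real \<alpha>)"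
    by (subst set_integral_mult_right) (simp add: fermi_primitive_def)
  finally show ?thesis by (simp add: stable_phi_at_exp_def r_def)
qed

lemma fermi_primitive_vector_derivative:
  assumes r: "0 < r" "r < pi" and \<alpha>: "0 < Re \<alpha>"
  shows "((\<lambda>t. fermi_primitive r (of_real t, \<alpha>)) has_vector_derivative
            fermi_integral r (of_real t, \<alpha>)) (at t)"
proof -
  let ?I = "\<lambda>t. fermi_integral r (complex_of_real t, \<alpha>)"
  have p: "(complex_of_real t, \<alpha>) \<in> strip_params r" for t
    using r \<alpha> by (auto simp: strip_params_def)
  have cont: "continuous_on A ?I" for A
    by (rule continuous_on_compose2[OF holomorphic2_on_continuous[OF holomorphic2_on_fermi_integral[OF r]]])
       (use p in \<open>auto intro!: continuous_intros\<close>)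
  have shift: "set_integrable lborel {..x} ?I"
              "fermi_primitive r (of_real x, \<alpha>) = (LINT u:{..x}|lborel. ?I u)" for x
  proof -
    have "set_integrable lborel {..0} (\<lambda>s. fermi_integral r (fst (of_real x :: complex, \<alpha>) + of_real s,
            snd (of_real x :: complex, \<alpha>)))"
      using fermi_primitive_locally_bounded[OF r p] by metis
    hence "integrable lborel (\<lambda>s. indicator {..0} s *\<^sub>R ?I (x + s))"
      by (simp add: set_integrable_def)
    also have "(\<lambda>s. indicator {..0} s *\<^sub>R ?I (x + s)) = (\<lambda>s. indicator {..x} (x + 1 * s) *\<^sub>R ?I (x + 1 * s))"
      by (auto simp: indicator_def)
    finally show "set_integrable lborel {..x} ?I"
      unfolding set_integrable_def by (subst (asm) lborel_integrable_real_affine_iff) auto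
    have "(LINT u:{..x}|lborel. ?I u) = (LINT s|lborel. indicator {..x} (x + 1 * s) *\<^sub>R ?I (x + 1 * s))"
      unfolding set_lebesgue_integral_def
      by (subst lborel_integral_real_affine[of 1 _ x]) auto
    also have "\<dots> = (LINT s:{..0}|lborel. ?I (x + s))"
      unfolding set_lebesgue_integral_def
      by (intro Bochner_Integration.integral_cong) (auto simp: indicator_def)
    finally show "fermi_primitive r (of_real x, \<alpha>) = (LINT u:{..x}|lborel. ?I u)"
      by (simp add: fermi_primitive_def)
  qed
  define a where "a = t - 1"
  have eq: "fermi_primitive r (of_real x, \<alpha>) = fermi_primitive r (of_real a, \<alpha>) + integral {a..x} ?I"
    if "x > a" for x
  proof -
    have 1: "set_integrable lborel {a<..x} ?I" "set_integrable lborel {a..x} ?I"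
      using shift(1)[of x] by (auto intro: set_integrable_subset)
    have "{..x} = {..a} \<union> {a<..x}" using that by auto
    hence "fermi_primitive r (of_real x, \<alpha>) = (LINT u:{..a} \<union> {a<..x}|lborel. ?I u)"
      by (simp add: shift(2))
    also have "\<dots> = (LINT u:{..a}|lborel. ?I u) + (LINT u:{a<..x}|lborel. ?I u)"
      by (rule set_integral_Un) (use shift(1) 1 in auto)
    also have "(LINT u:{a<..x}|lborel. ?I u) = (LINT u:{a..x}|lborel. ?I u)"
    proof (rule set_integral_cong_set)
      show "AE u in lborel. u \<in> {a..x} \<longleftrightarrow> u \<in> {a<..x}"
        using AE_lborel_singleton[of a] by eventually_elim auto
    qed (use 1 in \<open>auto simp: set_integrable_def set_borel_measurable_def\<close>)
    also have "\<dots> = integral {a..x} ?I" by (rule set_borel_integral_eq_integral(2)[OF 1(2)])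
    finally show ?thesis by (simp add: shift(2))
  qed
  have "((\<lambda>x. integral {a..x} ?I) has_vector_derivative ?I t) (at t within {a..t+1})"
    by (rule integral_has_vector_derivative[OF cont]) (auto simp: a_def)
  hence "((\<lambda>x. integral {a..x} ?I) has_vector_derivative ?I t) (at t)"
    by (subst (asm) at_within_interior) (auto simp: a_def)
  hence "((\<lambda>x. fermi_primitive r (of_real a, \<alpha>) + integral {a..x} ?I) has_vector_derivative ?I t) (at t)"
    by (auto intro!: derivative_eq_intros)
  thus ?thesis
  proof (rule has_vector_derivative_transform_within_open[of _ _ _ "{a<..}"])
    show "fermi_primitive r (of_real a, \<alpha>) + integral {a..x} ?I = fermi_primitive r (of_real x, \<alpha>)"
      if "x \<in> {a<..}" for x using eq that by simp
  qed (auto simp: a_def)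
qed

section \<open>Residues in a horizontal strip\<close>

lemma horizontal_contour_integral:
  assumes "M > 0" and f: "continuous_on {z. Im z = c} f"
  shows "contour_integral (linepath (Complex (-M) c) (Complex M c)) f =
           integral {-M..M} (\<lambda>x. f (of_real x + \<i> * of_real c))"
    and "f contour_integrable_on linepath (Complex (-M) c) (Complex M c)"
proof -
  let ?g = "\<lambda>z. f (z + \<i> * of_real c)"
  have eq: "Complex x c = of_real x + \<i> * of_real c" for x
    by (simp add: complex_eq_iff)
  have iff: "(f has_contour_integral I) (linepath (Complex (-M) c) (Complex M c)) \<longleftrightarrow>
             (?g has_contour_integral I) (linepath (of_real (-M)) (of_real M))" for I
    unfolding has_contour_integral_linepath eq by (simp add: linepath_def algebra_simps)
  have "continuous_on {-M..M} (\<lambda>x. ?g (of_real x))"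
    by (rule continuous_on_compose2[OF f]) (auto intro!: continuous_intros)
  hence "(\<lambda>x. ?g (of_real x)) integrable_on {-M..M}"
    by (rule integrable_continuous_real)
  hence "((\<lambda>x. ?g (of_real x)) has_integral integral {-M..M} (\<lambda>x. ?g (of_real x))) {-M..M}"
    by (rule integrable_integral)
  hence "(f has_contour_integral integral {-M..M} (\<lambda>x. ?g (of_real x))) (linepath (Complex (-M) c) (Complex M c))"
    unfolding iff using \<open>M > 0\<close> by (subst has_contour_integral_linepath_Reals_iff) auto
  thus "contour_integral (linepath (Complex (-M) c) (Complex M c)) f =
           integral {-M..M} (\<lambda>x. f (of_real x + \<i> * of_real c))"
    and "f contour_integrable_on linepath (Complex (-M) c) (Complex M c)"
    by (auto intro: contour_integral_unique has_contour_integral_integrable)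
qed

lemma integral_symmetric_interval_tendsto:
  fixes f :: "real \<Rightarrow> complex"
  assumes "integrable lborel f"
  shows "(\<lambda>n. integral {- real n..real n} f) \<longlonglongrightarrow> integral\<^sup>L lborel f"
proof -
  have "integral {- real n..real n} f = (LINT x|lborel. indicator {- real n..real n} x *\<^sub>R f x)" for n
  proof -
    have "set_integrable lborel {- real n..real n} f"
      unfolding set_integrable_def by (rule integrable_mult_indicator) (use assms in auto)
    thus ?thesis
      using set_borel_integral_eq_integral(2)[of "{- real n..real n}" f] by (simp add: set_lebesgue_integral_def)
  qed
  moreover have "(\<lambda>n. LINT x|lborel. indicator {- real n..real n} x *\<^sub>R f x) \<longlonglongrightarrow> integral\<^sup>L lborel f"
  proof (rule integral_dominated_convergence[where w = "\<lambda>x. norm (f x)"])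
    show "AE x in lborel. (\<lambda>n. indicator {- real n..real n} x *\<^sub>R f x) \<longlonglongrightarrow> f x"
    proof (rule AE_I2)
      fix x :: real
      have "eventually (\<lambda>n. indicator {- real n..real n} x *\<^sub>R f x = f x) sequentially"
        using eventually_ge_at_top[of "nat \<lceil>\<bar>x\<bar>\<rceil>"]
      proof eventually_elim
        case (elim n)
        hence "\<bar>x\<bar> \<le> real n" by linarith
        thus ?case by (auto simp: indicator_def)
      qed
      thus "(\<lambda>n. indicator {- real n..real n} x *\<^sub>R f x) \<longlonglongrightarrow> f x"
        by (rule tendsto_eventually)
    qed
  qed (use assms in \<open>auto simp: indicator_def\<close>)
  ultimately show ?thesis by simp
qed

lemma open_horizontal_strip: "open {z. a < Im z \<and> Im z < b}"
  by (intro open_Collect_conj open_Collect_less continuous_intros)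

lemma convex_horizontal_strip: "convex {z. a < Im z \<and> Im z < b}"
proof -
  have "{z. a < Im z \<and> Im z < b} = {z. Im z > a} \<inter> {z. Im z < b}" by auto
  thus ?thesis by (simp add: convex_Int convex_halfspace_Im_gt convex_halfspace_Im_lt)
qed

text \<open>
  The residue theorem on the rectangles with real parts between \<open>-n\<close> and \<open>n\<close>; the bounds \<open>B n\<close>
  make the vertical sides disappear in the limit.
\<close>

lemma residue_sum_horizontal_strip:
  fixes f :: "complex \<Rightarrow> complex"
  assumes h: "h > 0" and \<epsilon>: "\<epsilon> > 0" and pts: "finite pts" "\<And>p. p \<in> pts \<Longrightarrow> -h < Im p \<and> Im p < 0"
    and holo: "f holomorphic_on {z. -h - \<epsilon> < Im z \<and> Im z < \<epsilon>} - pts"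
    and int: "integrable lborel (\<lambda>x. f (of_real x))" "integrable lborel (\<lambda>x. f (of_real x - \<i> * of_real h))"
    and decay: "B \<longlonglongrightarrow> 0" "eventually (\<lambda>n. \<forall>z. \<bar>Re z\<bar> = real n \<and> -h \<le> Im z \<and> Im z \<le> 0 \<longrightarrow> norm (f z) \<le> B n) sequentially"
  shows "(LINT x|lborel. f (of_real x - \<i> * of_real h)) - (LINT x|lborel. f (of_real x)) =
           2 * pi * \<i> * (\<Sum>p\<in>pts. residue f p)"
proof -
  define S where "S = {z. -h - \<epsilon> < Im z \<and> Im z < \<epsilon>}"
  have S: "open S" "convex S"
    unfolding S_def by (rule open_horizontal_strip convex_horizontal_strip)+
  define side where "side = (\<lambda>n. contour_integral (linepath (Complex (real n) (-h)) (Complex (real n) 0)) f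
                               + contour_integral (linepath (Complex (- real n) 0) (Complex (- real n) (-h))) f)"
  define R where "R = Max (insert 0 ((\<lambda>p. \<bar>Re p\<bar>) ` pts))"
  have R: "\<bar>Re p\<bar> \<le> R" if "p \<in> pts" for p
    unfolding R_def using pts that by (intro Max_ge) auto
  have cont: "continuous_on (S - pts) f" using holo by (simp add: S_def holomorphic_on_imp_continuous_on)
  have large: "eventually (\<lambda>n. real n > R \<and> n > 0) sequentially"
    using eventually_gt_at_top[of "nat \<lceil>R\<rceil> + 1"] by eventually_elim linarith
  have main: "integral {- real n..real n} (\<lambda>x. f (of_real x - \<i> * of_real h)) - integral {- real n..real n} (\<lambda>x. f (of_real x))
                + side n = 2 * pi * \<i> * (\<Sum>p\<in>pts. residue f p)"
    and vert: "f contour_integrable_on linepath (Complex (real n) (-h)) (Complex (real n) 0)"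
        "f contour_integrable_on linepath (Complex (- real n) 0) (Complex (- real n) (-h))"
    if n: "real n > R \<and> n > 0" for n
  proof -
    define a1 a2 a3 a4 where "a1 = Complex (- real n) (-h)" and "a2 = Complex (real n) (-h)"
      and "a3 = Complex (real n) 0" and "a4 = Complex (- real n) 0"
    note a = a1_def a2_def a3_def a4_def
    have seg: "closed_segment a2 a3 \<subseteq> S - pts" "closed_segment a4 a1 \<subseteq> S - pts"
              "closed_segment a1 a2 \<subseteq> S - pts" "closed_segment a3 a4 \<subseteq> S - pts"
      using n h \<epsilon> R pts
      by (force simp: a S_def closed_segment_same_Re closed_segment_same_Im closed_segment_eq_real_ivl)+
    have ci: "f contour_integrable_on linepath a2 a3" "f contour_integrable_on linepath a4 a1"
             "f contour_integrable_on linepath a1 a2" "f contour_integrable_on linepath a3 a4"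
      using seg by (auto intro!: contour_integrable_continuous_linepath continuous_on_subset[OF cont])
    show "f contour_integrable_on linepath (Complex (real n) (-h)) (Complex (real n) 0)"
        "f contour_integrable_on linepath (Complex (- real n) 0) (Complex (- real n) (-h))"
      using ci by (simp_all add: a)
    have rp: "rectpath a1 a3 = linepath a1 a2 +++ linepath a2 a3 +++ linepath a3 a4 +++ linepath a4 a1"
      by (simp add: rectpath_def a Let_def)
    have "contour_integral (rectpath a1 a3) f = 2 * pi * \<i> * (\<Sum>p\<in>pts. winding_number (rectpath a1 a3) p * residue f p)"
    proof (rule Residue_theorem[of S])
      show "f holomorphic_on S - pts" using holo by (simp add: S_def)
      have "path_image (rectpath a1 a3) = closed_segment a1 a2 \<union> closed_segment a2 a3 \<union> closed_segment a3 a4 \<union> closed_segment a4 a1"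
        unfolding rp by (simp add: path_image_join Un_assoc)
      thus sub: "path_image (rectpath a1 a3) \<subseteq> S - pts" using seg by blast
      show "\<forall>z. z \<notin> S \<longrightarrow> winding_number (rectpath a1 a3) z = 0"
        using sub S by (intro allI impI winding_number_zero_outside[of _ S]) auto
    qed (use S pts in \<open>auto intro: convex_connected\<close>)
    also have "(\<Sum>p\<in>pts. winding_number (rectpath a1 a3) p * residue f p) = (\<Sum>p\<in>pts. residue f p)"
    proof (rule sum.cong)
      fix p assume p: "p \<in> pts"
      have "p \<in> box a1 a3" using pts(2)[OF p] R[OF p] n by (auto simp: a in_box_complex_iff)
      thus "winding_number (rectpath a1 a3) p * residue f p = residue f p"
        by (simp add: winding_number_rectpath)
    qed simp
    also have "contour_integral (rectpath a1 a3) f =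
        contour_integral (linepath a1 a2) f + contour_integral (linepath a3 a4) f +
        (contour_integral (linepath a2 a3) f + contour_integral (linepath a4 a1) f)"
      unfolding rp using ci by (simp add: contour_integrable_joinI)
    also have "contour_integral (linepath a2 a3) f + contour_integral (linepath a4 a1) f = side n"
      by (simp add: side_def a)
    also have "contour_integral (linepath a3 a4) f = - contour_integral (linepath a4 a3) f"
      using ci(4) by (metis contour_integral_reversepath reversepath_linepath valid_path_linepath minus_minus)
    also have "contour_integral (linepath a4 a3) f = integral {- real n..real n} (\<lambda>x. f (of_real x + \<i> * of_real 0))"
      unfolding a using n pts \<epsilon> h
      by (intro horizontal_contour_integral(1) continuous_on_subset[OF cont]) (auto simp: S_def dest: pts(2))
    also have "contour_integral (linepath a1 a2) f = integral {- real n..real n} (\<lambda>x. f (of_real x + \<i> * of_real (-h)))"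
      unfolding a using n pts \<epsilon> h
      by (intro horizontal_contour_integral(1) continuous_on_subset[OF cont]) (auto simp: S_def dest: pts(2))
    finally show "integral {- real n..real n} (\<lambda>x. f (of_real x - \<i> * of_real h)) - integral {- real n..real n} (\<lambda>x. f (of_real x))
                + side n = 2 * pi * \<i> * (\<Sum>p\<in>pts. residue f p)" by simp
  qed
  have "side \<longlonglongrightarrow> 0"
  proof (rule Lim_null_comparison)
    show "(\<lambda>n. 2 * h * B n) \<longlonglongrightarrow> 0" using tendsto_mult_right_zero[OF decay(1)] by simp
    show "eventually (\<lambda>n. norm (side n) \<le> 2 * h * B n) sequentially"
      using large decay(2)
    proof eventually_elim
      case (elim n)
      have "norm (f (Complex (real n) 0)) \<le> B n" using elim(2) h by auto
      hence B: "B n \<ge> 0" by (meson norm_ge_zero order_trans)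
      have d: "norm (Complex (real n) 0 - Complex (real n) (- h)) = h"
              "norm (Complex (- real n) (-h) - Complex (- real n) 0) = h"
        using h by (simp_all add: cmod_def)
      have "norm (contour_integral (linepath (Complex (real n) (-h)) (Complex (real n) 0)) f) \<le> B n * h"
        using contour_integral_bound_linepath[OF vert(1)[OF elim(1)] B] elim(2) h
        unfolding d by (auto simp: closed_segment_same_Re closed_segment_eq_real_ivl)
      moreover have "norm (contour_integral (linepath (Complex (- real n) 0) (Complex (- real n) (-h))) f) \<le> B n * h"
        using contour_integral_bound_linepath[OF vert(2)[OF elim(1)] B] elim(2) h
        unfolding d by (auto simp: closed_segment_same_Re closed_segment_eq_real_ivl)
      ultimately have "norm (side n) \<le> B n * h + B n * h"
        unfolding side_def by (intro norm_triangle_le add_mono)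
      thus ?case by (simp add: algebra_simps)
    qed
  qed
  hence "(\<lambda>n. integral {- real n..real n} (\<lambda>x. f (of_real x - \<i> * of_real h)) - integral {- real n..real n} (\<lambda>x. f (of_real x))
                + side n) \<longlonglongrightarrow>
          (LINT x|lborel. f (of_real x - \<i> * of_real h)) - (LINT x|lborel. f (of_real x)) + 0"
    by (intro tendsto_add tendsto_diff integral_symmetric_interval_tendsto int)
  moreover have "(\<lambda>n. integral {- real n..real n} (\<lambda>x. f (of_real x - \<i> * of_real h)) - integral {- real n..real n} (\<lambda>x. f (of_real x))
                + side n) \<longlonglongrightarrow> 2 * pi * \<i> * (\<Sum>p\<in>pts. residue f p)"
    by (rule tendsto_eventually, rule eventually_mono[OF large]) (rule main)
  ultimately show ?thesis using LIMSEQ_unique by fastforce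
qed

section \<open>The shift relation for the convolution integral\<close>

lemma one_plus_exp_eq_0_iff: "1 + exp w = 0 \<longleftrightarrow> (\<exists>k::int. w = \<i> * of_real (pi * (2 * of_int k + 1)))"
proof -
  have "1 + exp w = 0 \<longleftrightarrow> exp w = exp (\<i> * pi)"
    by (simp add: add_eq_0_iff)
  also have "\<dots> \<longleftrightarrow> (\<exists>k::int. w = \<i> * of_real (pi * (2 * of_int k + 1)))"
    unfolding exp_eq by (intro ex_cong1) (simp add: algebra_simps)
  finally show ?thesis .
qed

text \<open>
  Every factor of the integrand has its zeros at imaginary parts that are odd multiples of \<open>\<pi>\<close>, up to
  a shift; this picks out the single one inside the strip.
\<close>

lemma odd_multiple_pi_window:
  fixes k :: int
  assumes "- 3 * pi < pi * (2 * of_int k + 1)" "pi * (2 * of_int k + 1) < pi"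
  shows "k = - 1"
proof -
  have "pi * (- 3) < pi * (2 * of_int k + 1)" "pi * (2 * of_int k + 1) < pi * 1"
    using assms by simp_all
  hence "- 3 < 2 * real_of_int k + 1" "2 * real_of_int k + 1 < 1"
    by (simp_all only: mult_less_cancel_left_pos[OF pi_gt_zero])
  thus ?thesis by linarith
qed

lemma norm_one_plus_exp_far:
  assumes "\<bar>Re w\<bar> \<ge> 1"
  shows "max 1 (exp (Re w)) / 2 \<le> norm (1 + exp w)"
proof -
  have ge: "\<bar>exp (Re w) - 1\<bar> \<le> norm (1 + exp w)"
    using norm_triangle_ineq3[of "exp w" "- 1"] by (simp add: add.commute)
  show ?thesis
  proof (cases "Re w \<ge> 1")
    case True
    hence "exp (Re w) \<ge> 2" using exp_ge_add_one_self[of "Re w"] by linarith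
    moreover from this have "max 1 (exp (Re w)) = exp (Re w)" by (intro max_absorb2) linarith
    ultimately show ?thesis using ge by linarith
  next
    case False
    hence "exp (- Re w) \<ge> 2" using exp_ge_add_one_self[of "- Re w"] assms by linarith
    hence "exp (Re w) \<le> 1 / 2" by (simp add: exp_minus field_simps)
    moreover from this have "max 1 (exp (Re w)) = 1" by (intro max_absorb1) linarith
    ultimately show ?thesis using ge by linarith
  qed
qed

lemma norm_poisson_kernel_far:
  assumes "\<bar>Re s\<bar> \<ge> 1"
  shows "norm (poisson_kernel r s) \<le> 8 * exp (- \<bar>Re s\<bar>)"
  using poisson_kernel_bound_of_factors[of "1 / 2" s r]
    norm_one_plus_exp_far[of "s + \<i> * of_real r"] norm_one_plus_exp_far[of "s - \<i> * of_real r"] assms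
  by (simp add: power2_eq_square)

text \<open>
  The strip \<open>-2\<pi> \<le> Im y \<le> 0\<close> is one period of the kernel, and on its lower edge the
  integrand is, after a real translation of \<open>y\<close>, the original one with \<open>t\<close> replaced by
  \<open>t - 2\<pi>v\<close>. The strip contains three simple poles:
  \<open>y0\<close> from \<open>1 + e^{\<alpha>y}\<close>, whose residue gives the term in \<open>X\<close>, and \<open>pole r\<close>, \<open>pole (-r)\<close> from the kernel,
  whose residues give the terms in \<open>W1\<close> and \<open>W2\<close>. The restriction to \<open>1/\<alpha> = 1 - \<i>v\<close> makes
  \<open>y0\<close> the only zero of \<open>1 + e^{\<alpha>y}\<close> in the strip.
\<close>

lemma fermi_integral_shift:
  fixes r v t :: real
  defines "\<alpha> \<equiv> 1 / (1 - \<i> * of_real v)"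
    and "X \<equiv> exp (of_real t - of_real pi * of_real v)"
    and "W1 \<equiv> exp ((1 / (1 - \<i> * of_real v)) * (of_real t + \<i> * of_real pi + \<i> * of_real r))"
    and "W2 \<equiv> exp ((1 / (1 - \<i> * of_real v)) * (of_real t + \<i> * of_real pi - \<i> * of_real r))"
  assumes r: "0 < r" "r < pi" and v: "v > 0"
  shows "- (\<alpha> / (2 * of_real pi)) *
           (fermi_integral r (of_real t, \<alpha>) - fermi_integral r (of_real (t - 2 * pi * v), \<alpha>)) =
         2 * \<i> * of_real (sin r) * X / ((1 - X * exp (\<i> * of_real r)) * (1 - X * exp (- \<i> * of_real r)))
         + \<alpha> * W1 / (1 + W1) - \<alpha> * W2 / (1 + W2)" (is "?L = ?R")
    and "1 + W1 \<noteq> 0" "1 + W2 \<noteq> 0" "1 - X * exp (\<i> * of_real r) \<noteq> 0" "1 - X * exp (- \<i> * of_real r) \<noteq> 0"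
proof -
  define f where "f = (\<lambda>y. poisson_kernel r (of_real t + y) / (1 + exp (\<alpha> * y)))"
  define e :: "real \<Rightarrow> complex" where "e = (\<lambda>x. exp (\<i> * of_real x))"
  define y0 where "y0 = - of_real pi * (of_real v + \<i>)"
  define pole where "pole = (\<lambda>\<sigma>::real. - of_real t - \<i> * of_real pi - \<i> * of_real \<sigma>)"
  define fac where "fac = (\<lambda>\<sigma> y. 1 + exp (of_real t + y + \<i> * complex_of_real \<sigma>))"
  define K0 where "K0 = poisson_kernel r (of_real t + y0)"
  define U1 U2 where "U1 = W1 / (1 + W1)" and "U2 = W2 / (1 + W2)"
  \<comment> \<open>A margin of this size reaches exactly up to the next poles of the kernel.\<close>
  define \<epsilon> where "\<epsilon> = pi - r"
  define S where "S = {z. -(2 * pi) - \<epsilon> < Im z \<and> Im z < \<epsilon>}"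
  have nv: "1 - \<i> * of_real v \<noteq> 0" by (simp add: complex_eq_iff)
  have \<alpha>_nz: "\<alpha> \<noteq> 0" using nv by (simp add: \<alpha>_def)
  have \<alpha>_eq: "\<alpha> = (1 + \<i> * of_real v) / of_real (1 + v\<^sup>2)"
  proof -
    have "(1 - \<i> * of_real v) * (1 + \<i> * of_real v) = of_real (1 + v\<^sup>2)"
      by (simp add: complex_eq_iff power2_eq_square)
    moreover have "complex_of_real (1 + v\<^sup>2) \<noteq> 0"
      by (metis of_real_eq_0_iff power_one sum_power2_eq_zero_iff zero_neq_one)
    ultimately show ?thesis using nv by (simp add: \<alpha>_def field_simps)
  qed
  have v2: "1 + v\<^sup>2 > 0" by (simp add: add_pos_nonneg)
  have Re\<alpha>: "Re \<alpha> > 0" using v2 by (simp add: \<alpha>_eq Re_divide_of_real del: of_real_add)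
  have Re\<alpha>y: "Re (\<alpha> * y) = (Re y - v * Im y) / (1 + v\<^sup>2)" for y
  proof -
    have "\<alpha> * y = ((1 + \<i> * of_real v) * y) / of_real (1 + v\<^sup>2)" by (simp add: \<alpha>_eq)
    thus ?thesis by (simp only: Re_divide_of_real) simp
  qed
  have zero_ray: "\<exists>k::int. y = of_real (pi * (2 * of_int k + 1)) * (of_real v + \<i>)" if "1 + exp (\<alpha> * y) = 0" for y
  proof -
    obtain k :: int where "\<alpha> * y = \<i> * of_real (pi * (2 * of_int k + 1))"
      using \<open>1 + exp (\<alpha> * y) = 0\<close> one_plus_exp_eq_0_iff by blast
    hence "y = (1 - \<i> * of_real v) * (\<i> * of_real (pi * (2 * of_int k + 1)))"
      using nv by (simp add: \<alpha>_def field_simps)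
    also have "\<dots> = of_real (pi * (2 * of_int k + 1)) * (of_real v + \<i>)"
      by (simp add: complex_eq_iff algebra_simps)
    finally show ?thesis by blast
  qed
  have zero0: "y = y0" if y: "y \<in> S" "1 + exp (\<alpha> * y) = 0" for y
  proof -
    obtain k :: int where k: "y = of_real (pi * (2 * of_int k + 1)) * (of_real v + \<i>)"
      using zero_ray y by blast
    have "Im y = pi * (2 * of_int k + 1)" by (simp add: k)
    hence "- 3 * pi < pi * (2 * of_int k + 1)" "pi * (2 * of_int k + 1) < pi"
      using y(1) r unfolding S_def \<epsilon>_def mem_Collect_eq by linarith+
    hence "k = -1" by (rule odd_multiple_pi_window)
    thus ?thesis unfolding k by (simp add: y0_def)
  qed
  have zero_fac: "y = pole \<sigma>" if y: "y \<in> S" "fac \<sigma> y = 0" and \<sigma>: "\<bar>\<sigma>\<bar> \<le> r" for y \<sigma>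
  proof -
    obtain k :: int where "of_real t + y + \<i> * of_real \<sigma> = \<i> * of_real (pi * (2 * of_int k + 1))"
      using y one_plus_exp_eq_0_iff unfolding fac_def by blast
    hence k: "y = \<i> * of_real (pi * (2 * of_int k + 1)) - of_real t - \<i> * of_real \<sigma>"
      by (simp add: algebra_simps)
    have "Im y = pi * (2 * of_int k + 1) - \<sigma>" by (simp add: k)
    hence "- 3 * pi < pi * (2 * of_int k + 1)" "pi * (2 * of_int k + 1) < pi"
      using y(1) \<sigma> unfolding S_def \<epsilon>_def mem_Collect_eq by linarith+
    hence "k = -1" by (rule odd_multiple_pi_window)
    thus ?thesis unfolding k by (simp add: pole_def)
  qed
  have Im_y: "Im y0 = - pi" "Im (pole \<sigma>) = - pi - \<sigma>" for \<sigma>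
    by (simp_all add: y0_def pole_def)
  have pole_ne: "y0 \<noteq> pole r" "y0 \<noteq> pole (- r)" "pole r \<noteq> pole (- r)"
  proof -
    have ne: "a \<noteq> b" if "Im a \<noteq> Im b" for a b using that by blast
    show "y0 \<noteq> pole r" by (rule ne) (use r in \<open>simp add: Im_y\<close>)
    show "y0 \<noteq> pole (- r)" by (rule ne) (use r in \<open>simp add: Im_y\<close>)
    show "pole r \<noteq> pole (- r)" by (rule ne) (use r in \<open>simp add: Im_y\<close>)
  qed
  have yS: "y0 \<in> S" "pole r \<in> S" "pole (- r) \<in> S"
    using r by (auto simp: S_def Im_y \<epsilon>_def)
  have sub_strip: "open (S \<inter> {z. a < Im z \<and> Im z < b})" "connected (S \<inter> {z. a < Im z \<and> Im z < b})" for a b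
    unfolding S_def by (auto intro!: open_Int convex_connected convex_Int open_horizontal_strip convex_horizontal_strip)
  have e_pi: "exp (\<i> * of_real pi) = -1" "exp (- (\<i> * of_real pi)) = -1" by (simp_all add: exp_minus)
  have e_inv: "exp (- (\<i> * of_real x)) = inverse (e x)" for x by (simp add: e_def exp_minus)
  have sin_e: "e x - inverse (e x) = 2 * \<i> * of_real (sin x)" for x
    by (simp add: sin_exp_eq sin_of_real[symmetric] e_def exp_minus)
  have sin_nz: "sin r > 0" using r by (intro sin_gt_zero)
  have eX: "exp (of_real t + y0) = - X"
  proof -
    have "of_real t + y0 = (of_real t - of_real pi * of_real v) + (- (\<i> * of_real pi))"
      by (simp add: y0_def algebra_simps)
    thus ?thesis unfolding X_def by (simp only: exp_add e_pi) simp
  qed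
  have eX1: "exp (of_real t + y0 + \<i> * of_real r) = - X * e r" "exp (of_real t + y0 - \<i> * of_real r) = - X * inverse (e r)"
    unfolding exp_add[of "of_real t + y0"] diff_conv_add_uminus[of "of_real t + y0"] eX e_inv by (simp_all add: e_def)
  show Xnz: "1 - X * exp (\<i> * of_real r) \<noteq> 0" "1 - X * exp (- \<i> * of_real r) \<noteq> 0"
    using zero_fac[OF yS(1), of r] zero_fac[OF yS(1), of "- r"] eX1 pole_ne r e_inv
    by (auto simp: e_def fac_def)
  have ray: "exp (\<alpha> * pole r) = inverse W1" "exp (\<alpha> * pole (- r)) = inverse W2"
    unfolding W1_def W2_def \<alpha>_def[symmetric] exp_minus[symmetric]
    by (simp_all add: pole_def algebra_simps)
  have ray_nz: "1 + exp (\<alpha> * pole r) \<noteq> 0" "1 + exp (\<alpha> * pole (- r)) \<noteq> 0"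
    using zero0[OF yS(2)] zero0[OF yS(3)] pole_ne by auto
  have W_nz: "W1 \<noteq> 0" "W2 \<noteq> 0" by (simp_all add: W1_def W2_def)
  show W1nz: "1 + W1 \<noteq> 0" using ray_nz(1) W_nz unfolding ray by (auto simp: field_simps add_eq_0_iff)
  show W2nz: "1 + W2 \<noteq> 0" using ray_nz(2) W_nz unfolding ray by (auto simp: field_simps add_eq_0_iff)
  have e0: "exp (\<alpha> * y0) = -1"
  proof -
    have "\<alpha> * y0 = - (\<i> * of_real pi)"
    proof -
      have "y0 = (1 - \<i> * of_real v) * (- (\<i> * of_real pi))"
        by (simp add: y0_def complex_eq_iff)
      thus ?thesis using nv by (simp add: \<alpha>_def)
    qed
    thus ?thesis by (simp only: e_pi)
  qed
  have f_alt: "f y = 2 * of_real (sin r) * exp (of_real t + y) / (fac \<sigma> y * fac (- \<sigma>) y * (1 + exp (\<alpha> * y)))"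
    if "\<bar>\<sigma>\<bar> = r" for \<sigma> y
    using that by (auto simp: f_def poisson_kernel_def fac_def abs_eq_iff' mult_ac)
  have fac_hol: "fac \<sigma> holomorphic_on A" for \<sigma> A
    unfolding fac_def by (intro holomorphic_intros)
  have holo: "f holomorphic_on S - {y0, pole r, pole (- r)}"
    unfolding f_alt[of r, OF abs_of_pos[OF r(1)], abs_def]
    by (intro holomorphic_intros fac_hol) (use zero0 zero_fac[of _ r] zero_fac[of _ "- r"] r in auto)
  have res0: "residue f y0 = - (poisson_kernel r (of_real t + y0) / \<alpha>)"
  proof -
    let ?s = "S \<inter> {z. - pi - r < Im z \<and> Im z < - pi + r}"
    have "residue (\<lambda>w. poisson_kernel r (of_real t + w) / (1 + exp (\<alpha> * w))) y0 =
            poisson_kernel r (of_real t + y0) / (- \<alpha>)"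
    proof (rule residue_simple_pole_deriv[of _ ?s])
      have "fac r w \<noteq> 0" "fac (- r) w \<noteq> 0" if "w \<in> ?s" for w
        using that zero_fac[of w r] zero_fac[of w "- r"] Im_y r by auto
      thus "(\<lambda>w. poisson_kernel r (of_real t + w)) holomorphic_on ?s"
        unfolding poisson_kernel_def by (intro holomorphic_intros) (auto simp: fac_def)
      show "poisson_kernel r (of_real t + y0) \<noteq> 0"
        using Xnz sin_nz unfolding poisson_kernel_def eX1 eX by (auto simp: X_def e_def exp_minus)
      show "((\<lambda>w. 1 + exp (\<alpha> * w)) has_field_derivative - \<alpha>) (at y0)"
        using e0 by (auto intro!: derivative_eq_intros)
    qed (use e0 \<alpha>_nz sub_strip yS Im_y r in \<open>auto intro!: holomorphic_intros\<close>)
    thus ?thesis by (simp add: f_def[abs_def])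
  qed
  \<comment> \<open>The poles of the kernel in the strip belong to \<open>\<sigma> = r\<close> and \<open>\<sigma> = -r\<close>; the quotient of sines is the sign of \<open>\<sigma>\<close>.\<close>
  have res: "residue f (pole \<sigma>) = - \<i> * of_real (sin r / sin \<sigma>) / (1 + exp (\<alpha> * pole \<sigma>))"
    if \<sigma>: "\<bar>\<sigma>\<bar> = r" for \<sigma>
  proof -
    let ?s = "S \<inter> {z. - pi - \<sigma> - r < Im z \<and> Im z < - pi - \<sigma> + r}"
    let ?F = "\<lambda>w. 2 * of_real (sin r) * exp (of_real t + w) / (fac (- \<sigma>) w * (1 + exp (\<alpha> * w)))"
    have \<sigma>': "\<sigma> = r \<or> \<sigma> = - r" using \<sigma> by (auto simp: abs_eq_iff')
    have ey: "exp (of_real t + pole \<sigma> + \<i> * of_real x) = - exp (\<i> * of_real (x - \<sigma>))" for x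
    proof -
      have "of_real t + pole \<sigma> + \<i> * of_real x = - (\<i> * of_real pi) + \<i> * of_real (x - \<sigma>)"
        by (simp add: pole_def algebra_simps)
      thus ?thesis by (simp only: exp_add e_pi) simp
    qed
    have pole0: "fac \<sigma> (pole \<sigma>) = 0" unfolding fac_def ey by simp
    have poleS: "pole \<sigma> \<in> S" using \<sigma>' yS by auto
    have ray_\<sigma>: "1 + exp (\<alpha> * pole \<sigma>) \<noteq> 0" using \<sigma>' ray_nz by auto
    have nz: "fac (- \<sigma>) w \<noteq> 0" "1 + exp (\<alpha> * w) \<noteq> 0" if "w \<in> ?s" for w
      using that \<sigma>' zero_fac[of w "- \<sigma>"] zero0[of w] Im_y r by auto
    have nz_pole: "fac (- \<sigma>) (pole \<sigma>) \<noteq> 0"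
      using zero_fac[OF poleS, of "- \<sigma>"] \<sigma>' pole_ne(3) r by auto
    have "residue (\<lambda>w. ?F w / fac \<sigma> w) (pole \<sigma>) = ?F (pole \<sigma>) / (- 1)"
    proof (rule residue_simple_pole_deriv[of _ ?s])
      show "?F holomorphic_on ?s"
        by (intro holomorphic_intros fac_hol) (use nz in auto)
      show "?F (pole \<sigma>) \<noteq> 0" using nz_pole ray_\<sigma> sin_nz by auto
      show "(fac \<sigma> has_field_derivative - 1) (at (pole \<sigma>))"
        using ey[of \<sigma>] unfolding fac_def by (auto intro!: derivative_eq_intros)
    qed (use pole0 poleS Im_y r sub_strip fac_hol in auto)
    also have "(\<lambda>w. ?F w / fac \<sigma> w) = f"
      using f_alt[OF \<sigma>] by (simp add: fun_eq_iff mult_ac)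
    also have "?F (pole \<sigma>) / (- 1) = - \<i> * of_real (sin r / sin \<sigma>) / (1 + exp (\<alpha> * pole \<sigma>))"
    proof -
      have e\<sigma>: "exp (of_real t + pole \<sigma>) = - inverse (e \<sigma>)" "fac (- \<sigma>) (pole \<sigma>) = 1 - (inverse (e \<sigma>))\<^sup>2"
        unfolding fac_def using ey[of 0] ey[of "- \<sigma>"]
        by (simp_all add: e_def power2_eq_square mult_ac flip: exp_minus exp_add)
      have "e \<sigma> \<noteq> 0" "sin \<sigma> \<noteq> 0" using \<sigma>' sin_nz by (auto simp: e_def)
      have "of_real (sin \<sigma>) * exp (of_real t + pole \<sigma>) * 2 = \<i> * fac (- \<sigma>) (pole \<sigma>)"
      proof -
        have "2 * of_real (sin \<sigma>) = - (\<i> * (2 * \<i> * of_real (sin \<sigma>)))" by simp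
        also have "\<dots> = - (\<i> * (e \<sigma> - inverse (e \<sigma>)))" unfolding sin_e ..
        finally have s: "2 * of_real (sin \<sigma>) = - (\<i> * (e \<sigma> - inverse (e \<sigma>)))" .
        have "of_real (sin \<sigma>) * exp (of_real t + pole \<sigma>) * 2 = (2 * of_real (sin \<sigma>)) * exp (of_real t + pole \<sigma>)"
          by simp
        also have "\<dots> = \<i> * fac (- \<sigma>) (pole \<sigma>)"
          unfolding s e\<sigma> using \<open>e \<sigma> \<noteq> 0\<close> by (simp add: power2_eq_square field_simps)
        finally show ?thesis .
      qed
      hence "2 * of_real (sin r) * exp (of_real t + pole \<sigma>) = \<i> * of_real (sin r / sin \<sigma>) * fac (- \<sigma>) (pole \<sigma>)"
        using \<open>sin \<sigma> \<noteq> 0\<close> by (simp add: field_simps)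
      thus ?thesis using nz_pole ray_\<sigma> by simp
    qed
    finally show ?thesis .
  qed
  have res1: "residue f (pole r) = - \<i> / (1 + exp (\<alpha> * pole r))"
    and res2: "residue f (pole (- r)) = \<i> / (1 + exp (\<alpha> * pole (- r)))"
    using res[of r] res[of "- r"] r sin_nz by simp_all
  \<comment> \<open>On the lower edge \<open>\<alpha>v = \<i> - \<i>\<alpha>\<close> turns the imaginary shift of the Fermi function into a real one.\<close>
  have lower: "f (of_real x - \<i> * of_real (2 * pi)) =
                 poisson_kernel r (of_real (t - 2 * pi * v) + of_real (2 * pi * v + 1 * x)) /
                   (1 + exp (\<alpha> * of_real (2 * pi * v + 1 * x)))" for x
  proof -
    have per: "exp (w - \<i> * of_real (2 * pi)) = exp w" for w
      using exp_two_pi_i' by (simp add: exp_diff mult.commute)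
    have "exp (of_real t + (of_real x - \<i> * of_real (2 * pi))) = exp (of_real t + of_real x)"
         "exp (of_real t + (of_real x - \<i> * of_real (2 * pi)) + \<i> * of_real r) = exp (of_real t + of_real x + \<i> * of_real r)"
         "exp (of_real t + (of_real x - \<i> * of_real (2 * pi)) - \<i> * of_real r) = exp (of_real t + of_real x - \<i> * of_real r)"
      using per[of "of_real t + of_real x"] per[of "of_real t + of_real x + \<i> * of_real r"]
            per[of "of_real t + of_real x - \<i> * of_real r"] by (simp_all add: algebra_simps)
    hence 1: "poisson_kernel r (of_real t + (of_real x - \<i> * of_real (2 * pi))) = poisson_kernel r (of_real t + of_real x)"
      by (simp only: poisson_kernel_def)
    have "\<alpha> * (of_real x - \<i> * of_real (2 * pi)) = \<alpha> * of_real (2 * pi * v + x) - \<i> * of_real (2 * pi)"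
    proof -
      have "\<alpha> * (1 - \<i> * of_real v) = 1" using nv by (simp add: \<alpha>_def)
      hence "\<i> * (\<alpha> * (1 - \<i> * of_real v)) = \<i>" by simp
      hence "\<alpha> * of_real v = \<i> - \<i> * \<alpha>" by (simp add: algebra_simps)
      hence "\<alpha> * of_real v * of_real (2 * pi) = (\<i> - \<i> * \<alpha>) * of_real (2 * pi)" by simp
      thus ?thesis by (simp add: algebra_simps)
    qed
    hence 2: "exp (\<alpha> * (of_real x - \<i> * of_real (2 * pi))) = exp (\<alpha> * of_real (2 * pi * v + x))"
      by (simp only: per)
    show ?thesis unfolding f_def 1 2 by (simp add: algebra_simps)
  qed
  have p: "(of_real x, \<alpha>) \<in> strip_params r" for x :: real
    using Re\<alpha> r by (simp add: strip_params_def)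
  have int1: "integrable lborel (\<lambda>x. f (of_real x))"
    using integrable_fermi_integrand[OF r p[of t]] by (simp add: f_def)
  have int2: "integrable lborel (\<lambda>x. f (of_real x - \<i> * of_real (2 * pi)))"
    unfolding lower using integrable_fermi_integrand[OF r p[of "t - 2 * pi * v"]]
    by (intro lborel_integrable_real_affine) simp_all
  have I1: "(LINT x|lborel. f (of_real x)) = fermi_integral r (of_real t, \<alpha>)"
    by (simp add: f_def fermi_integral_def)
  have I2: "(LINT x|lborel. f (of_real x - \<i> * of_real (2 * pi))) = fermi_integral r (of_real (t - 2 * pi * v), \<alpha>)"
    unfolding lower fermi_integral_def
    by (subst lborel_integral_real_affine[of 1 _ "2 * pi * v"]) simp_all
  have "(LINT x|lborel. f (of_real x - \<i> * of_real (2 * pi))) - (LINT x|lborel. f (of_real x)) =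
          2 * pi * \<i> * (\<Sum>p\<in>{y0, pole r, pole (- r)}. residue f p)"
  proof (rule residue_sum_horizontal_strip[where \<epsilon> = \<epsilon> and B = "\<lambda>n. 16 * exp \<bar>t\<bar> * exp (- real n)"])
    show "f holomorphic_on {z. - (2 * pi) - \<epsilon> < Im z \<and> Im z < \<epsilon>} - {y0, pole r, pole (- r)}"
      using holo by (simp add: S_def)
    show "- (2 * pi) < Im p \<and> Im p < 0" if "p \<in> {y0, pole r, pole (- r)}" for p
      using that Im_y r by auto
    have "(\<lambda>n. exp (- real n)) \<longlonglongrightarrow> 0"
      by (intro filterlim_compose[OF exp_at_bot]
            filterlim_compose[OF filterlim_uminus_at_bot_at_top filterlim_real_sequentially])
    thus "(\<lambda>n. 16 * exp \<bar>t\<bar> * exp (- real n)) \<longlonglongrightarrow> 0"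
      by (rule tendsto_mult_right_zero)
    show "eventually (\<lambda>n. \<forall>z. \<bar>Re z\<bar> = real n \<and> - (2 * pi) \<le> Im z \<and> Im z \<le> 0 \<longrightarrow>
            norm (f z) \<le> 16 * exp \<bar>t\<bar> * exp (- real n)) sequentially"
      using eventually_ge_at_top[of "nat \<lceil>1 + v\<^sup>2 + 2 * pi * v + \<bar>t\<bar>\<rceil>"]
    proof eventually_elim
      case (elim n)
      have n: "1 + v\<^sup>2 + 2 * pi * v + \<bar>t\<bar> \<le> real n" using elim by linarith
      have vp: "0 \<le> 2 * pi * v" using v by simp
      show ?case
      proof (intro allI impI)
        fix z assume z: "\<bar>Re z\<bar> = real n \<and> - (2 * pi) \<le> Im z \<and> Im z \<le> 0"
        have "Re (of_real t + z) = t + Re z" by simp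
        hence far: "\<bar>Re (of_real t + z)\<bar> \<ge> real n - \<bar>t\<bar>" "real n - \<bar>t\<bar> \<ge> 1"
          using z n vp zero_le_power2[of v] by linarith+
        have "norm (poisson_kernel r (of_real t + z)) \<le> 8 * exp (- \<bar>Re (of_real t + z)\<bar>)"
          using far by (intro norm_poisson_kernel_far) linarith
        also have "\<dots> \<le> 8 * exp (\<bar>t\<bar> - real n)"
          using far by simp
        finally have 1: "norm (poisson_kernel r (of_real t + z)) \<le> 8 * exp (\<bar>t\<bar> - real n)" .
        have vI: "0 \<le> - (v * Im z)" "- (v * Im z) \<le> 2 * pi * v"
          using z v mult_left_mono[of "- Im z" "2 * pi" v] by (auto simp: mult_nonneg_nonpos mult_ac)
        have "\<bar>Re z - v * Im z\<bar> \<ge> 1 + v\<^sup>2"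
          using z n vI by (cases "Re z \<ge> 0") auto
        hence "\<bar>Re (\<alpha> * z)\<bar> \<ge> 1" unfolding Re\<alpha>y using v2 by (simp add: abs_divide)
        hence "max 1 (exp (Re (\<alpha> * z))) / 2 \<le> norm (1 + exp (\<alpha> * z))"
          by (rule norm_one_plus_exp_far)
        hence 2: "1 / 2 \<le> norm (1 + exp (\<alpha> * z))" by simp
        have "norm (f z) \<le> 8 * exp (\<bar>t\<bar> - real n) / (1 / 2)"
          unfolding f_def norm_divide by (intro frac_le 1 2) auto
        also have "\<dots> = 16 * exp \<bar>t\<bar> * exp (- real n)" by (simp add: exp_diff exp_minus field_simps)
        finally show "norm (f z) \<le> 16 * exp \<bar>t\<bar> * exp (- real n)" .
      qed
    qed
  qed (use r int1 int2 in \<open>auto simp: \<epsilon>_def\<close>)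
  also have "(\<Sum>p\<in>{y0, pole r, pole (- r)}. residue f p) = residue f y0 + residue f (pole r) + residue f (pole (- r))"
    using pole_ne by simp
  also have "residue f y0 + residue f (pole r) + residue f (pole (- r)) = - (K0 / \<alpha>) - \<i> * U1 + \<i> * U2"
  proof -
    have "1 / (1 + exp (\<alpha> * pole r)) = U1" "1 / (1 + exp (\<alpha> * pole (- r))) = U2"
      unfolding ray U1_def U2_def using W_nz W1nz W2nz by (simp_all add: field_simps)
    hence "\<i> / (1 + exp (\<alpha> * pole r)) = \<i> * U1" "\<i> / (1 + exp (\<alpha> * pole (- r))) = \<i> * U2"
      by (metis mult.right_neutral times_divide_eq_right)+
    thus ?thesis unfolding res0 res1 res2 K0_def by simp
  qed
  finally have "fermi_integral r (of_real t, \<alpha>) - fermi_integral r (of_real (t - 2 * pi * v), \<alpha>) =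
      - (2 * pi * \<i> * (- (K0 / \<alpha>) - \<i> * U1 + \<i> * U2))"
    unfolding I1 I2 by (simp add: algebra_simps)
  hence "?L = - (\<alpha> / (2 * of_real pi)) * - (2 * pi * \<i> * (- (K0 / \<alpha>) - \<i> * U1 + \<i> * U2))"
    by simp
  also have "\<dots> = - \<i> * K0 + \<alpha> * U1 - \<alpha> * U2"
    using \<alpha>_nz by (simp add: field_simps)
  also have "- \<i> * K0 =
      2 * \<i> * of_real (sin r) * X / ((1 - X * exp (\<i> * of_real r)) * (1 - X * exp (- \<i> * of_real r)))"
    unfolding K0_def poisson_kernel_def eX1 eX by (simp add: e_def exp_minus)
  finally show "?L = ?R" by (simp add: U1_def U2_def)
qed

section \<open>The product formula near the real parameters\<close>

lemma has_vector_derivative_along_reals: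
  fixes f :: "complex \<Rightarrow> complex"
  assumes "(f has_field_derivative D) (at (of_real t))"
  shows "((\<lambda>x. f (of_real x)) has_vector_derivative D) (at t)"
proof -
  have "((of_real :: real \<Rightarrow> complex) has_vector_derivative 1) (at t)"
    by (auto intro!: derivative_eq_intros simp: has_vector_derivative_def bounded_linear_of_real scaleR_conv_of_real
             bounded_linear.has_derivative[OF bounded_linear_of_real, of "\<lambda>x. x"])
  from field_vector_diff_chain_at[OF this assms] show ?thesis by (simp add: o_def)
qed

text \<open>
  The primitive is holomorphic, so its complex derivative at a real point can be read off from the
  derivative along the real line.
\<close>

lemma fermi_primitive_field_derivative:
  assumes r: "0 < r" "r < pi" and \<alpha>: "0 < Re \<alpha>"
  shows "((\<lambda>s. fermi_primitive r (s, \<alpha>)) has_field_derivative fermi_integral r (of_real t, \<alpha>)) (at (of_real t))"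
proof -
  have "(\<lambda>s. fermi_primitive r (s, \<alpha>)) holomorphic_on {s. \<bar>Im s\<bar> < pi - r}"
    by (rule holomorphic2_on_slice1[OF holomorphic2_on_fermi_primitive[OF r]])
       (use \<alpha> in \<open>auto simp: strip_params_def\<close>)
  moreover have "open {s. \<bar>Im s\<bar> < pi - r}" by (intro open_Collect_less continuous_intros)
  ultimately obtain D where D: "((\<lambda>s. fermi_primitive r (s, \<alpha>)) has_field_derivative D) (at (of_real t))"
    using r by (metis (mono_tags, lifting) holomorphic_derivI Im_complex_of_real abs_zero diff_gt_0_iff_gt mem_Collect_eq)
  have "((\<lambda>x. fermi_primitive r (of_real x, \<alpha>)) has_vector_derivative D) (at t)"
    by (rule has_vector_derivative_along_reals[OF D])
  with fermi_primitive_vector_derivative[OF r \<alpha>, of t] have "D = fermi_integral r (of_real t, \<alpha>)"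
    using vector_derivative_unique_at by blast
  with D show ?thesis by simp
qed

lemma fermi_primitive_at_bot:
  assumes r: "0 < r" "r < pi" and \<alpha>: "0 < Re \<alpha>"
  shows "((\<lambda>t. fermi_primitive r (of_real t, \<alpha>)) \<longlongrightarrow> 0) at_bot"
proof -
  have p: "(complex_of_real 0, \<alpha>) \<in> strip_params r" using assms by (simp add: strip_params_def)
  obtain V C b where V: "(complex_of_real 0, \<alpha>) \<in> V" "C > 0" "b > 0"
    "\<And>t \<alpha> s. (t, \<alpha>) \<in> V \<Longrightarrow> (t + of_real s, \<alpha>) \<in> V"
    "\<And>q. q \<in> V \<Longrightarrow> norm (fermi_primitive r q) \<le> C * exp (b * Re (fst q))"
    using fermi_primitive_locally_bounded[OF r p] by metis
  have bd: "norm (fermi_primitive r (of_real t, \<alpha>)) \<le> C * exp (b * t)" for t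
    using V(5)[OF V(4)[OF V(1), of t]] by simp
  have "filterlim (\<lambda>t. b * t) at_bot at_bot"
    using \<open>b > 0\<close> by (intro filterlim_tendsto_pos_mult_at_bot[OF tendsto_const] filterlim_ident)
  hence "((\<lambda>t. C * exp (b * t)) \<longlongrightarrow> C * 0) at_bot"
    by (intro tendsto_intros filterlim_compose[OF exp_at_bot])
  hence "((\<lambda>t. C * exp (b * t)) \<longlongrightarrow> 0) at_bot" by simp
  thus ?thesis
    by (rule Lim_null_comparison[rotated]) (use bd in simp)
qed

lemma log_derivative_cancel:
  fixes A :: "complex \<Rightarrow> complex"
  assumes d: "(A has_field_derivative A') (at s)" "(B has_field_derivative B') (at s)"
    "(C has_field_derivative C') (at s)" "(D has_field_derivative D') (at s)"
    "(G has_field_derivative G') (at s)"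
    and nz: "A s \<noteq> 0" "B s \<noteq> 0" "C s \<noteq> 0" "D s \<noteq> 0"
    and eq: "A' / A s + B' / B s - C' / C s - D' / D s + G' = 0"
  shows "((\<lambda>s. A s * B s / (C s * D s) * exp (G s)) has_field_derivative 0) (at s)"
proof -
  have "((\<lambda>s. A s * B s / (C s * D s) * exp (G s)) has_field_derivative
      (A s * B s / (C s * D s) * exp (G s)) * (A' / A s + B' / B s - C' / C s - D' / D s + G')) (at s)"
    using nz by (auto intro!: derivative_eq_intros d simp: field_simps)
  thus ?thesis by (simp add: eq)
qed

text \<open>
  The quotient \<open>Q\<close> of the two sides has logarithmic derivative 0 on the real line by the shift relation,
  and it tends to 1 at \<open>-\<infinity>\<close>.
\<close>

lemma stable_phi_at_exp_functional_equation:
  fixes r v t :: real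
  defines "\<alpha> \<equiv> 1 / (1 - \<i> * of_real v)"
  assumes r: "0 < r" "r < pi" and v: "v > 0"
  shows "stable_phi_at_exp r (of_real t, \<alpha>) *
           ((1 - exp (of_real t - of_real pi * of_real v) * exp (\<i> * of_real r)) *
            (1 + exp (\<alpha> * (of_real t + \<i> * of_real pi - \<i> * of_real r)))) =
         (1 - exp (of_real t - of_real pi * of_real v) * exp (- \<i> * of_real r)) *
         (1 + exp (\<alpha> * (of_real t + \<i> * of_real pi + \<i> * of_real r))) *
         stable_phi_at_exp r (of_real (t - 2 * pi * v), \<alpha>)"
proof -
  define u w :: complex where "u = exp (\<i> * of_real r)" and "w = exp (- \<i> * of_real r)"
  define X where "X = (\<lambda>s::complex. exp (s - of_real pi * of_real v))"
  define W1 where "W1 = (\<lambda>s::complex. exp (\<alpha> * (s + \<i> * of_real pi + \<i> * of_real r)))"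
  define W2 where "W2 = (\<lambda>s::complex. exp (\<alpha> * (s + \<i> * of_real pi - \<i> * of_real r)))"
  define \<Lambda> where "\<Lambda> = (\<lambda>s. fermi_primitive r (s, \<alpha>))"
  define G where "G = (\<lambda>s. \<alpha> / (2 * of_real pi) * (\<Lambda> s - \<Lambda> (s - of_real (2 * pi * v))))"
  define Q where "Q = (\<lambda>s. (1 - X s * w) * (1 + W1 s) / ((1 - X s * u) * (1 + W2 s)) * exp (G s))"
  have Re\<alpha>: "0 < Re \<alpha>"
    using v by (simp add: \<alpha>_def Re_divide power2_eq_square add_pos_nonneg)
  have uw: "u - w = 2 * \<i> * of_real (sin r)"
    by (simp add: u_def w_def sin_exp_eq sin_of_real[symmetric] exp_minus)
  have nz: "1 + W1 (of_real t) \<noteq> 0" "1 + W2 (of_real t) \<noteq> 0" "1 - X (of_real t) * u \<noteq> 0" "1 - X (of_real t) * w \<noteq> 0" for t :: real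
    using fermi_integral_shift(2-5)[OF r v, of t] by (simp_all add: W1_def W2_def X_def u_def w_def \<alpha>_def)
  have deriv_Q: "(Q has_field_derivative 0) (at (of_real t))" for t :: real
    unfolding Q_def
  proof (rule log_derivative_cancel)
    let ?s = "complex_of_real t"
    let ?dI = "fermi_integral r (?s, \<alpha>) - fermi_integral r (of_real (t - 2 * pi * v), \<alpha>)"
    show "((\<lambda>s. 1 - X s * w) has_field_derivative - (X ?s * w)) (at ?s)"
         "((\<lambda>s. 1 + W1 s) has_field_derivative \<alpha> * W1 ?s) (at ?s)"
         "((\<lambda>s. 1 - X s * u) has_field_derivative - (X ?s * u)) (at ?s)"
         "((\<lambda>s. 1 + W2 s) has_field_derivative \<alpha> * W2 ?s) (at ?s)"
      unfolding X_def W1_def W2_def by (auto intro!: derivative_eq_intros)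
    have 1: "(\<Lambda> has_field_derivative fermi_integral r (of_real x, \<alpha>)) (at (of_real x))" for x :: real
      unfolding \<Lambda>_def by (rule fermi_primitive_field_derivative[OF r Re\<alpha>])
    have "((\<lambda>s. s - of_real (2 * pi * v)) has_field_derivative 1) (at ?s)"
      by (auto intro!: derivative_eq_intros)
    from DERIV_chain2[of \<Lambda> _ "\<lambda>s. s - of_real (2 * pi * v)", OF _ this]
    have 2: "((\<lambda>s. \<Lambda> (s - of_real (2 * pi * v))) has_field_derivative fermi_integral r (of_real (t - 2 * pi * v), \<alpha>)) (at ?s)"
      using 1[of "t - 2 * pi * v"] by simp
    show "(G has_field_derivative \<alpha> / (2 * of_real pi) * ?dI) (at ?s)"
      unfolding G_def by (intro DERIV_cmult DERIV_diff 1 2)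
    have "\<alpha> / (2 * of_real pi) * ?dI =
            - ((u - w) * X ?s / ((1 - X ?s * u) * (1 - X ?s * w)) + \<alpha> * W1 ?s / (1 + W1 ?s) - \<alpha> * W2 ?s / (1 + W2 ?s))"
      using fermi_integral_shift(1)[OF r v, of t]
      unfolding uw by (simp add: W1_def W2_def X_def u_def w_def \<alpha>_def minus_equation_iff[of "_ / _"])
    moreover have "- (X ?s * w) / (1 - X ?s * w) - - (X ?s * u) / (1 - X ?s * u) = (u - w) * X ?s / ((1 - X ?s * u) * (1 - X ?s * w))"
      using nz[of t] by (simp add: field_simps)
    ultimately show "- (X ?s * w) / (1 - X ?s * w) + \<alpha> * W1 ?s / (1 + W1 ?s) - - (X ?s * u) / (1 - X ?s * u) -
        \<alpha> * W2 ?s / (1 + W2 ?s) + \<alpha> / (2 * of_real pi) * ?dI = 0"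
      by (simp add: algebra_simps)
  qed (use nz[of t] in auto)
  have "((\<lambda>x. Q (of_real x)) has_vector_derivative 0) (at x)" for x :: real
    by (rule has_vector_derivative_along_reals[OF deriv_Q])
  hence "\<exists>c. \<forall>x\<in>UNIV. Q (complex_of_real x) = c"
    by (intro has_derivative_zero_constant) (auto simp: has_vector_derivative_def)
  then obtain c where c: "\<And>x. Q (complex_of_real x) = c" by blast
  have exp_lim: "((\<lambda>x. exp (\<beta> * complex_of_real x + k)) \<longlongrightarrow> 0) at_bot" if "Re \<beta> > 0" for \<beta> k
  proof (rule tendsto_norm_zero_cancel)
    have "((\<lambda>x. exp (Re \<beta> * x) * exp (Re k)) \<longlongrightarrow> 0 * exp (Re k)) at_bot"
      using that
      by (intro tendsto_mult tendsto_const filterlim_compose[OF exp_at_bot]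
            filterlim_tendsto_pos_mult_at_bot[OF tendsto_const] filterlim_ident)
    thus "((\<lambda>x. norm (exp (\<beta> * complex_of_real x + k))) \<longlongrightarrow> 0) at_bot"
      by (simp add: exp_add norm_mult)
  qed
  have LX: "((\<lambda>x. X (complex_of_real x)) \<longlongrightarrow> 0) at_bot"
    using exp_lim[of 1 "- (of_real pi * of_real v)"] by (simp add: X_def)
  have lim: "((\<lambda>x. Q (complex_of_real x)) \<longlongrightarrow> (1 - 0 * w) * (1 + 0) / ((1 - 0 * u) * (1 + 0)) * exp (\<alpha> / (2 * of_real pi) * (0 - 0))) at_bot"
    unfolding Q_def G_def
  proof (intro tendsto_intros)
    show "((\<lambda>x. W1 (complex_of_real x)) \<longlongrightarrow> 0) at_bot"
      using exp_lim[OF Re\<alpha>, of "\<alpha> * (\<i> * of_real pi + \<i> * of_real r)"] by (simp add: W1_def algebra_simps)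
    show "((\<lambda>x. W2 (complex_of_real x)) \<longlongrightarrow> 0) at_bot"
      using exp_lim[OF Re\<alpha>, of "\<alpha> * (\<i> * of_real pi - \<i> * of_real r)"] by (simp add: W2_def algebra_simps)
    show L: "((\<lambda>x. \<Lambda> (complex_of_real x)) \<longlongrightarrow> 0) at_bot"
      unfolding \<Lambda>_def by (rule fermi_primitive_at_bot[OF r Re\<alpha>])
    have "filterlim (\<lambda>x::real. x - 2 * pi * v) at_bot at_bot"
      unfolding filterlim_at_bot
    proof
      fix Z :: real
      show "eventually (\<lambda>x. x - 2 * pi * v \<le> Z) at_bot"
        using eventually_le_at_bot[of "Z + 2 * pi * v"] by eventually_elim linarith
    qed
    from filterlim_compose[OF L this]
    show "((\<lambda>x. \<Lambda> (complex_of_real x - of_real (2 * pi * v))) \<longlongrightarrow> 0) at_bot" by simp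
  qed (use LX in auto)
  hence "((\<lambda>x::real. c) \<longlongrightarrow> 1) at_bot" by (simp add: c)
  hence "c = 1" by (simp add: tendsto_const_iff)
  hence Q1: "Q (of_real t) = 1" using c by simp
  have "exp (G (of_real t)) * stable_phi_at_exp r (of_real t, \<alpha>) = stable_phi_at_exp r (of_real (t - 2 * pi * v), \<alpha>)"
    by (simp add: G_def stable_phi_at_exp_def \<Lambda>_def algebra_simps flip: exp_add)
  hence "(1 - X (of_real t) * w) * (1 + W1 (of_real t)) / ((1 - X (of_real t) * u) * (1 + W2 (of_real t))) *
           stable_phi_at_exp r (of_real (t - 2 * pi * v), \<alpha>) = Q (of_real t) * stable_phi_at_exp r (of_real t, \<alpha>)"
    by (simp add: Q_def)
  hence "(1 - X (of_real t) * w) * (1 + W1 (of_real t)) * stable_phi_at_exp r (of_real (t - 2 * pi * v), \<alpha>) =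
          stable_phi_at_exp r (of_real t, \<alpha>) * ((1 - X (of_real t) * u) * (1 + W2 (of_real t)))"
    unfolding Q1
  proof -
    have gen: "a * x = y * b" if "a / b * x = 1 * y" "b \<noteq> 0" for a b x y :: complex
      using that by (auto simp: field_simps)
    show ?thesis if "(1 - X (of_real t) * w) * (1 + W1 (of_real t)) / ((1 - X (of_real t) * u) * (1 + W2 (of_real t))) *
           stable_phi_at_exp r (of_real (t - 2 * pi * v), \<alpha>) = 1 * stable_phi_at_exp r (of_real t, \<alpha>)"
      by (rule gen[OF that]) (use nz[of t] in simp)
  qed
  thus ?thesis
    by (simp add: X_def W1_def W2_def u_def w_def)
qed

text \<open>
  The product in \<open>z = e^t\<close> times the product in \<open>z^\<alpha> = e^{\<alpha>t}\<close>: \<open>r = \<pi>\<rho>\<close> gives the numerator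
  of the product formula, and \<open>r = -\<pi>\<rho>\<close> its denominator.
\<close>

definition double_qpoch :: "real \<Rightarrow> complex \<times> complex \<Rightarrow> complex" where
  "double_qpoch r p =
     qpoch_inf (- exp (fst p - \<i> * of_real pi / snd p - \<i> * of_real r)) (exp (- (2 * of_real pi * \<i>) / snd p)) *
     qpoch_inf (- exp (snd p * (fst p + \<i> * of_real pi + \<i> * of_real r))) (exp (2 * of_real pi * \<i> * snd p))"

lemma Im_inverse_neg:
  assumes "Im \<alpha> > 0" shows "Im (1 / \<alpha>) < 0"
proof -
  have "(Re \<alpha>)\<^sup>2 + (Im \<alpha>)\<^sup>2 > 0" using assms by (simp add: add_nonneg_pos)
  thus ?thesis using assms by (simp add: Im_divide)
qed

lemma norm_nomes_less_1:
  assumes "Im \<alpha> > 0"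
  shows "norm (exp (2 * of_real pi * \<i> * \<alpha>)) < 1" "norm (exp (- (2 * of_real pi * \<i>) / \<alpha>)) < 1"
proof -
  show "norm (exp (2 * of_real pi * \<i> * \<alpha>)) < 1" using assms by simp
  have eq: "- (2 * of_real pi * \<i>) / \<alpha> = - (2 * of_real pi * \<i>) * (1 / \<alpha>)" by simp
  have "Re (- (2 * of_real pi * \<i>) * \<beta>) = 2 * pi * Im \<beta>" for \<beta> by simp
  hence "Re (- (2 * of_real pi * \<i>) / \<alpha>) = 2 * pi * Im (1 / \<alpha>)" unfolding eq .
  also have "\<dots> < 0" using Im_inverse_neg[OF assms] by (intro mult_pos_neg) auto
  finally show "norm (exp (- (2 * of_real pi * \<i>) / \<alpha>)) < 1" by (simp only: norm_exp_eq_Re) simp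
qed

lemma holomorphic2_on_double_qpoch: "double_qpoch r holomorphic2_on UNIV \<times> {\<alpha>. Im \<alpha> > 0}"
proof -
  let ?W = "UNIV \<times> {\<alpha>. Im \<alpha> > 0} :: (complex \<times> complex) set"
  have W: "open ?W" by (intro open_Times open_Collect_less continuous_intros) auto
  have "(\<lambda>p. qpoch_inf (0 - exp (fst p - \<i> * of_real pi / snd p - \<i> * of_real r)) (exp ((- (2 * of_real pi * \<i>)) / snd p)) *
     qpoch_inf (0 - exp (snd p * (fst p + \<i> * of_real pi + \<i> * of_real r))) (exp (2 * of_real pi * \<i> * snd p)))
       holomorphic2_on ?W"
    by (intro holomorphic2_intros holomorphic2_on_qpoch[OF W] norm_nomes_less_1) auto
  thus ?thesis by (simp add: double_qpoch_def[abs_def])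
qed

text \<open>
  Step \<open>n\<close> of the iterated functional equation contributes the factors with index \<open>n\<close> of all four
  infinite products.
\<close>

lemma stable_phi_at_exp_product_on_curve:
  fixes r v t :: real
  defines "\<alpha> \<equiv> 1 / (1 - \<i> * of_real v)"
  assumes r: "0 < r" "r < pi" and v: "v > 0"
  shows "stable_phi_at_exp r (of_real t, \<alpha>) * double_qpoch (- r) (of_real t, \<alpha>) = double_qpoch r (of_real t, \<alpha>)"
proof -
  have nv: "1 - \<i> * of_real v \<noteq> 0" by (simp add: complex_eq_iff)
  have \<alpha>1: "\<alpha> * (1 - \<i> * of_real v) = 1" "1 / \<alpha> = 1 - \<i> * of_real v" using nv by (simp_all add: \<alpha>_def)
  have \<alpha>v: "\<alpha> * of_real v = \<i> - \<i> * \<alpha>"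
  proof -
    have "\<i> * (\<alpha> * (1 - \<i> * of_real v)) = \<i>" using \<alpha>1 by simp
    thus ?thesis by (simp add: algebra_simps)
  qed
  have pos: "0 < Re \<alpha>" "0 < Im \<alpha>"
    using v by (simp_all add: \<alpha>_def Re_divide Im_divide power2_eq_square add_pos_nonneg)
  define q qt where "q = exp (2 * of_real pi * \<i> * \<alpha>)" and "qt = exp (- (2 * of_real pi * \<i>) / \<alpha>)"
  have q: "norm q < 1" "norm qt < 1" unfolding q_def qt_def by (rule norm_nomes_less_1[OF pos(2)])+
  have div: "x / \<alpha> = x * (1 - \<i> * of_real v)" for x using \<alpha>1(2) by (metis divide_inverse inverse_eq_divide)
  have e_pi: "exp (\<i> * of_real pi) = -1" "exp (- (\<i> * of_real pi)) = -1" by (simp_all add: exp_minus)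
  have e2pi: "exp (- (2 * of_real pi * \<i>)) = 1" by (simp add: exp_minus)
  have qt_eq: "qt = exp (- of_real (2 * pi * v))"
  proof -
    have "- (2 * of_real pi * \<i>) / \<alpha> = - (2 * of_real pi * \<i>) + (- of_real (2 * pi * v))"
      unfolding div by (simp add: algebra_simps)
    thus ?thesis unfolding qt_def by (simp only: exp_add e2pi) simp
  qed
  have q_eq: "q = exp (- (\<alpha> * of_real (2 * pi * v)))"
  proof -
    have "- (\<alpha> * of_real (2 * pi * v)) = - (2 * of_real pi * \<i>) + 2 * of_real pi * \<i> * \<alpha>"
    proof -
      have "\<alpha> * of_real (2 * pi * v) = 2 * of_real pi * (\<alpha> * of_real v)" by simp
      thus ?thesis unfolding \<alpha>v by (simp add: algebra_simps)
    qed
    thus ?thesis unfolding q_def by (simp only: exp_add e2pi) simp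
  qed
  define X where "X = exp (complex_of_real t - of_real pi * of_real v)"
  define W where "W = (\<lambda>s::real. exp (\<alpha> * (of_real t + \<i> * of_real pi + \<i> * of_real s)))"
  define e where "e = (\<lambda>s::real. exp (- (\<i> * of_real s)))"
  have dq: "double_qpoch s (of_real t, \<alpha>) = qpoch_inf (X * e s) qt * qpoch_inf (- W s) q" for s
  proof -
    have "of_real t - \<i> * of_real pi / \<alpha> - \<i> * of_real s =
            (of_real t - of_real pi * of_real v) + (- (\<i> * of_real pi)) + (- (\<i> * of_real s))"
      unfolding div by (simp add: algebra_simps)
    hence "- exp (of_real t - \<i> * of_real pi / \<alpha> - \<i> * of_real s) = X * e s"
      unfolding X_def e_def by (simp only: exp_add e_pi) simp
    thus ?thesis by (simp add: double_qpoch_def W_def q_def qt_def)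
  qed
  let ?\<phi> = "\<lambda>t. stable_phi_at_exp r (of_real t, \<alpha>)"
  define fac where "fac = (\<lambda>s k. (1 - (X * e s) * qt ^ k) * (1 - (- W s) * q ^ k))"
  have step: "?\<phi> (t - 2 * pi * v * real n) * fac (- r) n = fac r n * ?\<phi> (t - 2 * pi * v * real (Suc n))" for n
  proof -
    have 1: "exp (of_real (t - 2 * pi * v * real n) - of_real pi * of_real v) = X * qt ^ n"
      unfolding X_def qt_eq exp_of_nat_mult[symmetric] exp_add[symmetric] by (simp add: algebra_simps)
    have 2: "exp (\<alpha> * (of_real (t - 2 * pi * v * real n) + \<i> * of_real pi + \<i> * of_real s)) = W s * q ^ n" for s
      unfolding W_def q_eq exp_of_nat_mult[symmetric] exp_add[symmetric] by (simp add: algebra_simps)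
    have 3: "exp (\<alpha> * (of_real (t - 2 * pi * v * real n) + \<i> * of_real pi - \<i> * of_real r)) = W (- r) * q ^ n"
      using 2[of "- r"] by simp
    have 4: "exp (\<i> * of_real r) = e (- r)" "exp (- \<i> * of_real r) = e r" by (simp_all add: e_def)
    have 5: "t - 2 * pi * v * real n - 2 * pi * v = t - 2 * pi * v * real (Suc n)" by (simp add: algebra_simps)
    show ?thesis
      using stable_phi_at_exp_functional_equation[OF r v, of "t - 2 * pi * v * real n"]
      unfolding \<alpha>_def[symmetric] 1 2 3 4 5 by (simp add: fac_def mult_ac)
  qed
  have prod: "?\<phi> t * (\<Prod>k<n. fac (- r) k) = (\<Prod>k<n. fac r k) * ?\<phi> (t - 2 * pi * v * real n)" for n
  proof (induction n)
    case (Suc n)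
    have "?\<phi> t * (\<Prod>k<Suc n. fac (- r) k) = (?\<phi> t * (\<Prod>k<n. fac (- r) k)) * fac (- r) n"
      by simp
    also have "\<dots> = (\<Prod>k<n. fac r k) * (?\<phi> (t - 2 * pi * v * real n) * fac (- r) n)"
      unfolding Suc.IH by (simp only: mult_ac)
    finally show ?case unfolding step by simp
  qed simp
  have lim_phi: "(\<lambda>n. ?\<phi> (t - 2 * pi * v * real n)) \<longlonglongrightarrow> 1"
  proof -
    have "filterlim (\<lambda>n. 2 * pi * v * real n) at_top sequentially"
      using v by (intro filterlim_tendsto_pos_mult_at_top[OF tendsto_const] filterlim_real_sequentially) auto
    hence "filterlim (\<lambda>n. t - 2 * pi * v * real n) at_bot sequentially"
      using filterlim_tendsto_add_at_top[OF tendsto_const[of "- t"]]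
      by (subst filterlim_uminus_at_bot) (simp add: algebra_simps)
    from filterlim_compose[OF fermi_primitive_at_bot[OF r pos(1)] this]
    have "(\<lambda>n. exp (- (\<alpha> / (2 * of_real pi)) * fermi_primitive r (of_real (t - 2 * pi * v * real n), \<alpha>)))
            \<longlonglongrightarrow> exp (- (\<alpha> / (2 * of_real pi)) * 0)"
      by (intro tendsto_exp tendsto_mult tendsto_const)
    thus ?thesis by (simp add: stable_phi_at_exp_def)
  qed
  have lim_fac: "(\<lambda>n. \<Prod>k<n. fac s k) \<longlonglongrightarrow> qpoch_inf (X * e s) qt * qpoch_inf (- W s) q" for s
    unfolding fac_def prod.distrib by (intro tendsto_mult qpoch_LIMSEQ q)
  have "(\<lambda>n. ?\<phi> t * (\<Prod>k<n. fac (- r) k)) \<longlonglongrightarrow> ?\<phi> t * (qpoch_inf (X * e (- r)) qt * qpoch_inf (- W (- r)) q)"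
    by (intro tendsto_mult tendsto_const lim_fac)
  moreover have "(\<lambda>n. (\<Prod>k<n. fac r k) * ?\<phi> (t - 2 * pi * v * real n))
                   \<longlonglongrightarrow> (qpoch_inf (X * e r) qt * qpoch_inf (- W r) q) * 1"
    by (intro tendsto_mult lim_phi lim_fac)
  ultimately have "?\<phi> t * (qpoch_inf (X * e (- r)) qt * qpoch_inf (- W (- r)) q) =
        (qpoch_inf (X * e r) qt * qpoch_inf (- W r) q) * 1"
    unfolding prod using LIMSEQ_unique by blast
  thus ?thesis by (simp add: dq)
qed

lemma stable_phi_at_exp_product:
  assumes r: "0 < r" "r < pi" and t: "\<bar>Im t\<bar> < pi - r" and \<alpha>: "0 < Re \<alpha>" "0 < Im \<alpha>"
  shows "stable_phi_at_exp r (t, \<alpha>) * double_qpoch (- r) (t, \<alpha>) = double_qpoch r (t, \<alpha>)"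
proof -
  define A where "A = {t. \<bar>Im t\<bar> < pi - r}"
  define B where "B = {\<alpha>. 0 < Re \<alpha>} \<inter> {\<alpha>. 0 < Im \<alpha>}"
  define f where "f = (\<lambda>p. stable_phi_at_exp r p * double_qpoch (- r) p - double_qpoch r p)"
  have "A = {t. - (pi - r) < Im t \<and> Im t < pi - r}" by (auto simp: A_def)
  hence A: "open A" "connected A"
    using convex_connected[OF convex_horizontal_strip] open_horizontal_strip by simp_all
  have B: "open B" "connected B" unfolding B_def
    by (auto intro!: open_Int open_Collect_less continuous_intros convex_connected convex_Int
          convex_halfspace_Im_gt convex_halfspace_Re_gt)
  have f: "f holomorphic2_on A \<times> B"
    unfolding f_def
    by (intro holomorphic2_intros holomorphic2_on_subset[OF holomorphic2_on_stable_phi_at_exp[OF r]]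
          holomorphic2_on_subset[OF holomorphic2_on_double_qpoch])
       (auto simp: A_def B_def strip_params_def)
  define c where "c = (\<lambda>v::real. 1 / (1 - \<i> * of_real v))"
  have nv: "1 - \<i> * complex_of_real v \<noteq> 0" for v by (simp add: complex_eq_iff)
  have cB: "c v \<in> B" if "v > 0" for v
    using that by (simp add: c_def B_def Re_divide Im_divide power2_eq_square add_pos_nonneg)
  have c_inj: "c v \<noteq> c v'" if "v \<noteq> v'" for v v'
    using that nv[of v] nv[of v'] by (simp add: c_def field_simps)
  have lim_c: "c 1 islimpt (c ` {0<..})"
  proof (rule islimpt_injective_image)
    show "isCont c 1" unfolding c_def by (intro continuous_intros nv)
  qed (use c_inj in \<open>auto intro!: interior_limit_point simp: interior_open\<close>)
  have lim_R: "(0 :: complex) islimpt (range of_real)"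
    using islimpt_of_real_image[of UNIV 0] by simp
  have "f (t, \<alpha>) = 0"
  proof (rule holomorphic2_eq_zero[OF f A B _ _ lim_R _ _ lim_c])
    show "f (x, y) = 0" if xy: "x \<in> range of_real" "y \<in> c ` {0<..}" for x y
    proof -
      obtain u v where "x = of_real u" "y = c v" "v > 0" using xy by auto
      thus ?thesis using stable_phi_at_exp_product_on_curve[OF r, of v u] by (simp add: f_def c_def)
    qed
    show "range of_real \<subseteq> A" "0 \<in> A" using r by (auto simp: A_def)
    show "c ` {0<..} \<subseteq> B" "c 1 \<in> B" using cB by auto
    show "t \<in> A" "\<alpha> \<in> B" using t \<alpha> by (auto simp: A_def B_def)
  qed
  thus ?thesis by (simp add: f_def)
qed

section \<open>Meromorphic continuation and its uniqueness\<close>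

lemma upper_params_eq: "upper_params = (- \<real>\<^sub>\<le>\<^sub>0) \<times> {\<alpha>. 0 < Im \<alpha>}"
proof -
  have "(z \<noteq> 0 \<and> \<bar>Arg z\<bar> < pi) \<longleftrightarrow> z \<notin> \<real>\<^sub>\<le>\<^sub>0" for z
  proof (cases "z = 0")
    case False
    have "\<bar>Arg z\<bar> < pi \<longleftrightarrow> Arg z \<noteq> pi"
      using mpi_less_Arg[of z] Arg_le_pi[of z] by auto
    also have "\<dots> \<longleftrightarrow> z \<notin> \<real>\<^sub>\<le>\<^sub>0"
      using False by (auto simp: Arg_eq_pi complex_nonpos_Reals_iff complex_eq_iff)
    finally show ?thesis using False by simp
  qed auto
  thus ?thesis by (auto simp: upper_params_def)
qed

lemma slit_plane: "open (- \<real>\<^sub>\<le>\<^sub>0 :: complex set)" "connected (- \<real>\<^sub>\<le>\<^sub>0 :: complex set)"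
proof -
  show "open (- \<real>\<^sub>\<le>\<^sub>0 :: complex set)" by (simp add: closed_nonpos_Reals_complex open_Compl)
  have eq: "(\<real>\<^sub>\<le>\<^sub>0 :: complex set) = of_real ` {..0}" by (auto simp: nonpos_Reals_def)
  have "starlike (- \<real>\<^sub>\<le>\<^sub>0 :: complex set)" unfolding eq by (rule starlike_slotted_complex_plane_left)
  thus "connected (- \<real>\<^sub>\<le>\<^sub>0 :: complex set)" by (rule starlike_imp_connected)
qed

lemma upper_half_plane: "open {\<alpha>. 0 < Im \<alpha>}" "connected {\<alpha>. 0 < Im \<alpha>}"
  by (auto intro!: open_Collect_less continuous_intros convex_connected convex_halfspace_Im_gt)

lemma open_upper_params: "open upper_params" and connected_upper_params: "connected upper_params"
  unfolding upper_params_eq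
  by (intro open_Times connected_Times slit_plane upper_half_plane)+

definition double_qpoch_Ln :: "real \<Rightarrow> complex \<times> complex \<Rightarrow> complex" where
  "double_qpoch_Ln r p = double_qpoch r (Ln (fst p), snd p)"

lemma holomorphic2_on_double_qpoch_Ln: "double_qpoch_Ln r holomorphic2_on upper_params"
  unfolding double_qpoch_Ln_def[abs_def]
  by (rule holomorphic2_on_compose_fst[OF holomorphic2_on_double_qpoch, where A = "- \<real>\<^sub>\<le>\<^sub>0"])
     (auto intro!: holomorphic_intros simp: upper_params_eq)

definition sector_params :: "real \<Rightarrow> (complex \<times> complex) set" where
  "sector_params r = {p. fst p \<notin> \<real>\<^sub>\<le>\<^sub>0 \<and> (Ln (fst p), snd p) \<in> strip_params r}"

lemma open_sector_params: "open (sector_params r)"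
proof -
  have "open (((- \<real>\<^sub>\<le>\<^sub>0) \<times> UNIV) \<inter> (\<lambda>p. (Ln (fst p), snd p)) -` strip_params r)"
    by (intro continuous_open_preimage open_Times slit_plane open_UNIV open_strip_params)
       (auto intro!: continuous_intros)
  also have "\<dots> = sector_params r" by (auto simp: sector_params_def)
  finally show ?thesis .
qed

definition stable_phi_sector :: "real \<Rightarrow> complex \<times> complex \<Rightarrow> complex" where
  "stable_phi_sector r p = stable_phi_at_exp r (Ln (fst p), snd p)"

lemma holomorphic2_on_stable_phi_sector:
  assumes r: "0 < r" "r < pi"
  shows "stable_phi_sector r holomorphic2_on sector_params r"
  unfolding stable_phi_sector_def[abs_def]
  by (rule holomorphic2_on_compose_fst[OF holomorphic2_on_stable_phi_at_exp[OF r], where A = "- \<real>\<^sub>\<le>\<^sub>0"])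
     (auto intro!: holomorphic_intros simp: sector_params_def)

lemma stable_phi_sector_product:
  assumes r: "0 < r" "r < pi" and p: "p \<in> sector_params r" "p \<in> upper_params"
  shows "stable_phi_sector r p * double_qpoch_Ln (- r) p = double_qpoch_Ln r p"
  unfolding stable_phi_sector_def double_qpoch_Ln_def
  by (rule stable_phi_at_exp_product[OF r])
     (use p in \<open>auto simp: sector_params_def strip_params_def upper_params_eq\<close>)

lemma stable_phi_sector_real:
  assumes "0 < \<rho>" "\<rho> < 1" "z > 0" "\<alpha> > 0"
  shows "stable_phi_sector (pi * \<rho>) (of_real z, of_real \<alpha>) = stable_phi_real z \<alpha> \<rho>"
  using assms by (simp add: stable_phi_sector_def stable_phi_real_eq Ln_of_real)

lemma real_params_subset_sector:
  assumes r: "0 < r" "r < pi" shows "real_params \<subseteq> sector_params r"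
  using r by (auto simp: real_params_def sector_params_def strip_params_def Ln_of_real complex_nonpos_Reals_iff)

lemma qpoch_nonzero_of_norm_less_1:
  assumes "norm a < 1" "norm q < 1"
  shows "qpoch_inf a q \<noteq> 0"
  unfolding qpoch_nonzero_iff[OF assms(2)]
proof
  fix k
  have "norm (a * q ^ k) \<le> norm a * 1"
    unfolding norm_mult norm_power using assms by (intro mult_left_mono power_le_one) auto
  thus "a * q ^ k \<noteq> 1" using assms by auto
qed

text \<open>
  By the identity theorem one nonzero value suffices, and at \<open>z = 1\<close>, \<open>\<alpha> = \<i>\<close> all factors differ
  from 0 since both first arguments have norm below 1.
\<close>

lemma double_qpoch_Ln_not_locally_zero:
  assumes r: "\<bar>r\<bar> < pi" and V: "open V" "V \<noteq> {}" "V \<subseteq> upper_params"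
  shows "\<exists>p\<in>V. double_qpoch_Ln r p \<noteq> 0"
proof (rule ccontr)
  assume *: "\<not> (\<exists>p\<in>V. double_qpoch_Ln r p \<noteq> 0)"
  have "double_qpoch_Ln r (1, \<i>) = 0"
    by (rule holomorphic2_eq_zero_open[OF holomorphic2_on_double_qpoch_Ln[unfolded upper_params_eq] slit_plane upper_half_plane])
       (use V * in \<open>auto simp: upper_params_eq complex_nonpos_Reals_iff\<close>)
  moreover have "double_qpoch_Ln r (1, \<i>) \<noteq> 0"
  proof -
    have nome: "norm (exp (2 * of_real pi * \<i> * \<i>)) < 1" "norm (exp (- (2 * of_real pi * \<i>) / \<i>)) < 1"
      by (rule norm_nomes_less_1; simp)+
    have "qpoch_inf (- exp (0 - \<i> * of_real pi / \<i> - \<i> * of_real r)) (exp (- (2 * of_real pi * \<i>) / \<i>)) \<noteq> 0"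
      by (rule qpoch_nonzero_of_norm_less_1[OF _ nome(2)]) (simp add: norm_exp_eq_Re)
    moreover have "qpoch_inf (- exp (\<i> * (0 + \<i> * of_real pi + \<i> * of_real r))) (exp (2 * of_real pi * \<i> * \<i>)) \<noteq> 0"
      by (rule qpoch_nonzero_of_norm_less_1[OF _ nome(1)]) (use r in \<open>auto simp: norm_exp_eq_Re\<close>)
    ultimately show ?thesis by (simp add: double_qpoch_Ln_def double_qpoch_def)
  qed
  ultimately show False by simp
qed


lemma subset_closure_nonzeroI:
  assumes "\<And>V. open V \<Longrightarrow> V \<noteq> {} \<Longrightarrow> V \<subseteq> U \<Longrightarrow> \<exists>x\<in>V. P x" "open U"
  shows "U \<subseteq> closure {x \<in> U. P x}"
proof
  fix x assume x: "x \<in> U"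
  show "x \<in> closure {x \<in> U. P x}"
    unfolding closure_iff_nhds_not_empty
  proof (intro allI impI)
    fix A V assume "V \<subseteq> A" "open V" "x \<in> V"
    thus "{x \<in> U. P x} \<inter> A \<noteq> {}"
      using assms(1)[of "U \<inter> V"] assms(2) x by blast
  qed
qed

lemma closure_subset_open_nonemptyD:
  assumes "U \<subseteq> closure {x \<in> U. P x}" "open V" "V \<noteq> {}" "V \<subseteq> U"
  shows "\<exists>x\<in>V. P x"
proof -
  obtain x where "x \<in> V" using assms by blast
  hence "{x \<in> U. P x} \<inter> V \<noteq> {}"
    using assms by (metis closure_iff_nhds_not_empty subset_eq)
  thus ?thesis by blast
qed

lemma continuous_eq_zero_dense:
  fixes F :: "'a :: t2_space \<Rightarrow> complex"
  assumes F: "continuous_on V F" and V: "open V" and dense: "\<And>V'. open V' \<Longrightarrow> V' \<noteq> {} \<Longrightarrow> V' \<subseteq> V \<Longrightarrow> \<exists>x\<in>V'. F x = 0"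
    and x: "x \<in> V"
  shows "F x = 0"
proof (rule ccontr)
  assume "F x \<noteq> 0"
  have "open (V \<inter> F -` (- {0}))"
    by (rule continuous_open_preimage[OF F V]) auto
  from dense[OF this] \<open>F x \<noteq> 0\<close> x show False by auto
qed

text \<open>
  The local condition in the definition of meromorphy, named so that it can be restricted
  to smaller neighbourhoods.
\<close>

definition quotient_chart ::
    "(complex \<times> complex \<Rightarrow> complex) \<Rightarrow> complex \<times> complex \<Rightarrow> (complex \<times> complex) set \<Rightarrow>
     (complex \<times> complex \<Rightarrow> complex) \<Rightarrow> (complex \<times> complex \<Rightarrow> complex) \<Rightarrow> bool" where
  "quotient_chart \<Phi> p U f g \<longleftrightarrow>
     open U \<and> p \<in> U \<and> f holomorphic2_on U \<and> g holomorphic2_on U \<and>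
     U \<subseteq> closure {x \<in> U. g x \<noteq> 0} \<and>
     (\<forall>x\<in>U. g x \<noteq> 0 \<longrightarrow> \<Phi> x = f x / g x) \<and>
     (g p = 0 \<longrightarrow> \<Phi> p = 0 \<and>
        \<not> (\<exists>V h. open V \<and> p \<in> V \<and> V \<subseteq> U \<and> h holomorphic2_on V \<and> (\<forall>x\<in>V. h x * g x = f x)))"

lemma nicely_meromorphic2_on_iff_charts:
  "\<Phi> nicely_meromorphic2_on A \<longleftrightarrow> (\<forall>p\<in>A. \<exists>U f g. quotient_chart \<Phi> p U f g)"
  by (simp only: nicely_meromorphic2_on_def quotient_chart_def)

lemma quotient_chartI:
  assumes "open U" "p \<in> U" "f holomorphic2_on U" "g holomorphic2_on U"
    and "\<And>V. open V \<Longrightarrow> V \<noteq> {} \<Longrightarrow> V \<subseteq> U \<Longrightarrow> \<exists>x\<in>V. g x \<noteq> 0"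
    and "\<And>x. x \<in> U \<Longrightarrow> g x \<noteq> 0 \<Longrightarrow> \<Phi> x = f x / g x"
    and "g p = 0 \<Longrightarrow> \<Phi> p = 0"
    and "\<And>V h. g p = 0 \<Longrightarrow> open V \<Longrightarrow> p \<in> V \<Longrightarrow> V \<subseteq> U \<Longrightarrow> h holomorphic2_on V \<Longrightarrow>
           \<exists>x\<in>V. h x * g x \<noteq> f x"
  shows "quotient_chart \<Phi> p U f g"
  unfolding quotient_chart_def
proof (intro conjI impI)
  show "U \<subseteq> closure {x \<in> U. g x \<noteq> 0}"
    using assms(5) assms(1) by (rule subset_closure_nonzeroI)
qed (use assms(1-4,6-) in blast)+

lemma quotient_chartD:
  assumes "quotient_chart \<Phi> p U f g"
  shows "open U" "p \<in> U" "f holomorphic2_on U" "g holomorphic2_on U"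
    and "\<And>V. open V \<Longrightarrow> V \<noteq> {} \<Longrightarrow> V \<subseteq> U \<Longrightarrow> \<exists>x\<in>V. g x \<noteq> 0"
    and "\<And>x. x \<in> U \<Longrightarrow> g x \<noteq> 0 \<Longrightarrow> \<Phi> x = f x / g x"
    and "g p = 0 \<Longrightarrow> \<Phi> p = 0"
    and "\<And>V h. g p = 0 \<Longrightarrow> open V \<Longrightarrow> p \<in> V \<Longrightarrow> V \<subseteq> U \<Longrightarrow> h holomorphic2_on V \<Longrightarrow>
           \<exists>x\<in>V. h x * g x \<noteq> f x"
proof -
  note * = assms[unfolded quotient_chart_def]
  show "open U" "p \<in> U" "f holomorphic2_on U" "g holomorphic2_on U"
    using * by blast+
  have "U \<subseteq> closure {x \<in> U. g x \<noteq> 0}" using * by blast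
  thus "\<exists>x\<in>V. g x \<noteq> 0" if "open V" "V \<noteq> {}" "V \<subseteq> U" for V
    using that by (rule closure_subset_open_nonemptyD)
  show "\<Phi> x = f x / g x" if "x \<in> U" "g x \<noteq> 0" for x using * that by blast
  show "\<Phi> p = 0" if "g p = 0" using * that by blast
  show "\<exists>x\<in>V. h x * g x \<noteq> f x"
    if "g p = 0" "open V" "p \<in> V" "V \<subseteq> U" "h holomorphic2_on V" for V h
    using * that by blast
qed

lemma quotient_chart_holomorphic:
  assumes "open U" "p \<in> U" "h holomorphic2_on U" "\<And>x. x \<in> U \<Longrightarrow> \<Phi> x = h x"
  shows "quotient_chart \<Phi> p U h (\<lambda>_. 1)"
  by (rule quotient_chartI) (use assms in \<open>auto intro: holomorphic2_on_const\<close>)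

lemma quotient_chart_subset:
  assumes chart: "quotient_chart \<Phi> p U f g" and V: "open V" "p \<in> V" "V \<subseteq> U"
    and eq: "\<And>x. x \<in> V \<Longrightarrow> \<Psi> x = \<Phi> x"
  shows "quotient_chart \<Psi> p V f g"
proof (rule quotient_chartI)
  show "f holomorphic2_on V" "g holomorphic2_on V"
    using quotient_chartD(3,4)[OF chart] V(3) by (auto intro: holomorphic2_on_subset)
  show "\<exists>x\<in>V'. g x \<noteq> 0" if "open V'" "V' \<noteq> {}" "V' \<subseteq> V" for V'
    using quotient_chartD(5)[OF chart] that V(3) by blast
  show "\<exists>x\<in>V'. h x * g x \<noteq> f x" if "g p = 0" "open V'" "p \<in> V'" "V' \<subseteq> V" "h holomorphic2_on V'" for V' h
    using quotient_chartD(8)[OF chart that(1,2,3)] that V(3) by blast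
qed (use V eq quotient_chartD(6,7)[OF chart] in auto)

lemma open_nonzero_set:
  assumes "g holomorphic2_on U" "open U"
  shows "open (U \<inter> g -` (- {0}))"
  using assms by (intro continuous_open_preimage holomorphic2_on_continuous) auto

text \<open>
  The value at a point is that of any local holomorphic solution \<open>h\<close> of \<open>h D = N\<close>, and 0 if there is
  none. Local solutions agree because \<open>D\<close> vanishes on no open set. Thus the normalisation required
  of a meromorphic function holds without any analysis of the common zeros of \<open>N\<close> and \<open>D\<close>.
\<close>

lemma normalised_quotient_exists:
  assumes N: "N holomorphic2_on W" and D: "D holomorphic2_on W" and W: "open W"
    and dense: "\<And>V. open V \<Longrightarrow> V \<noteq> {} \<Longrightarrow> V \<subseteq> W \<Longrightarrow> \<exists>p\<in>V. D p \<noteq> 0"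
  obtains \<Phi> where "\<Phi> nicely_meromorphic2_on W"
    "\<And>p V h. p \<in> V \<Longrightarrow> open V \<Longrightarrow> V \<subseteq> W \<Longrightarrow> h holomorphic2_on V \<Longrightarrow>
        (\<And>x. x \<in> V \<Longrightarrow> h x * D x = N x) \<Longrightarrow> \<Phi> p = h p"
proof -
  define ext where "ext = (\<lambda>p V h. open V \<and> p \<in> V \<and> V \<subseteq> W \<and> h holomorphic2_on V \<and> (\<forall>x\<in>V. h x * D x = N x))"
  define \<Phi> where "\<Phi> = (\<lambda>p. if \<exists>V h. ext p V h then (THE y. \<exists>V h. ext p V h \<and> y = h p) else 0)"
  have uniq: "h p = h' p" if "ext p V h" "ext p V' h'" for p V h V' h'
  proof -
    have "(\<lambda>x. h x - h' x) p = 0"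
    proof (rule continuous_eq_zero_dense[of "V \<inter> V'"])
      show "continuous_on (V \<inter> V') (\<lambda>x. h x - h' x)"
        using that by (auto simp: ext_def intro!: continuous_intros intro: continuous_on_subset dest!: holomorphic2_on_continuous)
      show "\<exists>x\<in>U. h x - h' x = 0" if U: "open U" "U \<noteq> {}" "U \<subseteq> V \<inter> V'" for U
      proof -
        have "U \<subseteq> W" using \<open>ext p V h\<close> U by (auto simp: ext_def)
        then obtain x where x: "x \<in> U" "D x \<noteq> 0" using dense U by blast
        have "h x * D x = N x" "h' x * D x = N x"
          using \<open>ext p V h\<close> \<open>ext p V' h'\<close> x(1) U(3) by (auto simp: ext_def)
        hence "h x * D x = h' x * D x" by simp
        thus ?thesis using x by auto
      qed
    qed (use that in \<open>auto simp: ext_def\<close>)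
    thus ?thesis by simp
  qed
  have \<Phi>_ext: "\<Phi> p = h p" if "ext p V h" for p V h
  proof -
    have "(THE y. \<exists>V h. ext p V h \<and> y = h p) = h p"
      using that uniq by (intro the_equality) blast+
    thus ?thesis using that by (auto simp: \<Phi>_def)
  qed
  have "\<Phi> nicely_meromorphic2_on W"
    unfolding nicely_meromorphic2_on_iff_charts
  proof
    fix p assume p: "p \<in> W"
    show "\<exists>U f g. quotient_chart \<Phi> p U f g"
    proof (cases "\<exists>V h. ext p V h")
      case True
      then obtain V h where Vh: "ext p V h" by blast
      have "quotient_chart \<Phi> p V h (\<lambda>_. 1)"
      proof (rule quotient_chart_holomorphic)
        show "\<Phi> x = h x" if "x \<in> V" for x
          using Vh that by (intro \<Phi>_ext[of x V]) (auto simp: ext_def)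
      qed (use Vh in \<open>auto simp: ext_def\<close>)
      thus ?thesis by blast
    next
      case False
      have ext_nz: "ext x (W \<inter> D -` (- {0})) (\<lambda>x. N x / D x)" if "x \<in> W" "D x \<noteq> 0" for x
        unfolding ext_def
      proof (intro conjI)
        show "open (W \<inter> D -` (- {0}))"
          by (rule open_nonzero_set[OF D W])
        show "(\<lambda>x. N x / D x) holomorphic2_on (W \<inter> D -` (- {0}))"
          by (intro holomorphic2_intros holomorphic2_on_subset[OF N] holomorphic2_on_subset[OF D]) auto
      qed (use that in auto)
      have "quotient_chart \<Phi> p W N D"
      proof (rule quotient_chartI[OF W p N D dense])
        show "\<Phi> x = N x / D x" if "x \<in> W" "D x \<noteq> 0" for x
          by (rule \<Phi>_ext[OF ext_nz[OF that]])
        show "\<Phi> p = 0" unfolding \<Phi>_def by (rule if_not_P[OF False])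
        show "\<exists>x\<in>V. h x * D x \<noteq> N x" if "open V" "p \<in> V" "V \<subseteq> W" "h holomorphic2_on V" for V h
        proof (rule ccontr)
          assume "\<not> ?thesis"
          hence "ext p V h" using that by (simp add: ext_def)
          with False show False by blast
        qed
      qed
      thus ?thesis by blast
    qed
  qed
  moreover have "\<Phi> p = h p" if "p \<in> V" "open V" "V \<subseteq> W" "h holomorphic2_on V"
        "\<And>x. x \<in> V \<Longrightarrow> h x * D x = N x" for p V h
    using that by (intro \<Phi>_ext[of p V]) (auto simp: ext_def)
  ultimately show ?thesis using that by blast
qed

text \<open>
  Above the real \<open>\<alpha>\<close>-axis the continuation is the normalised quotient of products, elsewhere it is given by
  the integral; near the real parameters the two agree by the product formula.
\<close>

lemma stable_phi_continuation_exists: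
  assumes \<rho>: "0 < \<rho>" "\<rho> < 1"
  shows "\<exists>\<Phi>. is_stable_phi_continuation \<rho> \<Phi>"
proof -
  define r where "r = pi * \<rho>"
  have r: "0 < r" "r < pi" using \<rho> by (auto simp: r_def)
  obtain \<Psi> where \<Psi>: "\<Psi> nicely_meromorphic2_on upper_params"
    "\<And>p V h. p \<in> V \<Longrightarrow> open V \<Longrightarrow> V \<subseteq> upper_params \<Longrightarrow> h holomorphic2_on V \<Longrightarrow>
        (\<And>x. x \<in> V \<Longrightarrow> h x * double_qpoch_Ln (- r) x = double_qpoch_Ln r x) \<Longrightarrow> \<Psi> p = h p"
    by (rule normalised_quotient_exists[OF holomorphic2_on_double_qpoch_Ln[of r] holomorphic2_on_double_qpoch_Ln[of "- r"] open_upper_params])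
       (use double_qpoch_Ln_not_locally_zero[of "- r"] r in auto)
  define \<Phi> where "\<Phi> = (\<lambda>p. if p \<in> upper_params then \<Psi> p else stable_phi_sector r p)"
  have \<Phi>_sector: "\<Phi> p = stable_phi_sector r p" if p: "p \<in> sector_params r" for p
  proof (cases "p \<in> upper_params")
    case True
    have "\<Psi> p = stable_phi_sector r p"
    proof (rule \<Psi>(2))
      show "p \<in> sector_params r \<inter> upper_params" using p True by simp
      show "open (sector_params r \<inter> upper_params)" by (intro open_Int open_sector_params open_upper_params)
      show "stable_phi_sector r holomorphic2_on sector_params r \<inter> upper_params"
        by (rule holomorphic2_on_subset[OF holomorphic2_on_stable_phi_sector[OF r]]) auto
    qed (use stable_phi_sector_product[OF r] in auto)
    thus ?thesis using True by (simp add: \<Phi>_def)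
  qed (simp add: \<Phi>_def)
  have "\<Phi> nicely_meromorphic2_on (real_params \<union> upper_params)"
    unfolding nicely_meromorphic2_on_iff_charts
  proof
    fix p assume "p \<in> real_params \<union> upper_params"
    then consider "p \<in> sector_params r" | "p \<in> upper_params"
      using real_params_subset_sector[OF r] by blast
    thus "\<exists>U f g. quotient_chart \<Phi> p U f g"
    proof cases
      case 1
      thus ?thesis
        using quotient_chart_holomorphic[OF open_sector_params _ holomorphic2_on_stable_phi_sector[OF r] \<Phi>_sector]
        by blast
    next
      case 2
      then obtain U f g where chart: "quotient_chart \<Psi> p U f g"
        using \<Psi>(1) unfolding nicely_meromorphic2_on_iff_charts by blast
      have "quotient_chart \<Phi> p (U \<inter> upper_params) f g"
        by (rule quotient_chart_subset[OF chart])
           (use quotient_chartD(1,2)[OF chart] 2 open_upper_params in \<open>auto simp: \<Phi>_def\<close>)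
      thus ?thesis by blast
    qed
  qed
  moreover have "\<Phi> (of_real z, of_real \<alpha>) = stable_phi_real z \<alpha> \<rho>" if "z > 0" "\<alpha> > 0" for z \<alpha> :: real
  proof -
    have "(of_real z, of_real \<alpha>) \<in> real_params" using that by (auto simp: real_params_def)
    hence "\<Phi> (of_real z, of_real \<alpha>) = stable_phi_sector r (of_real z, of_real \<alpha>)"
      using \<Phi>_sector real_params_subset_sector[OF r] by blast
    thus ?thesis using stable_phi_sector_real[OF \<rho> that] by (simp add: r_def)
  qed
  ultimately show ?thesis unfolding is_stable_phi_continuation_def by blast
qed

lemma nicely_meromorphic2_polydisc:
  assumes "\<Phi> nicely_meromorphic2_on A" "(a, b) \<in> A" "open W" "(a, b) \<in> W"
  obtains s f g where "s > 0" "ball a s \<times> ball b s \<subseteq> W" "quotient_chart \<Phi> (a, b) (ball a s \<times> ball b s) f g"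
proof -
  obtain U f g where chart: "quotient_chart \<Phi> (a, b) U f g"
    using assms(1,2) unfolding nicely_meromorphic2_on_iff_charts by blast
  obtain s where s: "s > 0" "ball a s \<times> ball b s \<subseteq> U \<inter> W"
    using open_product_ball[of "U \<inter> W" a b] quotient_chartD(1,2)[OF chart] assms(3,4) by auto
  have "quotient_chart \<Phi> (a, b) (ball a s \<times> ball b s) f g"
    by (rule quotient_chart_subset[OF chart]) (use s in \<open>auto intro!: open_Times\<close>)
  thus ?thesis using that s by blast
qed

lemma ball_product: "open (ball a s \<times> ball b s)" for a b :: "'a :: euclidean_space"
  by (intro open_Times open_ball)

text \<open>
  Agreement of \<open>\<Phi>\<close> with \<open>N / D\<close> is propagated in the form that \<open>\<Phi> D = N\<close> holds on a dense set
  near a point, since the values of \<open>\<Phi>\<close> carry no information at zeros of the local denominators. In a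
  chart \<open>\<Phi> = f / g\<close> it amounts to \<open>f D = g N\<close>, an identity of holomorphic functions. Such
  an identity extends over the whole polydisc, and hence along the connected set of parameters.
\<close>

lemma stable_phi_continuation_unique:
  assumes \<rho>: "0 < \<rho>" "\<rho> < 1" and \<Phi>: "is_stable_phi_continuation \<rho> \<Phi>"
    and p: "p \<in> upper_params"
    and no_common_zero: "double_qpoch_Ln (- (pi * \<rho>)) p \<noteq> 0 \<or> double_qpoch_Ln (pi * \<rho>) p \<noteq> 0"
  shows "\<Phi> p = double_qpoch_Ln (pi * \<rho>) p / double_qpoch_Ln (- (pi * \<rho>)) p"
proof -
  define r where "r = pi * \<rho>"
  have r: "0 < r" "r < pi" using \<rho> by (auto simp: r_def)
  define N where "N = double_qpoch_Ln r"
  define D where "D = double_qpoch_Ln (- r)"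
  have N: "N holomorphic2_on upper_params" and D: "D holomorphic2_on upper_params"
    unfolding N_def D_def by (rule holomorphic2_on_double_qpoch_Ln)+
  have mero: "\<Phi> nicely_meromorphic2_on (real_params \<union> upper_params)"
    and real: "\<And>z \<alpha>. z > 0 \<Longrightarrow> \<alpha> > 0 \<Longrightarrow> \<Phi> (of_real z, of_real \<alpha>) = stable_phi_real z \<alpha> \<rho>"
    using \<Phi> by (auto simp: is_stable_phi_continuation_def)
  define agree where "agree = (\<lambda>p. \<exists>V. open V \<and> p \<in> V \<and> V \<subseteq> upper_params \<and>
      (\<forall>V'. open V' \<longrightarrow> V' \<noteq> {} \<longrightarrow> V' \<subseteq> V \<longrightarrow> (\<exists>V''. open V'' \<and> V'' \<noteq> {} \<and> V'' \<subseteq> V' \<and> (\<forall>x\<in>V''. \<Phi> x * D x = N x))))"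
  have agreeI: "agree x"
    if U: "open U" "U \<subseteq> upper_params" "x \<in> U" "g holomorphic2_on U"
      and dense: "\<And>V. open V \<Longrightarrow> V \<noteq> {} \<Longrightarrow> V \<subseteq> U \<Longrightarrow> \<exists>y\<in>V. g y \<noteq> 0"
      and eq: "\<And>y. y \<in> U \<Longrightarrow> g y \<noteq> 0 \<Longrightarrow> \<Phi> y * D y = N y" for x U g
    unfolding agree_def
  proof (rule exI[of _ U], intro conjI allI impI)
    fix V' assume V': "open V'" "V' \<noteq> {}" "V' \<subseteq> U"
    have "V' \<inter> (U \<inter> g -` (- {0})) \<noteq> {}" using dense[OF V'] V'(3) by auto
    thus "\<exists>V''. open V'' \<and> V'' \<noteq> {} \<and> V'' \<subseteq> V' \<and> (\<forall>x\<in>V''. \<Phi> x * D x = N x)"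
      using V'(1) open_nonzero_set[OF U(4,1)] eq by (intro exI[of _ "V' \<inter> (U \<inter> g -` (- {0}))"]) auto
  qed (use U in auto)
  have local: "\<forall>x\<in>ball a s \<times> ball b s. f x * D x = g x * N x"
    if s: "ball a s \<times> ball b s \<subseteq> upper_params" and chart: "quotient_chart \<Phi> (a, b) (ball a s \<times> ball b s) f g"
      and x: "agree x" "x \<in> ball a s \<times> ball b s" for a b s f g x
  proof -
    let ?B = "ball a s \<times> ball b s"
    note chartD = quotient_chartD[OF chart]
    have hol: "(\<lambda>x. f x * D x - g x * N x) holomorphic2_on ?B"
      using s chartD by (intro holomorphic2_intros holomorphic2_on_subset[OF D] holomorphic2_on_subset[OF N])
    obtain V where V: "open V" "x \<in> V"
      "\<forall>V'. open V' \<longrightarrow> V' \<noteq> {} \<longrightarrow> V' \<subseteq> V \<longrightarrow> (\<exists>V''. open V'' \<and> V'' \<noteq> {} \<and> V'' \<subseteq> V' \<and> (\<forall>x\<in>V''. \<Phi> x * D x = N x))"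
      using x(1) unfolding agree_def by blast
    have "open (V \<inter> ?B)" by (rule open_Int[OF V(1) ball_product])
    moreover have "V \<inter> ?B \<noteq> {}" using V(2) x(2) by blast
    ultimately obtain V1 where V1: "open V1" "V1 \<noteq> {}" "V1 \<subseteq> V \<inter> ?B" "\<forall>x\<in>V1. \<Phi> x * D x = N x"
      using V(3) by (meson inf_le1)
    have "open (?B \<inter> g -` (- {0}))"
      by (rule open_nonzero_set[OF chartD(4) ball_product])
    moreover have "V1 \<inter> (?B \<inter> g -` (- {0})) \<noteq> {}" using chartD(5)[OF V1(1,2)] V1(3) by auto
    ultimately have V2: "open (V1 \<inter> (?B \<inter> g -` (- {0})))" "V1 \<inter> (?B \<inter> g -` (- {0})) \<noteq> {}"
      using V1(1) by auto
    have "f y * D y - g y * N y = 0" if "y \<in> V1 \<inter> (?B \<inter> g -` (- {0}))" for y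
    proof -
      have "\<Phi> y = f y / g y" "g y \<noteq> 0" and N_eq: "N y = \<Phi> y * D y"
        using that chartD(6)[of y] V1(4) by auto
      hence f_eq: "f y = \<Phi> y * g y" by simp
      show ?thesis unfolding f_eq N_eq by simp
    qed
    note zero = this
    have "(\<lambda>x. f x * D x - g x * N x) y = 0" if "y \<in> ?B" for y
      by (rule holomorphic2_eq_zero_open[OF hol open_ball connected_ball open_ball connected_ball V2])
         (use zero that in blast)+
    thus ?thesis by simp
  qed
  have local': "agree x"
    if s: "ball a s \<times> ball b s \<subseteq> upper_params" and chart: "quotient_chart \<Phi> (a, b) (ball a s \<times> ball b s) f g"
      and eq: "\<forall>x\<in>ball a s \<times> ball b s. f x * D x = g x * N x"
      and x: "x \<in> ball a s \<times> ball b s" for a b s f g x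
  proof (rule agreeI[OF ball_product s x quotient_chartD(4,5)[OF chart]])
    fix y assume y: "y \<in> ball a s \<times> ball b s" "g y \<noteq> 0"
    hence "\<Phi> y = f y / g y" "f y * D y = g y * N y"
      using quotient_chartD(6)[OF chart, of y] eq by auto
    hence "g y * (\<Phi> y * D y) = g y * N y" using y by simp
    thus "\<Phi> y * D y = N y" using y by simp
  qed
  \<comment> \<open>Near \<open>z = \<alpha> = 1\<close> real points determine \<open>f / g\<close>. The extra factor \<open>g\<close> in \<open>F\<close> makes \<open>F\<close> vanish also at real zeros of \<open>g\<close>.\<close>
  obtain p1 where p1: "p1 \<in> upper_params" "agree p1"
  proof -
    have R: "(1, 1) \<in> real_params"
      unfolding real_params_def by (auto intro!: exI[of _ "1 :: real"])
    hence "(1, 1) \<in> real_params \<union> upper_params" "(1, 1) \<in> sector_params r"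
      using real_params_subset_sector[OF r] by auto
    from nicely_meromorphic2_polydisc[OF mero this(1) open_sector_params this(2)]
    obtain s f g where s: "s > 0" "ball 1 s \<times> ball 1 s \<subseteq> sector_params r"
      and chart: "quotient_chart \<Phi> (1, 1) (ball 1 s \<times> ball 1 s) f g"
      by metis
    note chartD = quotient_chartD[OF chart]
    let ?B = "ball (1 :: complex) s \<times> ball (1 :: complex) s"
    define F where "F = (\<lambda>x. g x * (f x - g x * stable_phi_sector r x))"
    have hol: "F holomorphic2_on ?B" unfolding F_def
      using s chartD by (intro holomorphic2_intros holomorphic2_on_subset[OF holomorphic2_on_stable_phi_sector[OF r]])
    define X where "X = (of_real :: real \<Rightarrow> complex) ` ({1 - s<..<1 + s} \<inter> {0<..})"
    have "dist (1 :: complex) (of_real x) = \<bar>1 - x\<bar>" for x :: real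
      using dist_of_real[of 1 x, where 'a = complex] by (simp add: dist_real_def)
    hence "X \<subseteq> ball 1 s" by (auto simp: X_def)
    have lim: "1 islimpt X"
      using islimpt_of_real_image[of "{1 - s<..<1 + s} \<inter> {0<..}" 1] s(1) by (simp add: X_def open_Int)
    have F0: "F (z, w) = 0" if zw: "z \<in> ball 1 s" "w \<in> ball 1 s" for z w
    proof (rule holomorphic2_eq_zero[OF hol open_ball connected_ball open_ball connected_ball _ _ lim _ _ lim])
      fix x y assume xy: "x \<in> X" "y \<in> X"
      then obtain x' y' where x': "x = of_real x'" "y = of_real y'" "x' > 0" "y' > 0"
        by (auto simp: X_def)
      have "(x, y) \<in> ?B" using xy \<open>X \<subseteq> ball 1 s\<close> by blast
      hence "g (x, y) = 0 \<or> \<Phi> (x, y) = f (x, y) / g (x, y)"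
        using chartD(6) by blast
      moreover have "\<Phi> (x, y) = stable_phi_sector r (x, y)"
        using real[of x' y'] stable_phi_sector_real[OF \<rho>, of x' y'] x' by (simp add: r_def)
      ultimately show "F (x, y) = 0"
        by (cases "g (x, y) = 0") (simp_all add: F_def)
    qed (use \<open>X \<subseteq> ball 1 s\<close> zw s in auto)
    define p1 where "p1 = (1 :: complex, 1 + \<i> * of_real (s / 2))"
    have p1: "p1 \<in> ?B" "p1 \<in> upper_params"
      using s(1) by (auto simp: p1_def upper_params_eq dist_norm norm_mult complex_nonpos_Reals_iff)
    have "agree p1"
    proof (rule agreeI[of "?B \<inter> upper_params" p1 g])
      fix y assume y: "y \<in> ?B \<inter> upper_params" "g y \<noteq> 0"
      hence "\<Phi> y = f y / g y" "F y = 0" using chartD(6)[of y] F0 by auto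
      hence "\<Phi> y = stable_phi_sector r y" using y by (auto simp: F_def field_simps)
      thus "\<Phi> y * D y = N y"
        using stable_phi_sector_product[OF r, of y] y s(2) by (auto simp: N_def D_def)
    qed (use p1 chartD(4,5) open_Int[OF ball_product open_upper_params] in
          \<open>auto intro: holomorphic2_on_subset\<close>)
    thus ?thesis using that p1 by blast
  qed
  have "agree p"
  proof (rule connected_induction_simple[where P = agree, OF connected_upper_params p1(1) p p1(2)])
    fix x assume x: "x \<in> upper_params"
    obtain a b where ab: "x = (a, b)" by (cases x)
    from nicely_meromorphic2_polydisc[OF mero, of a b upper_params] x
    obtain s f g where s: "s > 0" "ball a s \<times> ball b s \<subseteq> upper_params"
      and chart: "quotient_chart \<Phi> (a, b) (ball a s \<times> ball b s) f g"
      unfolding ab using open_upper_params by (metis UnI2)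
    have "agree w" if "agree v" "v \<in> ball a s \<times> ball b s" "w \<in> ball a s \<times> ball b s" for v w
      by (rule local'[OF s(2) chart local[OF s(2) chart that(1,2)] that(3)])
    moreover have "openin (top_of_set upper_params) (ball a s \<times> ball b s)"
      using s(2) ball_product by (intro open_subset) auto
    moreover have "x \<in> ball a s \<times> ball b s" using s(1) ab by auto
    ultimately show "\<exists>T. openin (top_of_set upper_params) T \<and> x \<in> T \<and> (\<forall>x\<in>T. \<forall>y\<in>T. agree x \<longrightarrow> agree y)"
      by blast
  qed
  \<comment> \<open>At a zero of \<open>g\<close> also \<open>D\<close> vanishes, as otherwise \<open>N / D\<close> would be a holomorphic extension of \<open>f / g\<close>.\<close>
  obtain a b where ab: "p = (a, b)" by (cases p)
  have pU: "(a, b) \<in> real_params \<union> upper_params" "(a, b) \<in> upper_params" using p ab by auto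
  obtain s f g where s: "s > 0" "ball a s \<times> ball b s \<subseteq> upper_params"
    and chart: "quotient_chart \<Phi> p (ball a s \<times> ball b s) f g"
    unfolding ab by (rule nicely_meromorphic2_polydisc[OF mero pU(1) open_upper_params pU(2)])
  note chartD = quotient_chartD[OF chart]
  let ?B = "ball a s \<times> ball b s"
  have pB: "p \<in> ?B" using s(1) ab by auto
  have eq: "\<forall>x\<in>?B. f x * D x = g x * N x"
    by (rule local[OF s(2) chart[unfolded ab] \<open>agree p\<close> pB])
  have "\<Phi> p = N p / D p"
  proof (cases "g p = 0")
    case False
    hence "\<Phi> p = f p / g p" using chartD(6) pB by blast
    hence f_eq: "f p = \<Phi> p * g p" using False by simp
    have fD: "f p * D p = g p * N p" using eq pB by blast
    hence "g p * (\<Phi> p * D p) = g p * N p" by (simp add: f_eq)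
    hence \<Phi>D: "\<Phi> p * D p = N p" using False by simp
    hence "D p \<noteq> 0" using no_common_zero by (auto simp: N_def D_def r_def)
    thus ?thesis using \<Phi>D by (simp add: eq_divide_eq)
  next
    case True
    have "D p = 0"
    proof (rule ccontr)
      assume nz: "D p \<noteq> 0"
      let ?V = "?B \<inter> D -` (- {0})"
      have "open ?V"
        by (rule open_nonzero_set[OF holomorphic2_on_subset[OF D s(2)] ball_product])
      moreover have "(\<lambda>x. N x / D x) holomorphic2_on ?V"
        using s(2) by (intro holomorphic2_intros holomorphic2_on_subset[OF N] holomorphic2_on_subset[OF D]) auto
      ultimately obtain x where x: "x \<in> ?V" "N x / D x * g x \<noteq> f x"
        using chartD(8)[of ?V "\<lambda>x. N x / D x"] True pB nz by auto
      moreover have "f x * D x = g x * N x" using x eq by blast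
      ultimately show False by (auto simp: field_simps)
    qed
    thus ?thesis using chartD(7) True by simp
  qed
  thus ?thesis by (simp add: N_def D_def r_def)
qed

text \<open>
  A zero of either product makes \<open>\<alpha>(t + \<i>(\<pi>(2k + 1) \<plusminus> r))\<close> equal to an odd multiple of \<open>\<pi>\<i>\<close>. For a
  common zero the difference says that \<open>\<alpha>\<close> times the real number \<open>2\<pi>(k - k') + 2r\<close> is real. As
  \<open>Im \<alpha> \<noteq> 0\<close>, that number is 0, which \<open>0 < r < \<pi>\<close> excludes.
\<close>

lemma q_factors_no_common_zero:
  assumes r: "0 < r" "r < pi" and \<alpha>: "Im \<alpha> > 0"
  shows "qpoch_inf (- exp (\<alpha> * (t + \<i> * of_real pi + \<i> * of_real (- r)))) (exp (2 * of_real pi * \<i> * \<alpha>)) \<noteq> 0 \<or>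
         qpoch_inf (- exp (\<alpha> * (t + \<i> * of_real pi + \<i> * of_real r))) (exp (2 * of_real pi * \<i> * \<alpha>)) \<noteq> 0"
proof (rule ccontr)
  have zeros: "\<exists>k m :: int. \<alpha> * (t + \<i> * of_real (pi * (2 * of_int k + 1) + s)) = \<i> * of_real (pi * (2 * of_int m + 1))"
    if zero: "qpoch_inf (- exp (\<alpha> * (t + \<i> * of_real pi + \<i> * of_real s))) (exp (2 * of_real pi * \<i> * \<alpha>)) = 0" for s
  proof -
    obtain k where "- exp (\<alpha> * (t + \<i> * of_real pi + \<i> * of_real s)) * exp (2 * of_real pi * \<i> * \<alpha>) ^ k = 1"
      using zero qpoch_nonzero_iff[OF norm_nomes_less_1(1)[OF \<alpha>],
          of "- exp (\<alpha> * (t + \<i> * of_real pi + \<i> * of_real s))"] by auto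
    moreover have "exp (\<alpha> * (t + \<i> * of_real pi + \<i> * of_real s)) * exp (2 * of_real pi * \<i> * \<alpha>) ^ k =
          exp (\<alpha> * (t + \<i> * of_real (pi * (2 * of_int (int k) + 1) + s)))"
      unfolding exp_of_nat_mult[symmetric] exp_add[symmetric] by (simp add: algebra_simps)
    ultimately have "1 + exp (\<alpha> * (t + \<i> * of_real (pi * (2 * of_int (int k) + 1) + s))) = 0"
      by (simp add: add_eq_0_iff minus_equation_iff)
    thus ?thesis unfolding one_plus_exp_eq_0_iff by blast
  qed
  assume "\<not> ?thesis"
  then obtain k m k' m' :: int where
    "\<alpha> * (t + \<i> * of_real (pi * (2 * of_int k + 1) + r)) = \<i> * of_real (pi * (2 * of_int m + 1))"
    "\<alpha> * (t + \<i> * of_real (pi * (2 * of_int k' + 1) + (- r))) = \<i> * of_real (pi * (2 * of_int m' + 1))"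
    using zeros[of r] zeros[of "- r"] by auto
  hence "\<alpha> * (t + \<i> * of_real (pi * (2 * of_int k + 1) + r)) - \<alpha> * (t + \<i> * of_real (pi * (2 * of_int k' + 1) + (- r))) =
      \<i> * of_real (pi * (2 * of_int m + 1)) - \<i> * of_real (pi * (2 * of_int m' + 1))"
    by (simp only:)
  hence "\<i> * (\<alpha> * of_real (2 * pi * of_int (k - k') + 2 * r)) = \<i> * of_real (2 * pi * of_int (m - m'))"
    by (simp add: algebra_simps)
  hence eq: "\<alpha> * of_real (2 * pi * of_int (k - k') + 2 * r) = of_real (2 * pi * of_int (m - m'))"
    by (metis complex_i_not_zero mult_left_cancel)
  have Im_of_real_mult: "Im (\<alpha> * of_real c) = Im \<alpha> * c" for c by simp
  have "Im (\<alpha> * of_real (2 * pi * of_int (k - k') + 2 * r)) = Im (of_real (2 * pi * of_int (m - m')))"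
    by (simp only: eq)
  hence "Im \<alpha> * (2 * pi * of_int (k - k') + 2 * r) = 0"
    unfolding Im_of_real_mult Im_complex_of_real .
  hence "2 * pi * of_int (k - k') + 2 * r = 0" using \<alpha> by (simp only: mult_eq_0_iff) simp
  hence r_eq: "r = pi * of_int (k' - k)" by (simp add: algebra_simps)
  have "0 < real_of_int (k' - k)" using r(1) unfolding r_eq by (simp add: zero_less_mult_iff del: of_int_diff)
  moreover have "pi * real_of_int (k' - k) < pi * 1" using r(2) unfolding r_eq by simp
  hence "real_of_int (k' - k) < 1" by (simp only: mult_less_cancel_left_pos[OF pi_gt_zero])
  ultimately have "0 < k' - k" "k' - k < 1"
    by (simp_all only: of_int_0_less_iff of_int_less_1_iff)
  thus False by linarith
qed

lemma double_qpoch_Ln_explicit: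
  assumes "z \<noteq> 0"
  shows "double_qpoch_Ln (pi * s) (z, \<alpha>) =
    qpoch_inf (- z * exp (- of_real pi * \<i> / \<alpha>) * exp (- of_real pi * \<i> * of_real s)) (exp (- 2 * of_real pi * \<i> / \<alpha>)) *
    qpoch_inf (- (z powr \<alpha>) * exp (of_real pi * \<i> * \<alpha>) * exp (of_real pi * \<i> * of_real s * \<alpha>)) (exp (2 * of_real pi * \<i> * \<alpha>))"
proof -
  have "exp (Ln z - \<i> * of_real pi / \<alpha> - \<i> * of_real (pi * s)) =
          exp (Ln z) * exp (- of_real pi * \<i> / \<alpha>) * exp (- of_real pi * \<i> * of_real s)"
    unfolding exp_add[symmetric] by (simp add: algebra_simps)
  moreover have "exp (\<alpha> * (Ln z + \<i> * of_real pi + \<i> * of_real (pi * s))) =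
          z powr \<alpha> * exp (of_real pi * \<i> * \<alpha>) * exp (of_real pi * \<i> * of_real s * \<alpha>)"
    unfolding powr_def using assms by (simp add: algebra_simps flip: exp_add)
  ultimately show ?thesis
    using assms by (simp add: double_qpoch_Ln_def double_qpoch_def)
qed

theorem theorem3:
  fixes \<rho> :: real and \<alpha> z q qt sqrt_q sqrt_qt :: complex
  assumes "0 < \<rho>" and "\<rho> < 1"
    and "Im \<alpha> > 0"
    and "q = exp (2 * of_real pi * \<i> * \<alpha>)"
    and "qt = exp (- 2 * of_real pi * \<i> / \<alpha>)"
    and "sqrt_q = exp (of_real pi * \<i> * \<alpha>)"
    and "sqrt_qt = exp (- of_real pi * \<i> / \<alpha>)"
    and "norm z < min (sqrt (norm q)) (sqrt (norm qt))"
    and "z \<noteq> 0" and "\<bar>Arg z\<bar> < pi"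
  shows "stable_phi z \<alpha> \<rho> =
    (qpoch_inf (- z * sqrt_qt * exp (- of_real pi * \<i> * of_real \<rho>)) qt *
     qpoch_inf (- (z powr \<alpha>) * sqrt_q * exp (of_real pi * \<i> * of_real \<rho> * \<alpha>)) q) /
    (qpoch_inf (- z * sqrt_qt * exp (of_real pi * \<i> * of_real \<rho>)) qt *
     qpoch_inf (- (z powr \<alpha>) * sqrt_q * exp (- of_real pi * \<i> * of_real \<rho> * \<alpha>)) q)"
proof -
  note \<rho> = assms(1,2) and q_defs = assms(4-7)
  have r: "0 < pi * \<rho>" "pi * \<rho> < pi" using \<rho> by auto
  have p: "(z, \<alpha>) \<in> upper_params" using assms by (simp add: upper_params_def)
  have explicit: "double_qpoch_Ln (pi * s) (z, \<alpha>) =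
      qpoch_inf (- z * sqrt_qt * exp (- of_real pi * \<i> * of_real s)) qt *
      qpoch_inf (- (z powr \<alpha>) * sqrt_q * exp (of_real pi * \<i> * of_real s * \<alpha>)) q" for s
    unfolding q_defs by (rule double_qpoch_Ln_explicit[OF \<open>z \<noteq> 0\<close>])
  have qt: "norm qt < 1" using norm_nomes_less_1(2)[OF assms(3)] by (simp add: q_defs)
  have "sqrt_qt ^ 2 = qt" unfolding q_defs by (simp add: power2_eq_square mult_ac flip: exp_add)
  hence sqrt_qt: "norm sqrt_qt = sqrt (norm qt)" by (metis norm_ge_zero norm_power real_sqrt_unique)
  have "sqrt (norm qt) < 1" using qt by simp
  hence "norm z < 1" "norm sqrt_qt < 1"
    using assms(8) unfolding min_less_iff_conj sqrt_qt by linarith+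
  hence "norm z * norm sqrt_qt < 1 * 1" by (intro mult_strict_mono) auto
  hence "norm (- z * sqrt_qt * exp (- of_real pi * \<i> * of_real s)) < 1" for s
    by (simp add: norm_mult)
  hence first: "qpoch_inf (- z * sqrt_qt * exp (- of_real pi * \<i> * of_real s)) qt \<noteq> 0" for s
    using qt by (rule qpoch_nonzero_of_norm_less_1)
  have ray: "- exp (\<alpha> * (Ln z + \<i> * of_real pi + \<i> * of_real (pi * s))) =
               - (z powr \<alpha>) * sqrt_q * exp (of_real pi * \<i> * of_real s * \<alpha>)" for s
    unfolding q_defs powr_def using \<open>z \<noteq> 0\<close> by (simp add: algebra_simps flip: exp_add)
  have "double_qpoch_Ln (- (pi * \<rho>)) (z, \<alpha>) \<noteq> 0 \<or> double_qpoch_Ln (pi * \<rho>) (z, \<alpha>) \<noteq> 0"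
    using q_factors_no_common_zero[OF r assms(3), of "Ln z"] first[of \<rho>] first[of "- \<rho>"]
    unfolding minus_mult_right explicit[of \<rho>] explicit[of "- \<rho>"] ray q_defs(1)[symmetric] by simp
  moreover have "is_stable_phi_continuation \<rho> (SOME \<Phi>. is_stable_phi_continuation \<rho> \<Phi>)"
    using stable_phi_continuation_exists[OF \<rho>] by (rule someI_ex)
  ultimately have "stable_phi z \<alpha> \<rho> = double_qpoch_Ln (pi * \<rho>) (z, \<alpha>) / double_qpoch_Ln (pi * (- \<rho>)) (z, \<alpha>)"
    unfolding stable_phi_def using stable_phi_continuation_unique[OF \<rho> _ p] by simp
  thus ?thesis
    unfolding explicit by simp
qed

end
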